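(* Let $X_0,\ldots,X_n$ be a sample from a stationary FAR(1) process $X_{t+1}=\Psi(X_t)+\epsilon_{t+1}$, $-\infty<t<\infty$, in $\mathcal{H}$ with $\mathrm{E}X_t=0$, satisfying (i) $\{\epsilon_t\}$ are i.i.d. with $\mathrm{E}\epsilon_t=0$ and $\mathrm{E}\Vert\epsilon_t\Vert^4<\infty$; (ii) $\Psi$ is a Hilbert-Schmidt operator with $\Vert\Psi\Vert_{\mathcal{L}}<1$; (iii) the eigenvalues $\lambda_1>\lambda_2>\ldots$ of $\Gamma$ are all positive and have multiplicity 1. Put $a_1=\lambda_1-\lambda_2$ and $a_j=\min(\lambda_{j-1}-\lambda_j,\ \lambda_j-\lambda_{j+1})$ for $j\ge 2$. Suppose that $k_n\to\infty$, that $$\frac{k_n}{n}\sum_{j=1}^{k_n}\frac{1}{a_j^2}\to 0 \ (n\to\infty), \qquad \frac{1}{\lambda_{k_n}}=O\left(\frac{n^{1/4}}{(\log n)^{\beta}}\right)\ \text{ for some } \beta>\frac12,$$ and additionally that $$\frac{1}{\lambda_{k_n}}\sum_{j=1}^{k_n}\frac{1}{a_j}=O\left(\frac{n^{1/4}}{(\log n)^{\beta}}\right)\ \text{ for some } \beta>1 .$$ Then, with $\bar X_n=\frac1n\sum_{t=0}^{n-1}X_t$ and $\bar X_n^*=\frac1n\sum_{t=0}^{n-1}X_t^*$, $$n\, d_2^2(\bar X_n,\bar X_n^* )\to 0\quad\text{in probability as } n\to\infty .$$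
   Context: $\mathcal{H}$ is a separable Hilbert space with scalar product $\langle\cdot,\cdot\rangle$ and norm $\Vert\cdot\Vert$. For $y,z\in\mathcal{H}$, $y\otimes z$ is the linear operator $(y\otimes z)(x)=\langle y,x\rangle z$. $\Vert A\Vert_{\mathcal{L}}$ is the operator norm of a bounded linear operator $A$ on $\mathcal{H}$. A FAR(1) process is a sequence of $\mathcal{H}$-valued random variables with $X_{t+1}=\Psi(X_t)+\epsilon_{t+1}$, where $\Psi:\mathcal{H}\to\mathcal{H}$ is a linear operator and the innovations $\epsilon_t$ are i.i.d. $\mathcal{H}$-valued random variables. $\Gamma=\mathrm{E}\,X_t\otimes X_t$ is the covariance operator, with eigenvalues $\lambda_1\ge\lambda_2\ge\ldots$. Estimates: $$\hat\Gamma_n=\frac1n\sum_{j=0}^{n-1}X_j\otimes X_j,\qquad \hat C_n=\frac1n\sum_{j=0}^{n-1}X_j\otimes X_{j+1}.$$ $\hat\lambda_1\ge\hat\lambda_2\ge\ldots$ and $\hat v_1,\hat v_2,\ldots$ are the eigenvalues and corresponding orthonormal eigenvectors of $\hat\Gamma_n$. $(k_n)$ is a sequence of positive integers, $\hat\Gamma_n^\dagger=\sum_{j=1}^{k_n}\frac{1}{\hat\lambda_j}\hat v_j\otimes\hat v_j$, and $\hat\Psi_n=\hat C_n\hat\Gamma_n^\dagger$. Residual-based bootstrap: $\hat\epsilon_j=X_j-\hat\Psi_n(X_{j-1})$, $\tilde\epsilon_j=\hat\epsilon_j-\frac1n\sum_{k=1}^n\hat\epsilon_k$, $j=1,\ldots,n$,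 and $\hat F_n$ is the empirical distribution of $\tilde\epsilon_1,\ldots,\tilde\epsilon_n$. Conditionally on $X_0,\ldots,X_n$, the bootstrap innovations $\epsilon_1^*,\ldots,\epsilon_n^*$ are i.i.d. with distribution $\hat F_n$, and the bootstrap data are generated recursively by $X_t^*=\hat\Psi_n(X_{t-1}^* )+\epsilon_t^*$, $t=1,\ldots,n$, for some suitable initial value $X_0^*$ (popular choices are $X_0^*=X_0$ or $X_0^*=\mathrm{E}X_0=0$). Mallows metric: for distributions $F,G$ on $\mathcal{H}$, $d_2^2(F,G)=\inf\mathrm{E}\Vert X-Y\Vert^2$, the infimum being over all pairs of $\mathcal{H}$-valued random variables $X,Y$ with marginal distributions $F$ and $G$. $d_2(\bar X_n,\bar X_n^* )$ denotes the (random) Mallows distance between the distribution of $\bar X_n$ and the conditional distribution of $\bar X_n^*$ given $X_0,\ldots,X_n$. *)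

theory Defs
  imports "HOL-Probability.Probability" "HOL-Library.Landau_Symbols"
begin

section \<open>Operators on a real Hilbert space\<close>

definition tensor :: "'a::real_inner \<Rightarrow> 'a \<Rightarrow> 'a \<Rightarrow> 'a"  (infixr "\<otimes>\<^sub>H" 75)
  where "(y \<otimes>\<^sub>H z) x = (y \<bullet> x) *\<^sub>R z"

definition orthonormal_basis :: "'a::real_inner set \<Rightarrow> bool"
  where "orthonormal_basis B \<longleftrightarrow>
    (\<forall>e\<in>B. norm e = 1) \<and> pairwise orthogonal B \<and> closure (span B) = UNIV"

text \<open>The sum of the squares does not depend on the orthonormal basis.\<close>

definition hilbert_schmidt :: "('a::real_inner \<Rightarrow>\<^sub>L 'a) \<Rightarrow> bool"
  where "hilbert_schmidt T \<longleftrightarrow>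
    (\<exists>B. orthonormal_basis B \<and> (\<lambda>e. (norm (blinfun_apply T e))\<^sup>2) summable_on B)"

definition eigenspace :: "('a::real_vector \<Rightarrow> 'a) \<Rightarrow> real \<Rightarrow> 'a set"
  where "eigenspace T \<mu> = {x. T x = \<mu> *\<^sub>R x}"

definition eigenvalues :: "('a::real_vector \<Rightarrow> 'a) \<Rightarrow> real set"
  where "eigenvalues T = {\<mu>. \<exists>x. x \<noteq> 0 \<and> T x = \<mu> *\<^sub>R x}"

text \<open>Sequences of eigenvalues and eigenvectors are indexed from 1; the value at 0 is irrelevant.
  The set equality says that 0 is not an eigenvalue if all \<open>lam j\<close> are positive.\<close>

definition simple_positive_spectrum :: "('a::real_vector \<Rightarrow> 'a) \<Rightarrow> (nat \<Rightarrow> real) \<Rightarrow> bool"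
  where "simple_positive_spectrum T lam \<longleftrightarrow>
    eigenvalues T = lam ` {1..} \<and>
    strict_antimono_on {1..} lam \<and>
    (\<forall>j\<ge>1. 0 < lam j \<and> dim (eigenspace T (lam j)) = 1)"

text \<open>\<open>l 1 \<ge> l 2 \<ge> \<dots>\<close> are the eigenvalues of a compact positive operator \<open>T\<close>, repeated
  according to multiplicity and followed by zeros if the rank is finite, and \<open>v 1, v 2, \<dots>\<close> are
  corresponding orthonormal eigenvectors. The last clause says that no nonzero eigenvalue is
  missing or listed with too small a multiplicity.\<close>

definition eigensystem :: "('a::real_inner \<Rightarrow> 'a) \<Rightarrow> (nat \<Rightarrow> real) \<Rightarrow> (nat \<Rightarrow> 'a) \<Rightarrow> bool"
  where "eigensystem T l v \<longleftrightarrow>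
    antimono_on {1..} l \<and>
    (\<forall>i\<ge>1. \<forall>j\<ge>1. v i \<bullet> v j = (if i = j then 1 else 0)) \<and>
    (\<forall>j\<ge>1. T (v j) = l j *\<^sub>R v j) \<and>
    (\<forall>\<mu>. \<mu> \<noteq> 0 \<longrightarrow> eigenspace T \<mu> = span (v ` {j. 1 \<le> j \<and> l j = \<mu>}))"

definition spectral_gap :: "(nat \<Rightarrow> real) \<Rightarrow> nat \<Rightarrow> real"
  where "spectral_gap lam j =
    (if j = 1 then lam 1 - lam 2 else min (lam (j - 1) - lam j) (lam j - lam (j + 1)))"

section \<open>FAR(1) processes\<close>

definition strictly_stationary :: "'w measure \<Rightarrow> (int \<Rightarrow> 'w \<Rightarrow> 'a::topological_space) \<Rightarrow> bool"
  where "strictly_stationary M X \<longleftrightarrow>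
    (\<forall>t. X t \<in> borel_measurable M) \<and>
    (\<forall>h. distr M (PiM UNIV (\<lambda>_. borel)) (\<lambda>\<omega> t. X (t + h) \<omega>)
        = distr M (PiM UNIV (\<lambda>_. borel)) (\<lambda>\<omega> t. X t \<omega>))"

definition iid :: "'w measure \<Rightarrow> (int \<Rightarrow> 'w \<Rightarrow> 'a::topological_space) \<Rightarrow> bool"
  where "iid M \<epsilon> \<longleftrightarrow>
    prob_space.indep_vars M (\<lambda>_. borel) \<epsilon> UNIV \<and>
    (\<forall>s t. distr M borel (\<epsilon> s) = distr M borel (\<epsilon> t))"

definition far1 ::
  "'w measure \<Rightarrow> ('a::real_normed_vector \<Rightarrow>\<^sub>L 'a) \<Rightarrow> (int \<Rightarrow> 'w \<Rightarrow> 'a) \<Rightarrow> (int \<Rightarrow> 'w \<Rightarrow> 'a) \<Rightarrow> bool"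
  where "far1 M \<Psi> \<epsilon> X \<longleftrightarrow>
    (\<forall>t. AE \<omega> in M. X (t + 1) \<omega> = blinfun_apply \<Psi> (X t \<omega>) + \<epsilon> (t + 1) \<omega>)"

text \<open>The covariance operator \<open>E Y \<otimes> Y\<close>, evaluated pointwise so that the Bochner integral is
  taken in the (separable) Hilbert space itself.\<close>

definition cov_operator ::
  "'w measure \<Rightarrow> ('w \<Rightarrow> 'a::{real_inner,banach,second_countable_topology}) \<Rightarrow> 'a \<Rightarrow> 'a"
  where "cov_operator M Y x = (\<integral>\<omega>. (Y \<omega> \<otimes>\<^sub>H Y \<omega>) x \<partial>M)"

definition sample :: "(int \<Rightarrow> 'w \<Rightarrow> 'a) \<Rightarrow> nat \<Rightarrow> 'w \<Rightarrow> (nat \<Rightarrow> 'a)"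
  where "sample X n \<omega> = (\<lambda>j\<in>{0..n}. X (int j) \<omega>)"

section \<open>Estimators and residual bootstrap, as functions of an observed path \<open>x 0, \<dots>, x n\<close>\<close>

definition emp_cov :: "nat \<Rightarrow> (nat \<Rightarrow> 'a::real_inner) \<Rightarrow> 'a \<Rightarrow> 'a"
  where "emp_cov n x y = (1 / real n) *\<^sub>R (\<Sum>j<n. (x j \<otimes>\<^sub>H x j) y)"

definition emp_cross_cov :: "nat \<Rightarrow> (nat \<Rightarrow> 'a::real_inner) \<Rightarrow> 'a \<Rightarrow> 'a"
  where "emp_cross_cov n x y = (1 / real n) *\<^sub>R (\<Sum>j<n. (x j \<otimes>\<^sub>H x (j + 1)) y)"

text \<open>Samples with \<open>l j = 0\<close> for some \<open>j \<le> k\<close> are covered by the convention \<open>1 / 0 = 0\<close>.\<close>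

definition truncated_inverse ::
  "nat \<Rightarrow> (nat \<Rightarrow> real) \<Rightarrow> (nat \<Rightarrow> 'a::real_inner) \<Rightarrow> 'a \<Rightarrow> 'a"
  where "truncated_inverse k l v y = (\<Sum>j=1..k. (1 / l j) *\<^sub>R (v j \<otimes>\<^sub>H v j) y)"

definition Psi_hat ::
  "nat \<Rightarrow> nat \<Rightarrow> (nat \<Rightarrow> real) \<Rightarrow> (nat \<Rightarrow> 'a::real_inner) \<Rightarrow> (nat \<Rightarrow> 'a) \<Rightarrow> 'a \<Rightarrow> 'a"
  where "Psi_hat n k l v x = emp_cross_cov n x \<circ> truncated_inverse k l v"

definition residual :: "('a::real_vector \<Rightarrow> 'a) \<Rightarrow> (nat \<Rightarrow> 'a) \<Rightarrow> nat \<Rightarrow> 'a"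
  where "residual T x j = x j - T (x (j - 1))"

definition centered_residual :: "nat \<Rightarrow> ('a::real_vector \<Rightarrow> 'a) \<Rightarrow> (nat \<Rightarrow> 'a) \<Rightarrow> nat \<Rightarrow> 'a"
  where "centered_residual n T x j =
    residual T x j - (1 / real n) *\<^sub>R (\<Sum>i=1..n. residual T x i)"

definition residual_distr ::
  "nat \<Rightarrow> ('a::{real_vector,topological_space} \<Rightarrow> 'a) \<Rightarrow> (nat \<Rightarrow> 'a) \<Rightarrow> 'a measure"
  where "residual_distr n T x =
    distr (uniform_count_measure {1..n}) borel (centered_residual n T x)"

fun boot_path :: "('a::real_vector \<Rightarrow> 'a) \<Rightarrow> 'a \<Rightarrow> (nat \<Rightarrow> 'a) \<Rightarrow> nat \<Rightarrow> 'a"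
  where
    "boot_path T x0 e 0 = x0"
  | "boot_path T x0 e (Suc t) = T (boot_path T x0 e t) + e (Suc t)"

text \<open>Conditional distribution of the bootstrap mean given the data \<open>x\<close>, when the bootstrap
  process is started at \<open>x0\<close>: the bootstrap innovations \<open>e 1, \<dots>, e n\<close> have joint conditional
  distribution \<open>PiM {1..n} (\<lambda>_. residual_distr n T x)\<close>.\<close>

definition boot_mean_distr ::
  "nat \<Rightarrow> ('a::{real_vector,topological_space} \<Rightarrow> 'a) \<Rightarrow> 'a \<Rightarrow> (nat \<Rightarrow> 'a) \<Rightarrow> 'a measure"
  where "boot_mean_distr n T x0 x =
    distr (PiM {1..n} (\<lambda>_. residual_distr n T x)) borel
      (\<lambda>e. (1 / real n) *\<^sub>R (\<Sum>t<n. boot_path T x0 e t))"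

definition mean_distr ::
  "'w measure \<Rightarrow> (int \<Rightarrow> 'w \<Rightarrow> 'a::{real_vector,topological_space}) \<Rightarrow> nat \<Rightarrow> 'a measure"
  where "mean_distr M X n = distr M borel (\<lambda>\<omega>. (1 / real n) *\<^sub>R (\<Sum>t<n. X (int t) \<omega>))"

section \<open>Mallows metric and convergence in probability\<close>

text \<open>The pairs of random variables with marginals \<open>F\<close> and \<open>G\<close> are represented by their joint
  distributions.\<close>

definition couplings ::
  "'a::topological_space measure \<Rightarrow> 'a measure \<Rightarrow> ('a \<times> 'a) measure set"
  where "couplings F G = {P. prob_space P \<and> sets P = sets (borel \<Otimes>\<^sub>M borel) \<and>
    distr P borel fst = F \<and> distr P borel snd = G}"

definition mallows_dist_sq ::
  "'a::real_normed_vector measure \<Rightarrow> 'a measure \<Rightarrow> ennreal"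
  where "mallows_dist_sq F G =
    (INF P\<in>couplings F G. \<integral>\<^sup>+ p. ennreal ((norm (fst p - snd p))\<^sup>2) \<partial>P)"

text \<open>The outer measure is used because the random quantities of interest depend on an arbitrary,
  not necessarily measurable, choice of the empirical eigenvectors. For measurable events it is
  the probability.\<close>

definition tends_to_zero_in_prob :: "'w measure \<Rightarrow> (nat \<Rightarrow> 'w \<Rightarrow> ennreal) \<Rightarrow> bool"
  where "tends_to_zero_in_prob M Z \<longleftrightarrow>
    (\<forall>\<delta>::real. 0 < \<delta> \<longrightarrow>
      (\<lambda>n. outer_measure_of M {\<omega>\<in>space M. ennreal \<delta> < Z n \<omega>}) \<longlonglongrightarrow> 0)"

definition bounded_in_prob :: "'w measure \<Rightarrow> (nat \<Rightarrow> 'w \<Rightarrow> 'a::real_normed_vector) \<Rightarrow> bool"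
  where "bounded_in_prob M Y \<longleftrightarrow>
    (\<forall>\<eta>::real. 0 < \<eta> \<longrightarrow> (\<exists>K::real. \<forall>\<^sub>F n in sequentially.
      outer_measure_of M {\<omega>\<in>space M. K < norm (Y n \<omega>)} \<le> ennreal \<eta>))"

text \<open>Constant sequences are bounded in probability. In particular the initial values
  \<open>X 0\<close> and \<open>0\<close> of the bootstrap recursion are.\<close>

lemma (in prob_space) bounded_in_prob_const:
  fixes Y :: "'a \<Rightarrow> 'b::{real_normed_vector,second_countable_topology}"
  assumes [measurable]: "Y \<in> borel_measurable M"
  shows "bounded_in_prob M (\<lambda>_. Y)"
  unfolding bounded_in_prob_def
proof (intro allI impI)
  fix \<eta> :: real assume "0 < \<eta>"
  define A where "A m = {\<omega>\<in>space M. real m < norm (Y \<omega>)}" for m :: nat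
  have A: "A m \<in> sets M" for m unfolding A_def by measurable
  have "(\<Inter>m. A m) = {}"
  proof -
    have "\<omega> \<notin> (\<Inter>m. A m)" for \<omega>
      using reals_Archimedean2[of "norm (Y \<omega>)"] by (auto simp: A_def not_less intro: less_imp_le)
    then show ?thesis by blast
  qed
  moreover have "(\<lambda>m. emeasure M (A m)) \<longlonglongrightarrow> emeasure M (\<Inter>m. A m)"
    using A by (intro Lim_emeasure_decseq) (auto simp: A_def decseq_def)
  ultimately have "(\<lambda>m. emeasure M (A m)) \<longlonglongrightarrow> 0" by simp
  then have "\<forall>\<^sub>F m in sequentially. emeasure M (A m) < ennreal \<eta>"
    using \<open>0 < \<eta>\<close> by (intro order_tendstoD) auto
  then obtain m where "emeasure M (A m) < ennreal \<eta>"
    by (auto simp: eventually_sequentially)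
  then have "outer_measure_of M {\<omega>\<in>space M. real m < norm (Y \<omega>)} \<le> ennreal \<eta>"
    using A[of m] by (simp add: A_def)
  then show "\<exists>K. \<forall>\<^sub>F n in sequentially.
      outer_measure_of M {\<omega>\<in>space M. K < norm (Y \<omega>)} \<le> ennreal \<eta>"
    by (intro exI[of _ "real m"]) simp
qed

end

theory Submission
  imports Defs
begin

text \<open>Write \<open>T\<close> for the estimator of \<open>\<Psi>\<close> and \<open>x0\<close> for the initial value of the bootstrap recursion.
The distance is bounded by running the process and its bootstrap version on one probability
space, with independent pairs of innovations drawn from a coupling \<open>Q\<close> of the law of an innovation
and the empirical law of the centred residuals. If \<open>S m\<close> and \<open>S' m\<close> are the two sums over the first
\<open>m\<close> times, summing the recursions gives
\<open>S (m + 1) - S' (m + 1) = T (S m - S' m) + (X 0 - x0) - (T - \<Psi>) (S m) + (\<epsilon> 1 - \<epsilon>' 1) + \<dots> + (\<epsilon> m - \<epsilon>' m)\<close>.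
As soon as \<open>T\<close> is a strict contraction, this recursion is stable. The innovations of both processes
are centred, so the second moment of the last sum is \<open>m\<close> times the cost of \<open>Q\<close>, and that of \<open>S m\<close> is of
order \<open>m\<close>. Hence \<open>n\<close> times the squared distance is at most a constant times
\<open>(1 + norm x0 ^ 2) / n + (norm (T - \<Psi>)) ^ 2 + cost Q\<close> (\<open>bootstrap_mean_distance\<close>), and it remains to
make the last two terms small with high probability.

The operator. If \<open>C\<close> and \<open>G\<close> are the empirical cross-covariance and covariance operators, the
model gives \<open>C = \<Psi> G + R\<close>, where \<open>R\<close> is the average of \<open>X j \<otimes> \<epsilon> (j + 1)\<close>. Therefore
\<open>T - \<Psi> = - \<Psi> (1 - P) + R G'\<close>, where \<open>G'\<close> is the truncated inverse of \<open>G\<close> and \<open>P\<close> projects onto the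
first \<open>k n\<close> empirical eigenvectors (\<open>Psi_hat_error\<close>).
The noise \<open>R\<close> is a sum of martingale differences, so its Hilbert-Schmidt norm is of order
\<open>1 / sqrt n\<close>, while the norm of \<open>G'\<close> is the inverse of the empirical eigenvalue of index \<open>k n\<close>. By Weyl's
inequality that eigenvalue is comparable to \<open>lam (k n)\<close>, provided that \<open>G\<close> is closer to the
covariance operator \<open>\<Gamma>\<close> than \<open>lam (k n)\<close>. The latter follows from the recursion once more: with
\<open>\<Psi>'\<close> the adjoint of \<open>\<Psi>\<close>, the error \<open>D = G - \<Gamma>\<close> satisfies \<open>D = \<Psi> D \<Psi>' + (terms of order 1 / sqrt n)\<close>, and
\<open>norm \<Psi> < 1\<close> (\<open>emp_cov_recursion\<close>).
The first term tends to zero in norm because \<open>1 - P\<close> tends to zero strongly and \<open>\<Psi>\<close> is a norm limit of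
finite-rank operators. For the strong convergence, \<open>(1 - P) G\<close> has norm at most the empirical
eigenvalue of index \<open>k n + 1\<close>, which is at most the trace of \<open>G\<close> divided by \<open>k n + 1\<close>; so
\<open>(1 - P) \<Gamma>\<close> tends to zero, and the range of the injective symmetric operator \<open>\<Gamma>\<close> is dense.

The innovations. An average over \<open>t\<close> of the squared differences between innovations and centred
residuals is controlled by \<open>norm (T - \<Psi>)\<close> (\<open>centered_residual_error\<close>). To couple the law of an innovation
with the empirical law of \<open>n\<close> true innovations, the space is divided into finitely many cells
on which the identity is almost constant in mean square; the frequencies of the cells obey the law
of large numbers, and laws with nearly equal cell probabilities can be coupled so that both
coordinates lie in the same cell with probability close to one (\<open>finite_class_coupling\<close>).\<close>


section \<open>Hilbert spaces\<close>

text \<open>The projection theorem, in the form needed for the Riesz representation and for dense ranges: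
the vector is the difference between a point off the subspace and its nearest point there.\<close>

lemma orthogonal_vector_to_closed_subspace:
  fixes S :: "'a::{real_inner,banach} set"
  assumes S: "subspace S" "closed S" "S \<noteq> UNIV"
  shows "\<exists>r. r \<noteq> 0 \<and> (\<forall>s\<in>S. r \<bullet> s = 0)"
proof -
  obtain e where e: "e \<notin> S" using S(3) by blast
  define d where "d = (INF s\<in>S. (norm (e - s))\<^sup>2)"
  have S0: "0 \<in> S" using S(1) by (rule subspace_0)
  have bdd: "bdd_below ((\<lambda>s. (norm (e - s))\<^sup>2) ` S)" by (rule bdd_belowI2[of _ 0]) simp
  have d_le: "d \<le> (norm (e - s))\<^sup>2" if "s \<in> S" for s
    unfolding d_def by (rule cINF_lower[OF bdd that])
  have "\<exists>s\<in>S. (norm (e - s))\<^sup>2 < d + 1 / real (Suc m)" for m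
  proof -
    have "d < d + 1 / real (Suc m)" by simp
    then show ?thesis unfolding d_def using S0 bdd by (subst (asm) (1) cINF_less_iff) auto
  qed
  then obtain s where sS: "\<And>m. s m \<in> S" and s: "\<And>m. (norm (e - s m))\<^sup>2 < d + 1 / real (Suc m)"
    by metis
  \<comment> \<open>The midpoint of two near minimisers is again in \<open>S\<close>, so the parallelogram law
     makes the minimising sequence Cauchy.\<close>
  have par: "(norm (s m - s n))\<^sup>2 \<le> 2 / real (Suc m) + 2 / real (Suc n)" for m n
  proof -
    define w where "w = (1/2) *\<^sub>R (s m + s n)"
    have "w \<in> S" unfolding w_def using S(1) sS by (simp add: subspace_add subspace_mul)
    then have "d \<le> (norm (e - w))\<^sup>2" by (rule d_le)
    moreover have "(norm (s m - s n))\<^sup>2 = 2 * (norm (e - s m))\<^sup>2 + 2 * (norm (e - s n))\<^sup>2 - 4 * (norm (e - w))\<^sup>2"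
      unfolding w_def power2_norm_eq_inner
      by (simp add: inner_diff_left inner_diff_right inner_add_left inner_add_right inner_commute
          algebra_simps)
    ultimately show ?thesis using s[of m] s[of n] by simp
  qed
  have "Cauchy s"
  proof (rule metric_CauchyI)
    fix \<eta> :: real assume \<eta>: "0 < \<eta>"
    obtain K where K: "inverse (real (Suc K)) < \<eta>\<^sup>2 / 4"
      using reals_Archimedean[of "\<eta>\<^sup>2 / 4"] \<eta> by auto
    have "dist (s m) (s n) < \<eta>" if "K \<le> m" "K \<le> n" for m n
    proof -
      have "2 / real (Suc m) \<le> 2 / real (Suc K)" "2 / real (Suc n) \<le> 2 / real (Suc K)"
        using that by (auto intro!: divide_left_mono)
      then have "(norm (s m - s n))\<^sup>2 < \<eta>\<^sup>2" using par[of m n] K unfolding inverse_eq_divide by linarith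
      then show ?thesis using \<eta> by (simp add: dist_norm power_less_imp_less_base)
    qed
    then show "\<exists>K. \<forall>m\<ge>K. \<forall>n\<ge>K. dist (s m) (s n) < \<eta>" by blast
  qed
  then obtain p where p: "s \<longlonglongrightarrow> p" using Cauchy_convergent_iff convergent_def by blast
  have pS: "p \<in> S" using S(2) sS p by (rule closed_sequentially)
  have "(\<lambda>m. (norm (e - s m))\<^sup>2) \<longlonglongrightarrow> (norm (e - p))\<^sup>2" using p by (intro tendsto_intros)
  moreover have "(\<lambda>m. d + 1 / real (Suc m)) \<longlonglongrightarrow> d + 0"
    by (intro tendsto_intros LIMSEQ_Suc[OF lim_1_over_n])
  ultimately have le: "(norm (e - p))\<^sup>2 \<le> d"
    using s by (intro LIMSEQ_le[of _ _ _ "d"]) (auto intro: less_imp_le exI[of _ 0])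
  have "(e - p) \<bullet> x = 0" if x: "x \<in> S" for x
  proof (cases "x = 0")
    case False
    define t where "t = ((e - p) \<bullet> x) / (x \<bullet> x)"
    have "p + t *\<^sub>R x \<in> S" using S(1) pS x by (simp add: subspace_add subspace_mul)
    then have "(norm (e - p))\<^sup>2 \<le> (norm (e - (p + t *\<^sub>R x)))\<^sup>2"
      using order_trans[OF le d_le] by simp
    also have "e - (p + t *\<^sub>R x) = (e - p) - t *\<^sub>R x" by simp
    also have "(norm ((e - p) - t *\<^sub>R x))\<^sup>2 = (norm (e - p))\<^sup>2 - 2 * t * ((e - p) \<bullet> x) + t\<^sup>2 * (x \<bullet> x)"
      unfolding power2_norm_eq_inner
      by (simp add: inner_diff_left inner_diff_right inner_commute power2_eq_square algebra_simps)
    also have "\<dots> = (norm (e - p))\<^sup>2 - ((e - p) \<bullet> x)\<^sup>2 / (x \<bullet> x)"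
      using False by (simp add: t_def power2_eq_square field_simps)
    finally have "((e - p) \<bullet> x)\<^sup>2 / (x \<bullet> x) \<le> 0" by simp
    moreover have "0 < x \<bullet> x" using False by simp
    ultimately have "((e - p) \<bullet> x)\<^sup>2 \<le> 0" by (simp add: divide_le_0_iff)
    then show ?thesis by simp
  qed simp
  moreover have "e - p \<noteq> 0" using e pS by auto
  ultimately show ?thesis by blast
qed

lemma riesz_representation:
  fixes f :: "'a::{real_inner,banach} \<Rightarrow> real"
  assumes f: "bounded_linear f"
  shows "\<exists>w. \<forall>x. f x = x \<bullet> w"
proof (cases "\<forall>x. f x = 0")
  case True
  then show ?thesis by (intro exI[of _ 0]) simp
next
  case False
  interpret f: bounded_linear f by fact
  have "subspace {x. f x = 0}" by (auto simp: subspace_def f.add f.scaleR f.zero)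
  moreover have "closed {x. f x = 0}" by (intro closed_Collect_eq continuous_intros f.continuous_on)
  ultimately obtain r where r: "r \<noteq> 0" "\<And>s. f s = 0 \<Longrightarrow> r \<bullet> s = 0"
    using orthogonal_vector_to_closed_subspace[of "{x. f x = 0}"] False by blast
  have "f x = x \<bullet> ((f r / (r \<bullet> r)) *\<^sub>R r)" for x
  proof -
    have "r \<bullet> (f r *\<^sub>R x - f x *\<^sub>R r) = 0" by (rule r(2)) (simp add: f.diff f.scaleR)
    then have "f r * (r \<bullet> x) = f x * (r \<bullet> r)" by (simp add: inner_diff_right)
    then show ?thesis using r(1) by (simp add: inner_commute field_simps)
  qed
  then show ?thesis by blast
qed

lemma adjoint_exists:
  fixes A :: "'a::{real_inner,banach} \<Rightarrow>\<^sub>L 'a"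
  obtains A' where "\<And>x y. A x \<bullet> y = x \<bullet> A' y" "\<And>y. norm (A' y) \<le> norm A * norm y"
proof -
  have "\<exists>w. \<forall>x. A x \<bullet> y = x \<bullet> w" for y
    by (rule riesz_representation)
       (intro bounded_linear_compose[OF bounded_linear_inner_left] blinfun.bounded_linear_right)
  then obtain A' where A': "\<And>x y. A x \<bullet> y = x \<bullet> A' y" by metis
  have "norm (A' y) \<le> norm A * norm y" for y
  proof (cases "A' y = 0")
    case False
    have "norm (A' y) * norm (A' y) = A (A' y) \<bullet> y"
      using A'[of "A' y" y] by (simp add: power2_norm_eq_inner[symmetric] power2_eq_square)
    also have "\<dots> \<le> norm (A (A' y)) * norm y" by (rule norm_cauchy_schwarz)
    also have "\<dots> \<le> (norm A * norm (A' y)) * norm y"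
      by (intro mult_right_mono norm_blinfun) simp
    finally show ?thesis using False by (simp add: mult.assoc mult.left_commute)
  qed simp
  with A' show thesis by (rule that)
qed

lemma subspace_closure:
  fixes S :: "'a::real_normed_vector set"
  assumes S: "subspace S"
  shows "subspace (closure S)"
  unfolding subspace_def
proof (intro conjI ballI allI)
  show "0 \<in> closure S" using subspace_0[OF S] closure_subset by blast
next
  fix x y assume "x \<in> closure S" "y \<in> closure S"
  then obtain f g where "\<forall>n. f n \<in> S" "f \<longlonglongrightarrow> x" "\<forall>n. g n \<in> S" "g \<longlonglongrightarrow> y"
    by (auto simp: closure_sequential)
  then have "\<forall>n. f n + g n \<in> S" "(\<lambda>n. f n + g n) \<longlonglongrightarrow> x + y"
    using subspace_add[OF S] by (auto intro: tendsto_add)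
  then show "x + y \<in> closure S"
    unfolding closure_sequential by (intro exI[of _ "\<lambda>n. f n + g n"]) simp
next
  fix c :: real and x assume "x \<in> closure S"
  then obtain f where "\<forall>n. f n \<in> S" "f \<longlonglongrightarrow> x"
    by (auto simp: closure_sequential)
  then have "\<forall>n. c *\<^sub>R f n \<in> S" "(\<lambda>n. c *\<^sub>R f n) \<longlonglongrightarrow> c *\<^sub>R x"
    using subspace_mul[OF S] by (auto intro: tendsto_intros)
  then show "c *\<^sub>R x \<in> closure S"
    unfolding closure_sequential by (intro exI[of _ "\<lambda>n. c *\<^sub>R f n"]) simp
qed

text \<open>A vector orthogonal to the range of a symmetric operator lies in its kernel.\<close>

lemma dense_range_if_symmetric_injective:
  fixes G :: "'a::{real_inner,banach} \<Rightarrow> 'a"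
  assumes G: "bounded_linear G" and sym: "\<And>x y. G x \<bullet> y = x \<bullet> G y"
    and inj: "\<And>x. G x = 0 \<Longrightarrow> x = 0"
  shows "closure (range G) = UNIV"
proof (rule ccontr)
  assume ne: "closure (range G) \<noteq> UNIV"
  interpret G: bounded_linear G by fact
  have "subspace (range G)"
    using subspace_UNIV G.linear_axioms by (intro linear_subspace_image) auto
  then have "subspace (closure (range G))" by (rule subspace_closure)
  then obtain r where r: "r \<noteq> 0" "\<And>s. s \<in> closure (range G) \<Longrightarrow> r \<bullet> s = 0"
    using orthogonal_vector_to_closed_subspace ne closed_closure by metis
  have "G r \<bullet> G r = r \<bullet> G (G r)" by (rule sym)
  also have "\<dots> = 0" by (rule r(2)[OF set_mp[OF closure_subset rangeI]])
  finally have "G r = 0" by simp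
  then show False using inj r(1) by blast
qed

text \<open>An orthonormal basis indexed by all natural numbers. Zero vectors are admitted, so that no
distinction between finite and infinite bases is necessary and sums over the basis are series.\<close>

definition orthonormal_frame :: "(nat \<Rightarrow> 'a::real_inner) \<Rightarrow> bool"
  where "orthonormal_frame e \<longleftrightarrow>
    (\<forall>i j. i \<noteq> j \<longrightarrow> e i \<bullet> e j = 0) \<and> (\<forall>i. norm (e i) = 1 \<or> e i = 0) \<and>
    closure (span (range e)) = UNIV"

text \<open>Distinct basis vectors have distance \<open>sqrt 2\<close>, so the balls of radius \<open>1/2\<close> around them are
disjoint, and a second countable space contains only countably many disjoint open sets.\<close>

lemma orthonormal_basis_countable:
  fixes B :: "'a::{real_inner,second_countable_topology} set"
  assumes "orthonormal_basis B"
  shows "countable B"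
proof -
  have disj: "disjnt (ball b (1/2)) (ball c (1/2))" if "b \<in> B" "c \<in> B" "b \<noteq> c" for b c
  proof -
    have "b \<bullet> c = 0" "norm b = 1" "norm c = 1"
      using assms that by (auto simp: orthonormal_basis_def pairwise_def orthogonal_def)
    then have "(norm (b - c))\<^sup>2 = 2"
      by (simp add: power2_norm_eq_inner inner_diff_left inner_diff_right inner_commute norm_eq_1)
    then have "1\<^sup>2 \<le> (dist b c)\<^sup>2" by (simp add: dist_norm)
    then have "1 \<le> dist b c" by (rule power2_le_imp_le) simp
    then show ?thesis
      unfolding disjnt_def by (auto simp: ball_def) (smt (verit) dist_commute dist_triangle)
  qed
  have "countable ((\<lambda>b. ball b (1/2)) ` B)"
    by (rule countable_disjoint_open_subsets) (auto simp: pairwise_def intro!: disj)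
  moreover have "inj_on (\<lambda>b. ball b (1/2)) B"
  proof (rule inj_onI, rule ccontr)
    fix b c assume bc: "b \<in> B" "c \<in> B" "ball b (1/2) = ball c (1/2)" "b \<noteq> c"
    then have "disjnt (ball b (1/2)) (ball b (1/2))" using disj[of b c] by simp
    then show False by (simp add: disjnt_def)
  qed
  ultimately show ?thesis by (rule countable_image_inj_on)
qed

lemma hilbert_schmidt_frame:
  fixes T :: "'a::{real_inner,second_countable_topology} \<Rightarrow>\<^sub>L 'a"
  assumes "hilbert_schmidt T"
  obtains e where "orthonormal_frame e" "summable (\<lambda>i. (norm (T (e i)))\<^sup>2)"
proof -
  obtain B where B: "orthonormal_basis B" and sum: "(\<lambda>b. (norm (T b))\<^sup>2) summable_on B"
    using assms by (auto simp: hilbert_schmidt_def)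
  have cB: "countable B" using B by (rule orthonormal_basis_countable)
  define f where "f = to_nat_on B"
  have inj: "inj_on f B" unfolding f_def using cB by (rule inj_on_to_nat_on)
  define e where "e i = (if i \<in> f ` B then inv_into B f i else 0)" for i
  have ef: "e (f b) = b" if "b \<in> B" for b using that inj by (simp add: e_def)
  have e_cases: "e i \<in> B \<and> i = f (e i) \<or> e i = 0" for i
    by (auto simp: e_def inv_into_into f_inv_into_f inj)
  have nB: "norm b = 1" if "b \<in> B" for b using B that by (auto simp: orthonormal_basis_def)
  have "orthonormal_frame e"
    unfolding orthonormal_frame_def
  proof (intro conjI allI impI)
    fix i j :: nat assume ij: "i \<noteq> j"
    show "e i \<bullet> e j = 0"
    proof (cases "e i = 0 \<or> e j = 0")
      case False
      then have "e i \<in> B" "e j \<in> B" "e i \<noteq> e j" using e_cases[of i] e_cases[of j] ij by auto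
      then show ?thesis using B by (auto simp: orthonormal_basis_def pairwise_def orthogonal_def)
    qed auto
  next
    fix i show "norm (e i) = 1 \<or> e i = 0" using e_cases[of i] nB by auto
  next
    have "B \<subseteq> range e" using ef by (metis image_subset_iff range_eqI subsetI)
    then have "closure (span B) \<subseteq> closure (span (range e))" by (intro closure_mono span_mono)
    then show "closure (span (range e)) = UNIV" using B by (auto simp: orthonormal_basis_def)
  qed
  moreover have "summable (\<lambda>i. (norm (T (e i)))\<^sup>2)"
  proof -
    have "(\<lambda>i. (norm (T (e i)))\<^sup>2) summable_on f ` B"
      using sum ef by (subst summable_on_reindex[OF inj]) (auto simp: o_def cong: summable_on_cong)
    then have "(\<lambda>i. (norm (T (e i)))\<^sup>2) summable_on UNIV"
      by (rule summable_on_cong_neutral[THEN iffD1, rotated -1])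
         (auto simp: e_def blinfun.zero_right)
    then show ?thesis by (rule summable_on_imp_summable)
  qed
  ultimately show thesis by (rule that)
qed

text \<open>The equation expresses that distinct vectors are orthogonal and that each vector is zero or
of norm one; \<open>orth_proj\<close> is then the orthogonal projection onto the span.\<close>

definition orthonormal_or_zero :: "'i set \<Rightarrow> ('i \<Rightarrow> 'a::real_inner) \<Rightarrow> bool"
  where "orthonormal_or_zero I v \<longleftrightarrow>
    (\<forall>i\<in>I. \<forall>j\<in>I. (v i \<bullet> v j) *\<^sub>R v j = (if i = j then v i else 0))"

definition orth_proj :: "'i set \<Rightarrow> ('i \<Rightarrow> 'a::real_inner) \<Rightarrow> 'a \<Rightarrow> 'a"
  where "orth_proj I v x = (\<Sum>i\<in>I. (x \<bullet> v i) *\<^sub>R v i)"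

lemma orth_proj_inner: "orth_proj I v x \<bullet> y = (\<Sum>i\<in>I. (x \<bullet> v i) * (y \<bullet> v i))"
  by (simp add: orth_proj_def inner_sum_left inner_commute[of y])

lemma orth_proj_symmetric: "orth_proj I v x \<bullet> y = x \<bullet> orth_proj I v y"
  by (simp add: orth_proj_inner inner_commute[of x "orth_proj I v y"] mult.commute)

lemma bounded_linear_orth_proj: "bounded_linear (orth_proj I v)"
  unfolding orth_proj_def
  by (intro bounded_linear_sum bounded_linear_compose[OF bounded_linear_scaleR_left] bounded_linear_inner_left)

context
  fixes I :: "'i set" and v :: "'i \<Rightarrow> 'a::real_inner"
  assumes fin: "finite I" and v: "orthonormal_or_zero I v"
begin

lemma orth_proj_basis: "i \<in> I \<Longrightarrow> orth_proj I v (v i) = v i"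
  using v fin unfolding orth_proj_def orthonormal_or_zero_def
  by (simp add: sum.delta' cong: sum.cong)

lemma orth_proj_inner_basis: "i \<in> I \<Longrightarrow> orth_proj I v x \<bullet> v i = x \<bullet> v i"
  by (simp add: orth_proj_symmetric orth_proj_basis)

lemma orth_proj_idem: "orth_proj I v (orth_proj I v x) = orth_proj I v x"
  unfolding orth_proj_def[of I v "orth_proj I v x"] orth_proj_def[of I v x, symmetric]
  unfolding orth_proj_def[of I v x] by (intro sum.cong) (simp_all add: orth_proj_inner_basis flip: orth_proj_def)

lemma norm_minus_orth_proj:
  "(norm (x - orth_proj I v x))\<^sup>2 = (norm x)\<^sup>2 - (\<Sum>i\<in>I. (x \<bullet> v i)\<^sup>2)"
proof -
  have "orth_proj I v x \<bullet> orth_proj I v x = orth_proj I v x \<bullet> x"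
    by (metis orth_proj_idem orth_proj_symmetric)
  moreover have "orth_proj I v x \<bullet> x = (\<Sum>i\<in>I. (x \<bullet> v i)\<^sup>2)"
    by (simp add: orth_proj_inner power2_eq_square)
  ultimately show ?thesis
    by (simp add: power2_norm_eq_inner inner_diff_left inner_diff_right inner_commute)
qed

lemma bessel_finite: "(\<Sum>i\<in>I. (x \<bullet> v i)\<^sup>2) \<le> (norm x)\<^sup>2"
  using norm_minus_orth_proj[of x] zero_le_power2[of "norm (x - orth_proj I v x)"] by linarith

lemma norm_minus_orth_proj_le: "norm (x - orth_proj I v x) \<le> norm x"
proof -
  have "(norm (x - orth_proj I v x))\<^sup>2 \<le> (norm x)\<^sup>2"
    by (simp add: norm_minus_orth_proj sum_nonneg)
  then show ?thesis by (rule power2_le_imp_le) simp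
qed

end

context
  fixes e :: "nat \<Rightarrow> 'a::real_inner"
  assumes e: "orthonormal_frame e"
begin

lemma orthonormal_frame_or_zero: "orthonormal_or_zero I e"
  unfolding orthonormal_or_zero_def
proof (intro ballI)
  fix i j
  show "(e i \<bullet> e j) *\<^sub>R e j = (if i = j then e i else 0)"
    using e unfolding orthonormal_frame_def
    by (cases "i = j") (metis inner_zero_left norm_eq_1 scaleR_one scaleR_zero_right, simp)
qed

lemma orth_proj_frame: "orth_proj {..<m} e (e i) = (if i < m then e i else 0)"
  using e orth_proj_basis[OF _ orthonormal_frame_or_zero, of "{..<m}" i]
  by (auto simp: orth_proj_def orthonormal_frame_def intro!: sum.neutral)

lemma bessel: "(\<Sum>i. ennreal ((x \<bullet> e i)\<^sup>2)) \<le> ennreal ((norm x)\<^sup>2)"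
proof -
  have "(\<Sum>i<m. ennreal ((x \<bullet> e i)\<^sup>2)) \<le> ennreal ((norm x)\<^sup>2)" for m
    using bessel_finite[OF _ orthonormal_frame_or_zero, of "{..<m}" x] by (simp add: sum_ennreal)
  then show ?thesis by (subst suminf_eq_SUP) (auto intro: SUP_least)
qed

text \<open>Reduces statements about the span of the frame to finite sums.\<close>

lemma orth_proj_eventually_id:
  assumes "x \<in> span (range e)"
  shows "\<exists>m. orth_proj {..<m} e x = x"
proof -
  let ?V = "{x. \<exists>m. \<forall>k\<ge>m. orth_proj {..<k} e x = x}"
  interpret P: bounded_linear "orth_proj {..<m} e" for m by (rule bounded_linear_orth_proj)
  have "subspace ?V"
    unfolding subspace_def
  proof (intro conjI ballI allI)
    show "0 \<in> ?V" by (simp add: P.zero)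
  next
    fix x y assume "x \<in> ?V" "y \<in> ?V"
    then obtain a b where "\<forall>k\<ge>a. orth_proj {..<k} e x = x" "\<forall>k\<ge>b. orth_proj {..<k} e y = y" by blast
    then have "\<forall>k\<ge>max a b. orth_proj {..<k} e (x + y) = x + y" by (simp add: P.add)
    then show "x + y \<in> ?V" by blast
  next
    fix c x assume "x \<in> ?V"
    then show "c *\<^sub>R x \<in> ?V" by (auto simp: P.scaleR)
  qed
  moreover have "range e \<subseteq> ?V"
  proof
    fix y assume "y \<in> range e"
    then obtain i where "y = e i" by blast
    then have "\<forall>k\<ge>Suc i. orth_proj {..<k} e y = y" by (auto simp: orth_proj_frame)
    then show "y \<in> ?V" by blast
  qed
  ultimately have "span (range e) \<subseteq> ?V" by (intro span_minimal)
  then show ?thesis using assms by blast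
qed

text \<open>The operator norm is at most the Hilbert-Schmidt norm. This is how all random operators are
estimated: the expected squared Hilbert-Schmidt norm is a sum, over the frame, of second moments of
random vectors. The Hilbert-Schmidt norm is a series in the extended nonnegative reals, so
that it can be interchanged with integrals without summability conditions.\<close>

lemma norm_le_hilbert_schmidt:
  fixes A :: "'a \<Rightarrow> 'b::real_normed_vector"
  assumes A: "bounded_linear A" and s: "0 \<le> s"
    and le: "(\<Sum>i. ennreal ((norm (A (e i)))\<^sup>2)) \<le> ennreal (s\<^sup>2)"
  shows "norm (A x) \<le> s * norm x"
proof -
  interpret A: bounded_linear A by fact
  have fin: "L2_set (\<lambda>i. norm (A (e i))) {..<m} \<le> s" for m
  proof -
    have "ennreal (\<Sum>i<m. (norm (A (e i)))\<^sup>2) \<le> ennreal (s\<^sup>2)"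
      using order_trans[OF sum_le_suminf[of "\<lambda>i. ennreal ((norm (A (e i)))\<^sup>2)" "{..<m}"] le]
      by (simp add: sum_ennreal)
    then have "(\<Sum>i<m. (norm (A (e i)))\<^sup>2) \<le> s\<^sup>2" by (simp add: ennreal_le_iff)
    then show ?thesis unfolding L2_set_def using s real_le_lsqrt by (simp add: sum_nonneg real_sqrt_le_iff real_le_lsqrt)
  qed
  have "range e \<subseteq> span (range e)" by (rule span_superset)
  let ?C = "{x. norm (A x) \<le> s * norm x}"
  have "span (range e) \<subseteq> ?C"
  proof
    fix y assume "y \<in> span (range e)"
    then obtain m where m: "orth_proj {..<m} e y = y" using orth_proj_eventually_id by blast
    have "A y = (\<Sum>i<m. (y \<bullet> e i) *\<^sub>R A (e i))"
      by (subst m[symmetric]) (simp add: orth_proj_def A.sum A.scaleR)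
    then have "norm (A y) \<le> (\<Sum>i<m. \<bar>y \<bullet> e i\<bar> * \<bar>norm (A (e i))\<bar>)"
      by (simp add: sum_norm_le)
    also have "\<dots> \<le> L2_set (\<lambda>i. y \<bullet> e i) {..<m} * L2_set (\<lambda>i. norm (A (e i))) {..<m}"
      by (rule L2_set_mult_ineq)
    also have "\<dots> \<le> norm y * s"
    proof (intro mult_mono fin)
      show "L2_set (\<lambda>i. y \<bullet> e i) {..<m} \<le> norm y"
        unfolding L2_set_def using bessel_finite[OF _ orthonormal_frame_or_zero, of "{..<m}" y] by (simp add: real_le_lsqrt sum_nonneg)
    qed auto
    finally show "y \<in> ?C" by (simp add: mult.commute)
  qed
  moreover have "closed ?C"
    by (intro closed_Collect_le continuous_intros A.continuous_on)
  ultimately have "closure (span (range e)) \<subseteq> ?C" by (simp add: closure_minimal)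
  then show ?thesis using e by (auto simp: orthonormal_frame_def)
qed

text \<open>Finite-rank approximation in operator norm: the tail of the series for the squared
Hilbert-Schmidt norm bounds the remainder.\<close>

lemma hilbert_schmidt_tail:
  fixes A :: "'a \<Rightarrow> 'b::real_normed_vector"
  assumes A: "bounded_linear A" and sum: "summable (\<lambda>i. (norm (A (e i)))\<^sup>2)" and "0 < \<eta>"
  obtains m where "\<And>x. norm (A (x - orth_proj {..<m} e x)) \<le> \<eta> * norm x"
proof -
  interpret A: bounded_linear A by fact
  obtain m where m: "\<And>n. n \<ge> m \<Longrightarrow> norm (\<Sum>i. (norm (A (e (i + n))))\<^sup>2) < \<eta>\<^sup>2"
    using suminf_exist_split[OF zero_less_power[OF \<open>0 < \<eta>\<close>, of 2] sum] by blast
  have tail: "(\<Sum>i. ennreal ((norm (A (e i - orth_proj {..<m} e (e i))))\<^sup>2)) \<le> ennreal (\<eta>\<^sup>2)"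
  proof -
    have "(\<Sum>i. ennreal ((norm (A (e i - orth_proj {..<m} e (e i))))\<^sup>2))
        = (\<Sum>i. ennreal ((norm (A (e (i + m) - orth_proj {..<m} e (e (i + m)))))\<^sup>2))"
      by (subst suminf_offset[where i=m]) (auto simp: orth_proj_frame A.zero intro!: sum.neutral)
    also have "\<dots> = (\<Sum>i. ennreal ((norm (A (e (i + m))))\<^sup>2))" by (simp add: orth_proj_frame)
    also have "\<dots> = ennreal (\<Sum>i. (norm (A (e (i + m))))\<^sup>2)"
      using summable_ignore_initial_segment[OF sum, of m] by (intro suminf_ennreal2) auto
    also have "\<dots> \<le> ennreal (\<eta>\<^sup>2)" using m[of m] by (intro ennreal_leI) auto
    finally show ?thesis .
  qed
  have "norm (A (x - orth_proj {..<m} e x)) \<le> \<eta> * norm x" for x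
    using \<open>0 < \<eta>\<close> tail
    by (intro norm_le_hilbert_schmidt bounded_linear_compose[OF A] bounded_linear_sub
        bounded_linear_ident bounded_linear_orth_proj) auto
  then show thesis by (rule that)
qed

end

section \<open>Eigenvectors of compact positive operators\<close>

text \<open>Replaces the Heine-Borel property of finite-dimensional subspaces, by induction on the number of
vectors.\<close>

lemma compact_linear_combinations:
  fixes x :: "nat \<Rightarrow> 'a::real_normed_vector"
  shows "compact {(\<Sum>j<n. c j *\<^sub>R x j) | c. \<forall>j<n. \<bar>c j\<bar> \<le> K}"
proof (induction n)
  case 0
  have "{(\<Sum>j<0. c j *\<^sub>R x j) | c. \<forall>j<(0::nat). \<bar>c j\<bar> \<le> K} = {0}" by auto
  then show ?case by simp
next
  case (Suc n)
  let ?S = "\<lambda>n. {(\<Sum>j<n. c j *\<^sub>R x j) | c. \<forall>j<n. \<bar>c j\<bar> \<le> K}"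
  have "?S (Suc n) = (\<lambda>(t, y). y + t *\<^sub>R x n) ` ({-K..K} \<times> ?S n)" (is "_ = ?R")
  proof (intro equalityI subsetI)
    fix y assume "y \<in> ?S (Suc n)"
    then obtain c where c: "y = (\<Sum>j<Suc n. c j *\<^sub>R x j)" "\<forall>j<Suc n. \<bar>c j\<bar> \<le> K" by blast
    have "(\<Sum>j<n. c j *\<^sub>R x j) \<in> ?S n" using c(2) by auto
    moreover have "c n \<in> {-K..K}" using c(2) by (auto simp: abs_le_iff)
    ultimately show "y \<in> ?R" by (intro image_eqI[of _ _ "(c n, \<Sum>j<n. c j *\<^sub>R x j)"]) (auto simp: c(1))
  next
    fix y assume "y \<in> ?R"
    then obtain t c where t: "t \<in> {-K..K}" "y = (\<Sum>j<n. c j *\<^sub>R x j) + t *\<^sub>R x n" "\<forall>j<n. \<bar>c j\<bar> \<le> K"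
      by auto
    then show "y \<in> ?S (Suc n)"
      by (intro CollectI exI[of _ "c(n := t)"]) (auto simp: abs_le_iff less_Suc_eq)
  qed
  moreover have "compact ?R"
    by (intro compact_continuous_image compact_Times Suc.IH)
       (auto simp: case_prod_unfold intro!: continuous_intros)
  ultimately show ?case by simp
qed

text \<open>A sequence \<open>y\<close> in the unit ball of \<open>V\<close> that maximises \<open>norm (A y)\<close> satisfies \<open>A (A y) - \<mu>\<^sup>2 y \<longlonglongrightarrow> 0\<close>,
where \<open>\<mu>\<close> is the norm of \<open>A\<close> on \<open>V\<close>. By compactness \<open>A y\<close> converges along a subsequence, hence so
does \<open>y\<close>, and the limit is an eigenvector of \<open>A\<^sup>2\<close>.\<close>

lemma top_eigenvector_on_invariant_subspace:
  fixes A :: "'a::real_inner \<Rightarrow> 'a"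
  assumes A: "bounded_linear A" and sym: "\<And>x y. A x \<bullet> y = x \<bullet> A y" and pos: "\<And>x. 0 \<le> A x \<bullet> x"
    and C: "compact C" "A ` cball 0 1 \<subseteq> C"
    and V: "subspace V" "closed V" "A ` V \<subseteq> V" and nz: "y0 \<in> V" "A y0 \<noteq> 0"
  obtains \<mu> w where "0 < \<mu>" "w \<noteq> 0" "w \<in> V" "A w = \<mu> *\<^sub>R w" "\<And>y. y \<in> V \<Longrightarrow> norm (A y) \<le> \<mu> * norm y"
proof -
  interpret A: bounded_linear A by fact
  define U where "U = {y\<in>V. norm y \<le> 1}"
  define \<mu> where "\<mu> = (SUP y\<in>U. norm (A y))"
  obtain KA where KA: "\<And>y. norm (A y) \<le> norm y * KA" "KA \<ge> 0" using A.nonneg_bounded by blast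
  have bdd: "bdd_above ((\<lambda>y. norm (A y)) ` U)"
  proof (rule bdd_aboveI2[of _ _ KA])
    fix y assume "y \<in> U"
    then show "norm (A y) \<le> KA" using KA(1)[of y] mult_right_mono[of "norm y" 1 KA] KA(2) by (simp add: U_def)
  qed
  have 0: "0 \<in> U" using subspace_0[OF V(1)] by (simp add: U_def)
  have le: "norm (A y) \<le> \<mu> * norm y" if "y \<in> V" for y
  proof (cases "y = 0")
    case False
    have "(1 / norm y) *\<^sub>R y \<in> U" using that False subspace_mul[OF V(1)] by (simp add: U_def)
    then have "norm (A ((1 / norm y) *\<^sub>R y)) \<le> \<mu>" unfolding \<mu>_def using bdd by (intro cSUP_upper)
    then show ?thesis using False by (simp add: A.scaleR field_simps)
  qed (simp add: A.zero)
  have \<mu>: "0 < \<mu>"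
  proof -
    have "0 < norm (A y0)" "0 < norm y0" using nz A.zero by auto
    then show ?thesis using le[OF nz(1)] by (smt (verit) zero_less_mult_pos2)
  qed
  have "\<exists>y\<in>U. \<mu> - 1 / real (Suc m) < norm (A y)" for m
  proof -
    have "\<mu> - 1 / real (Suc m) < (SUP y\<in>U. norm (A y))" by (simp add: \<mu>_def)
    then show ?thesis using 0 bdd by (subst (asm) less_cSUP_iff) auto
  qed
  then obtain y where yU: "\<And>m. y m \<in> U" and y: "\<And>m. \<mu> - 1 / real (Suc m) < norm (A (y m))" by metis
  have ny: "norm (y m) \<le> 1" and yV: "y m \<in> V" for m using yU by (auto simp: U_def)
  have le\<mu>: "norm (A (y m)) \<le> \<mu>" for m
    using le[OF yV[of m]] mult_left_mono[OF ny[of m], of \<mu>] \<mu> by linarith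
  have lim\<mu>: "(\<lambda>m. norm (A (y m))) \<longlonglongrightarrow> \<mu>"
  proof (rule tendsto_sandwich[of "\<lambda>m. \<mu> - 1 / real (Suc m)" _ _ "\<lambda>_. \<mu>"])
    show "(\<lambda>m. \<mu> - 1 / real (Suc m)) \<longlonglongrightarrow> \<mu>"
      using tendsto_diff[OF tendsto_const LIMSEQ_Suc[OF lim_1_over_n], of \<mu>] by simp
  qed (use y le\<mu> in \<open>auto intro: less_imp_le always_eventually\<close>)
  have "A (y m) \<in> C" for m using C(2) ny by (auto simp: image_subset_iff)
  then obtain z r where r: "strict_mono (r :: nat \<Rightarrow> nat)" and z: "((\<lambda>m. A (y m)) \<circ> r) \<longlonglongrightarrow> z"
    using seq_compactE[of C "\<lambda>m. A (y m)"] C(1) compact_imp_seq_compact by metis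
  have z: "(\<lambda>m. A (y (r m))) \<longlonglongrightarrow> z" using z by (simp add: o_def)
  have sq: "(norm (A (A (y m)) - \<mu>\<^sup>2 *\<^sub>R y m))\<^sup>2 \<le> \<mu>\<^sup>2 * (\<mu>\<^sup>2 - (norm (A (y m)))\<^sup>2)" for m
  proof -
    have "A (y m) \<in> V" using V(3) yV by blast
    then have "norm (A (A (y m))) \<le> \<mu> * norm (A (y m))" by (rule le)
    then have "(norm (A (A (y m))))\<^sup>2 \<le> \<mu>\<^sup>2 * (norm (A (y m)))\<^sup>2"
      using power_mono[OF _ norm_ge_zero, of _ _ 2] unfolding power_mult_distrib[symmetric] by blast
    moreover have "(norm (A (A (y m)) - \<mu>\<^sup>2 *\<^sub>R y m))\<^sup>2
        = (norm (A (A (y m))))\<^sup>2 - 2 * \<mu>\<^sup>2 * (norm (A (y m)))\<^sup>2 + \<mu>\<^sup>2 * \<mu>\<^sup>2 * (norm (y m))\<^sup>2"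
      using sym[of "A (y m)" "y m"]
      by (simp add: power2_norm_eq_inner inner_diff_left inner_diff_right inner_commute algebra_simps)
    moreover have "\<mu>\<^sup>2 * \<mu>\<^sup>2 * (norm (y m))\<^sup>2 \<le> \<mu>\<^sup>2 * \<mu>\<^sup>2 * 1"
      using ny[of m] by (intro mult_left_mono) (auto simp: abs_square_le_1)
    ultimately show ?thesis by (simp add: algebra_simps)
  qed
  have "(\<lambda>m. A (A (y m)) - \<mu>\<^sup>2 *\<^sub>R y m) \<longlonglongrightarrow> 0"
  proof -
    have "(\<lambda>m. \<mu>\<^sup>2 * (\<mu>\<^sup>2 - (norm (A (y m)))\<^sup>2)) \<longlonglongrightarrow> \<mu>\<^sup>2 * (\<mu>\<^sup>2 - \<mu>\<^sup>2)"
      using lim\<mu> by (intro tendsto_intros)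
    then have up: "(\<lambda>m. \<mu>\<^sup>2 * (\<mu>\<^sup>2 - (norm (A (y m)))\<^sup>2)) \<longlonglongrightarrow> 0" by simp
    have "(\<lambda>m. (norm (A (A (y m)) - \<mu>\<^sup>2 *\<^sub>R y m))\<^sup>2) \<longlonglongrightarrow> 0"
      by (rule tendsto_sandwich[OF _ _ tendsto_const up]) (intro always_eventually allI sq zero_le_power2)+
    then have "(\<lambda>m. sqrt ((norm (A (A (y m)) - \<mu>\<^sup>2 *\<^sub>R y m))\<^sup>2)) \<longlonglongrightarrow> sqrt 0"
      by (rule tendsto_real_sqrt)
    then show ?thesis by (simp add: tendsto_norm_zero_iff)
  qed
  from LIMSEQ_subseq_LIMSEQ[OF this r]
  have "(\<lambda>m. A (A (y (r m))) - \<mu>\<^sup>2 *\<^sub>R y (r m)) \<longlonglongrightarrow> 0" by (simp add: o_def)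
  from tendsto_diff[OF A.tendsto[OF z] this]
  have "(\<lambda>m. \<mu>\<^sup>2 *\<^sub>R y (r m)) \<longlonglongrightarrow> A z" by simp
  from tendsto_scaleR[OF tendsto_const this, of "1 / \<mu>\<^sup>2"]
  have yp: "(\<lambda>m. y (r m)) \<longlonglongrightarrow> (1 / \<mu>\<^sup>2) *\<^sub>R A z" using \<mu> by simp
  define p where "p = (1 / \<mu>\<^sup>2) *\<^sub>R A z"
  have pV: "p \<in> V" unfolding p_def using V(2) yV yp by (rule closed_sequentially)
  have Ap: "A p = z" using A.tendsto[OF yp] z unfolding p_def by (rule LIMSEQ_unique)
  have AAp: "A (A p) = \<mu>\<^sup>2 *\<^sub>R p" using \<mu> by (simp add: Ap) (simp add: p_def)
  have "(\<lambda>m. norm (A (y (r m)))) \<longlonglongrightarrow> \<mu>" using LIMSEQ_subseq_LIMSEQ[OF lim\<mu> r] by (simp add: o_def)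
  then have "norm z = \<mu>" using tendsto_norm[OF z] by (rule LIMSEQ_unique[rotated])
  then have p0: "p \<noteq> 0" using Ap \<mu> A.zero by auto
  \<comment> \<open>\<open>A\<^sup>2 p = \<mu>\<^sup>2 p\<close> factors as \<open>(A - \<mu>) (A + \<mu>) p = 0\<close>, and \<open>A + \<mu>\<close> is injective since \<open>A\<close> is
     positive.\<close>
  define w where "w = A p + \<mu> *\<^sub>R p"
  have "w \<bullet> p = A p \<bullet> p + \<mu> * (norm p)\<^sup>2" by (simp add: w_def inner_add_left power2_norm_eq_inner)
  moreover have "0 < \<mu> * (norm p)\<^sup>2" using \<mu> p0 by simp
  ultimately have "w \<noteq> 0" using pos[of p] by auto
  moreover have "w \<in> V" unfolding w_def using V pV by (intro subspace_add subspace_mul) auto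
  moreover have "A w = \<mu> *\<^sub>R w"
    by (simp add: w_def A.add A.scaleR AAp power2_eq_square scaleR_add_right add.commute)
  ultimately show thesis using \<mu> le by (intro that)
qed

section \<open>Empirical covariance operators\<close>

lemma bounded_linear_emp_cov: "bounded_linear (emp_cov n x)"
  unfolding emp_cov_def tensor_def
  by (intro bounded_linear_compose[OF bounded_linear_scaleR_right] bounded_linear_sum
      bounded_linear_compose[OF bounded_linear_scaleR_left] bounded_linear_inner_right)

lemma emp_cov_inner: "emp_cov n x y \<bullet> z = (1 / real n) * (\<Sum>j<n. (x j \<bullet> y) * (x j \<bullet> z))"
  by (simp add: emp_cov_def tensor_def inner_sum_left)

lemma emp_cov_symmetric: "emp_cov n x y \<bullet> z = y \<bullet> emp_cov n x z"
  by (simp add: emp_cov_inner inner_commute[of y "emp_cov n x z"] mult.commute)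

lemma emp_cov_nonneg: "0 \<le> emp_cov n x y \<bullet> y"
  by (simp add: emp_cov_inner sum_nonneg)

text \<open>The operator has finite rank, with bounded coefficients on the unit ball.\<close>

lemma emp_cov_compact: "\<exists>C. compact C \<and> emp_cov n x ` cball 0 1 \<subseteq> C"
proof -
  define K where "K = (\<Sum>j<n. norm (x j))"
  have "emp_cov n x y \<in> {(\<Sum>j<n. c j *\<^sub>R x j) | c. \<forall>j<n. \<bar>c j\<bar> \<le> K}" if y: "norm y \<le> 1" for y
  proof -
    have "\<bar>(1 / real n) * (x j \<bullet> y)\<bar> \<le> K" if "j < n" for j
    proof -
      have "\<bar>x j \<bullet> y\<bar> \<le> norm (x j) * norm y" by (rule Cauchy_Schwarz_ineq2)
      also have "\<dots> \<le> norm (x j)" using y by (simp add: mult_left_le)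
      also have "\<dots> \<le> K" unfolding K_def using that by (intro member_le_sum) auto
      finally have "\<bar>x j \<bullet> y\<bar> \<le> K" .
      moreover have "1 / real n \<le> 1" using that by simp
      ultimately have "(1 / real n) * \<bar>x j \<bullet> y\<bar> \<le> 1 * K" by (intro mult_mono) auto
      then show ?thesis by (simp add: abs_mult)
    qed
    moreover have "emp_cov n x y = (\<Sum>j<n. ((1 / real n) * (x j \<bullet> y)) *\<^sub>R x j)"
      by (simp add: emp_cov_def tensor_def scaleR_sum_right)
    ultimately show ?thesis
      by (intro CollectI exI[of _ "\<lambda>j. (1 / real n) * (x j \<bullet> y)"]) auto
  qed
  then show ?thesis using compact_linear_combinations[where x=x and n=n and K=K] by (intro exI) auto
qed

context
  fixes n :: nat and x :: "nat \<Rightarrow> 'a::real_inner" and l v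
  assumes es: "eigensystem (emp_cov n x) l v"
begin

lemma eigensystem_orthonormal: "1 \<le> i \<Longrightarrow> 1 \<le> j \<Longrightarrow> v i \<bullet> v j = (if i = j then 1 else 0)"
  using es by (simp add: eigensystem_def)

lemma eigensystem_eigenvector: "1 \<le> j \<Longrightarrow> emp_cov n x (v j) = l j *\<^sub>R v j"
  using es by (simp add: eigensystem_def)

lemma eigensystem_antimono: "1 \<le> i \<Longrightarrow> i \<le> j \<Longrightarrow> l j \<le> l i"
  using es by (simp add: eigensystem_def monotone_on_def)

lemma eigensystem_orthonormal_or_zero: "orthonormal_or_zero {1..k} v"
  by (simp add: orthonormal_or_zero_def eigensystem_orthonormal)

lemma eigensystem_rayleigh: "1 \<le> j \<Longrightarrow> l j = emp_cov n x (v j) \<bullet> v j"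
  by (simp add: eigensystem_eigenvector eigensystem_orthonormal)

lemma eigensystem_nonneg: "1 \<le> j \<Longrightarrow> 0 \<le> l j"
  using eigensystem_rayleigh emp_cov_nonneg by metis

text \<open>On the orthogonal complement of the first \<open>k\<close> eigenvectors the norm is attained at an
  eigenvector, whose eigenvalue has to occur in the list after position \<open>k\<close>.\<close>

lemma eigensystem_tail:
  assumes orth: "\<And>j. j \<in> {1..k} \<Longrightarrow> y \<bullet> v j = 0"
  shows "norm (emp_cov n x y) \<le> l (Suc k) * norm y"
proof (cases "emp_cov n x y = 0")
  case True
  then show ?thesis using eigensystem_nonneg[of "Suc k"] by simp
next
  case False
  define V where "V = {y. \<forall>j\<in>{1..k}. y \<bullet> v j = 0}"
  have sub: "subspace V" by (auto simp: V_def subspace_def inner_add_left)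
  have "closed V"
  proof -
    have "V = (\<Inter>j\<in>{1..k}. {y. y \<bullet> v j = 0})" by (auto simp: V_def)
    then show ?thesis by (auto intro!: closed_Collect_eq continuous_intros)
  qed
  moreover have "emp_cov n x ` V \<subseteq> V"
    by (auto simp: V_def emp_cov_symmetric eigensystem_eigenvector)
  moreover obtain C where "compact C" "emp_cov n x ` cball 0 1 \<subseteq> C" using emp_cov_compact by blast
  moreover have yV: "y \<in> V" using orth by (auto simp: V_def)
  ultimately obtain \<mu> w where w: "0 < \<mu>" "w \<noteq> 0" "w \<in> V" "emp_cov n x w = \<mu> *\<^sub>R w"
    and le: "\<And>y. y \<in> V \<Longrightarrow> norm (emp_cov n x y) \<le> \<mu> * norm y"
    using top_eigenvector_on_invariant_subspace[OF bounded_linear_emp_cov emp_cov_symmetric emp_cov_nonneg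
        _ _ sub, of C n x y] False by metis
  have "w \<in> eigenspace (emp_cov n x) \<mu>" using w(4) by (simp add: eigenspace_def)
  then have wspan: "w \<in> span (v ` {j. 1 \<le> j \<and> l j = \<mu>})"
    using es w(1) by (auto simp: eigensystem_def)
  have "\<exists>j\<ge>Suc k. l j = \<mu>"
  proof (rule ccontr)
    assume "\<not> ?thesis"
    then have "v ` {j. 1 \<le> j \<and> l j = \<mu>} \<subseteq> v ` {1..k}" by (force simp: not_less_eq_eq)
    then have "orthogonal w s" if "s \<in> v ` {j. 1 \<le> j \<and> l j = \<mu>}" for s
      using w(3) that by (auto simp: V_def orthogonal_def)
    then have "orthogonal w w" using orthogonal_to_span[OF wspan] by blast
    then show False using w(2) by (simp add: orthogonal_self)
  qed
  then obtain j where j: "Suc k \<le> j" "l j = \<mu>" by blast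
  then have "\<mu> \<le> l (Suc k)" using eigensystem_antimono[of "Suc k" j] by simp
  then show ?thesis using le[OF yV] by (meson mult_right_mono norm_ge_zero order_trans)
qed

text \<open>The sum of the first \<open>k\<close> eigenvalues is at most the trace, and \<open>l k\<close> is the smallest of them.\<close>

lemma eigensystem_trace:
  assumes "1 \<le> k"
  shows "real k * l k \<le> (1 / real n) * (\<Sum>i<n. (norm (x i))\<^sup>2)"
proof -
  have "real k * l k = (\<Sum>j\<in>{1..k}. l k)" by simp
  also have "\<dots> \<le> (\<Sum>j\<in>{1..k}. l j)" by (intro sum_mono eigensystem_antimono) auto
  also have "\<dots> = (\<Sum>j\<in>{1..k}. (1 / real n) * (\<Sum>i<n. (x i \<bullet> v j)\<^sup>2))"
    by (intro sum.cong) (auto simp: eigensystem_rayleigh emp_cov_inner power2_eq_square)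
  also have "\<dots> = (1 / real n) * (\<Sum>i<n. \<Sum>j\<in>{1..k}. (x i \<bullet> v j)\<^sup>2)"
    by (subst sum.swap) (simp add: sum_distrib_left)
  also have "\<dots> \<le> (1 / real n) * (\<Sum>i<n. (norm (x i))\<^sup>2)"
    by (intro mult_left_mono sum_mono bessel_finite eigensystem_orthonormal_or_zero) auto
  finally show ?thesis .
qed

text \<open>The span of \<open>k\<close> orthonormal vectors contains a unit vector orthogonal to the first \<open>k - 1\<close>
  empirical eigenvectors; comparing the two quadratic forms there gives Weyl's inequality.\<close>

lemma eigensystem_weyl:
  fixes G :: "'a \<Rightarrow> 'a"
  assumes k: "1 \<le> k" and G: "linear G"
    and u: "\<And>i j. i \<in> {1..k} \<Longrightarrow> j \<in> {1..k} \<Longrightarrow> u i \<bullet> u j = (if i = j then 1 else 0)"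
    and Gu: "\<And>i. i \<in> {1..k} \<Longrightarrow> G (u i) = m i *\<^sub>R u i" and m: "\<And>i. i \<in> {1..k} \<Longrightarrow> \<kappa> \<le> m i"
    and close: "\<And>y. norm (emp_cov n x y - G y) \<le> \<delta> * norm y"
  shows "\<kappa> \<le> l k + \<delta>"
proof -
  interpret G: linear G by fact
  let ?U = "u ` {1..k}"
  let ?g = "orth_proj {1..k-1} v"
  have inju: "inj_on u {1..k}"
  proof (rule inj_onI, rule ccontr)
    fix i j assume ij: "i \<in> {1..k}" "j \<in> {1..k}" "u i = u j" "i \<noteq> j"
    then have "u i \<bullet> u i = 0" using u[of i j] by simp
    then show False using u[of i i] ij(1) by simp
  qed
  have indU: "independent ?U"
  proof (rule pairwise_orthogonal_independent)
    show "pairwise orthogonal ?U" using u by (auto simp: pairwise_def orthogonal_def)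
    show "0 \<notin> ?U" using u by fastforce
  qed
  have "\<not> inj_on ?g (span ?U)"
  proof
    assume inj: "inj_on ?g (span ?U)"
    have lin: "linear ?g" using bounded_linear_orth_proj by (rule bounded_linear.linear)
    have "independent (?g ` ?U)" using lin indU inj by (rule linear_independent_injective_image)
    moreover have "?g ` ?U \<subseteq> span (v ` {1..k-1})"
      by (rule image_subsetI) (unfold orth_proj_def, intro span_sum span_scale span_base imageI)
    ultimately have "card (?g ` ?U) \<le> card (v ` {1..k-1})"
      using independent_span_bound[of "v ` {1..k-1}" "?g ` ?U"] by simp
    also have "\<dots> \<le> k - 1" using card_image_le[of "{1..k-1}" v] by simp
    also have "card (?g ` ?U) = k"
      by (simp only: card_image[OF inj_on_subset[OF inj span_superset]] card_image[OF inju]) simp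
    finally show False using k by simp
  qed
  then obtain y where y: "y \<in> span ?U" "y \<noteq> 0" "?g y = 0"
  proof -
    assume *: "\<And>y. y \<in> span ?U \<Longrightarrow> y \<noteq> 0 \<Longrightarrow> ?g y = 0 \<Longrightarrow> thesis"
    obtain a b where "a \<in> span ?U" "b \<in> span ?U" "?g a = ?g b" "a \<noteq> b"
      using \<open>\<not> inj_on ?g (span ?U)\<close> by (auto simp: inj_on_def)
    then show thesis
      by (intro *[of "a - b"])
         (auto simp: span_diff linear_diff[OF bounded_linear.linear[OF bounded_linear_orth_proj]])
  qed
  have "y \<bullet> v j = 0" if "j \<in> {1..k-1}" for j
    using orth_proj_inner_basis[OF _ eigensystem_orthonormal_or_zero that, of y] y(3) by simp
  then have "norm (emp_cov n x y) \<le> l k * norm y"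
    using eigensystem_tail[of "k - 1" y] k by simp
  then have "norm (G y) \<le> (l k + \<delta>) * norm y"
    using close[of y] norm_triangle_sub[of "G y" "emp_cov n x y"] by (simp add: norm_minus_commute algebra_simps)
  then have up: "G y \<bullet> y \<le> (l k + \<delta>) * (norm y)\<^sup>2"
    using norm_cauchy_schwarz[of "G y" y] mult_right_mono[of "norm (G y)" _ "norm y"]
    by (fastforce simp: power2_eq_square)
  obtain c where c: "y = (\<Sum>i\<in>{1..k}. c i *\<^sub>R u i)"
  proof -
    obtain d where "y = (\<Sum>w\<in>?U. d w *\<^sub>R w)" using y(1) by (auto simp: span_finite)
    then have "y = (\<Sum>i\<in>{1..k}. d (u i) *\<^sub>R u i)" using inju by (simp add: sum.reindex)
    then show thesis by (rule that)
  qed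
  have yu: "y \<bullet> u i = c i" if "i \<in> {1..k}" for i
  proof -
    have "y \<bullet> u i = (\<Sum>j\<in>{1..k}. if j = i then c j else 0)"
      unfolding c inner_sum_left using that by (intro sum.cong) (auto simp: u)
    then show ?thesis using that by simp
  qed
  have ny: "(norm y)\<^sup>2 = (\<Sum>i\<in>{1..k}. (c i)\<^sup>2)"
  proof -
    have "(norm y)\<^sup>2 = (\<Sum>i\<in>{1..k}. c i *\<^sub>R u i) \<bullet> y" unfolding c[symmetric] by (simp add: power2_norm_eq_inner)
    also have "\<dots> = (\<Sum>i\<in>{1..k}. c i * (y \<bullet> u i))" by (simp add: inner_sum_left inner_commute[of y])
    also have "\<dots> = (\<Sum>i\<in>{1..k}. (c i)\<^sup>2)" by (intro sum.cong) (simp_all add: yu power2_eq_square)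
    finally show ?thesis .
  qed
  have "G y \<bullet> y = (\<Sum>i\<in>{1..k}. m i * (c i)\<^sup>2)"
  proof -
    have "G y = (\<Sum>i\<in>{1..k}. c i *\<^sub>R m i *\<^sub>R u i)"
      unfolding c G.sum G.scale by (intro sum.cong) (simp_all add: Gu)
    then have "G y \<bullet> y = (\<Sum>i\<in>{1..k}. c i * (m i * (y \<bullet> u i)))"
      by (simp add: inner_sum_left inner_commute[of y] mult.assoc)
    also have "\<dots> = (\<Sum>i\<in>{1..k}. m i * (c i)\<^sup>2)" by (intro sum.cong) (simp_all add: yu power2_eq_square)
    finally show ?thesis .
  qed
  also have "\<dots> \<ge> (\<Sum>i\<in>{1..k}. \<kappa> * (c i)\<^sup>2)" by (intro sum_mono mult_right_mono m) auto
  finally have "\<kappa> * (norm y)\<^sup>2 \<le> G y \<bullet> y" by (simp add: ny sum_distrib_left)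
  with up have "\<kappa> * (norm y)\<^sup>2 \<le> (l k + \<delta>) * (norm y)\<^sup>2" by simp
  then show ?thesis using y(2) by simp
qed

section \<open>The regularised estimator of the autoregression operator\<close>

lemma truncated_inverse_bounded_linear: "bounded_linear (truncated_inverse k l v)"
  unfolding truncated_inverse_def tensor_def
  by (intro bounded_linear_sum bounded_linear_compose[OF bounded_linear_scaleR_right]
      bounded_linear_compose[OF bounded_linear_scaleR_left] bounded_linear_inner_right)

lemma emp_cov_truncated_inverse:
  assumes "1 \<le> k" "0 < l k"
  shows "emp_cov n x (truncated_inverse k l v y) = orth_proj {1..k} v y"
proof -
  interpret bounded_linear "emp_cov n x" by (rule bounded_linear_emp_cov)
  have "0 < l j" if "j \<in> {1..k}" for j using eigensystem_antimono[of j k] that assms by auto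
  then have "l j \<noteq> 0" if "j \<in> {1..k}" for j using that by force
  then show ?thesis
    unfolding truncated_inverse_def orth_proj_def sum tensor_def scaleR
    by (intro sum.cong) (auto simp: eigensystem_eigenvector inner_commute)
qed

text \<open>The coefficients with respect to the eigenvectors are multiplied by factors of at most \<open>1 / l k\<close>.\<close>

lemma norm_truncated_inverse_le:
  assumes "1 \<le> k" "0 < l k"
  shows "norm (truncated_inverse k l v y) \<le> norm y / l k"
proof -
  have lk: "l k \<le> l j" if "j \<in> {1..k}" for j using eigensystem_antimono[of j k] that by auto
  define c where "c j = (1 / l j) * (y \<bullet> v j)" for j
  have T: "truncated_inverse k l v y = (\<Sum>j\<in>{1..k}. c j *\<^sub>R v j)" (is "?t = _")
    by (simp add: truncated_inverse_def tensor_def c_def inner_commute)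
  have tv: "?t \<bullet> v j = c j" if "j \<in> {1..k}" for j
  proof -
    have "?t \<bullet> v j = (\<Sum>i\<in>{1..k}. if i = j then c i else 0)"
      unfolding T inner_sum_left using that by (intro sum.cong) (auto simp: eigensystem_orthonormal)
    then show ?thesis using that by simp
  qed
  have "(norm ?t)\<^sup>2 = (\<Sum>j\<in>{1..k}. c j *\<^sub>R v j) \<bullet> ?t" unfolding T[symmetric] by (simp add: power2_norm_eq_inner)
  also have "\<dots> = (\<Sum>j\<in>{1..k}. c j * (?t \<bullet> v j))" by (simp add: inner_sum_left inner_commute[of ?t])
  also have "\<dots> = (\<Sum>j\<in>{1..k}. (c j)\<^sup>2)" by (intro sum.cong) (simp_all add: tv power2_eq_square)
  also have "\<dots> \<le> (\<Sum>j\<in>{1..k}. (1 / l k)\<^sup>2 * (y \<bullet> v j)\<^sup>2)"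
    unfolding c_def power_mult_distrib
  proof (intro sum_mono mult_right_mono power_mono)
    fix j assume j: "j \<in> {1..k}"
    then have "0 < l j" using lk[OF j] assms by linarith
    then show "0 \<le> 1 / l j" "1 / l j \<le> 1 / l k" using lk[OF j] assms by (auto intro: divide_left_mono)
  qed auto
  also have "\<dots> = (1 / l k)\<^sup>2 * (\<Sum>j\<in>{1..k}. (y \<bullet> v j)\<^sup>2)" by (simp add: sum_distrib_left)
  also have "\<dots> \<le> (1 / l k)\<^sup>2 * (norm y)\<^sup>2"
    by (intro mult_left_mono bessel_finite eigensystem_orthonormal_or_zero) auto
  also have "\<dots> = (norm y / l k)\<^sup>2" by (simp add: power_divide)
  finally show ?thesis by (rule power2_le_imp_le) (use assms in auto)
qed

lemma Psi_hat_bounded_linear: "bounded_linear (Psi_hat n k l v x)"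
proof -
  have "bounded_linear (emp_cross_cov n x)"
    unfolding emp_cross_cov_def tensor_def
    by (intro bounded_linear_compose[OF bounded_linear_scaleR_right] bounded_linear_sum
      bounded_linear_compose[OF bounded_linear_scaleR_left] bounded_linear_inner_right)
  then show ?thesis
    unfolding Psi_hat_def o_def using truncated_inverse_bounded_linear by (rule bounded_linear_compose)
qed

text \<open>The error is \<open>- \<Psi> Q + R A'\<close>, where \<open>Q\<close> projects onto the orthogonal complement of the first \<open>k\<close> empirical
eigenvectors, \<open>R\<close> is the noise and \<open>A'\<close> the truncated inverse. Up to \<open>\<eta>\<close>, the norm of \<open>\<Psi> Q\<close> is determined
by the finitely many vectors \<open>Q (e i)\<close>. Each \<open>e i\<close> is close to \<open>G (g i)\<close>, thus to the image of \<open>g i\<close> under the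
empirical covariance operator, and \<open>Q\<close> shrinks that image by the eigenvalue of index
\<open>k + 1\<close>, which is at most \<open>K / (k + 1)\<close>.\<close>

lemma Psi_hat_error:
  fixes \<Psi> :: "'a \<Rightarrow>\<^sub>L 'a"
  assumes k: "1 \<le> k" and lk: "0 < l k"
    and e: "orthonormal_frame e"
    and tail: "\<And>z. norm (\<Psi> (z - orth_proj {..<m} e z)) \<le> \<eta> * norm z" and \<eta>: "0 \<le> \<eta>"
    and appr: "\<And>i. i < m \<Longrightarrow> norm (e i - G (g i)) \<le> \<zeta>"
    and close: "\<And>y. norm (emp_cov n x y - G y) \<le> \<delta> * norm y"
    and trace: "(1 / real n) * (\<Sum>i<n. (norm (x i))\<^sup>2) \<le> K"
    and noise: "\<And>y. norm (emp_cross_cov n x y - \<Psi> (emp_cov n x y)) \<le> r * norm y"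
  shows "norm (Psi_hat n k l v x y - \<Psi> y)
    \<le> (norm \<Psi> * (\<Sum>i<m. \<zeta> + (K / real (Suc k) + \<delta>) * norm (g i)) + \<eta> + r / l k) * norm y"
proof -
  define Q where "Q y = y - orth_proj {1..k} v y" for y
  let ?A = "emp_cov n x"
  interpret A: bounded_linear ?A by (rule bounded_linear_emp_cov)
  interpret P: bounded_linear "orth_proj {1..k} v" by (rule bounded_linear_orth_proj)
  have Qle: "norm (Q y) \<le> norm y" for y
    unfolding Q_def by (intro norm_minus_orth_proj_le eigensystem_orthonormal_or_zero) auto
  have Qadd: "Q (y + z) = Q y + Q z" for y z unfolding Q_def P.add by simp
  have Qsym: "Q y \<bullet> z = y \<bullet> Q z" for y z
    by (simp add: Q_def inner_diff_left inner_diff_right orth_proj_symmetric)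
  have QA: "norm (Q (?A y)) \<le> K / real (Suc k) * norm y" for y
  proof -
    have "orth_proj {1..k} v (?A y) = ?A (orth_proj {1..k} v y)"
      unfolding orth_proj_def A.sum A.scaleR
      by (intro sum.cong) (auto simp: emp_cov_symmetric eigensystem_eigenvector)
    then have "Q (?A y) = ?A (Q y)" by (simp add: Q_def A.diff)
    also have "norm (?A (Q y)) \<le> l (Suc k) * norm (Q y)"
    proof (rule eigensystem_tail)
      fix j assume "j \<in> {1..k}"
      then show "Q y \<bullet> v j = 0"
        using orth_proj_inner_basis[OF _ eigensystem_orthonormal_or_zero] by (simp add: Q_def inner_diff_left)
    qed
    also have "\<dots> \<le> K / real (Suc k) * norm y"
    proof (intro mult_mono Qle)
      have "real (Suc k) * l (Suc k) \<le> K" using eigensystem_trace[of "Suc k"] trace by simp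
      then show "l (Suc k) \<le> K / real (Suc k)" by (simp add: field_simps)
      then show "0 \<le> K / real (Suc k)" using eigensystem_nonneg[of "Suc k"] by simp
    qed auto
    finally show ?thesis .
  qed
  have Qe: "norm (Q (e i)) \<le> \<zeta> + (K / real (Suc k) + \<delta>) * norm (g i)" if i: "i < m" for i
  proof -
    have "e i = (e i - G (g i)) + (- (?A (g i) - G (g i)) + ?A (g i))" by simp
    then have "Q (e i) = Q (e i - G (g i)) + (Q (- (?A (g i) - G (g i))) + Q (?A (g i)))"
      by (metis Qadd)
    then have "norm (Q (e i)) \<le> norm (Q (e i - G (g i))) + (norm (Q (- (?A (g i) - G (g i)))) + norm (Q (?A (g i))))"
      by (metis norm_triangle_le add_left_mono norm_triangle_ineq)
    also have "\<dots> \<le> \<zeta> + (\<delta> * norm (g i) + K / real (Suc k) * norm (g i))"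
      using order_trans[OF Qle appr[OF i]] order_trans[OF Qle, of "- (?A (g i) - G (g i))"] close[of "g i"] QA[of "g i"]
      by (intro add_mono) (auto simp: norm_minus_commute)
    finally show ?thesis by (simp add: algebra_simps)
  qed
  have \<Psi>Q: "norm (\<Psi> (Q y)) \<le> (norm \<Psi> * (\<Sum>i<m. \<zeta> + (K / real (Suc k) + \<delta>) * norm (g i)) + \<eta>) * norm y"
  proof -
    let ?P = "orth_proj {..<m} e"
    have "norm (?P (Q y)) \<le> (\<Sum>i<m. norm ((Q y \<bullet> e i) *\<^sub>R e i))" unfolding orth_proj_def by (rule norm_sum)
    also have "\<dots> \<le> (\<Sum>i<m. (\<zeta> + (K / real (Suc k) + \<delta>) * norm (g i)) * norm y)"
    proof (rule sum_mono)
      fix i assume "i \<in> {..<m}"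
      have "norm (e i) \<le> 1" using e unfolding orthonormal_frame_def by (metis norm_zero order_refl zero_le_one)
      then have "norm ((Q y \<bullet> e i) *\<^sub>R e i) \<le> \<bar>y \<bullet> Q (e i)\<bar>" by (simp add: Qsym mult_left_le)
      also have "\<dots> \<le> norm y * norm (Q (e i))" by (rule Cauchy_Schwarz_ineq2)
      also have "\<dots> \<le> norm y * (\<zeta> + (K / real (Suc k) + \<delta>) * norm (g i))"
        using Qe \<open>i \<in> {..<m}\<close> by (intro mult_left_mono) auto
      finally show "norm ((Q y \<bullet> e i) *\<^sub>R e i) \<le> (\<zeta> + (K / real (Suc k) + \<delta>) * norm (g i)) * norm y"
        by (simp add: mult.commute)
    qed
    finally have "norm (?P (Q y)) \<le> (\<Sum>i<m. \<zeta> + (K / real (Suc k) + \<delta>) * norm (g i)) * norm y"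
      by (simp add: sum_distrib_right)
    then have "norm (\<Psi> (?P (Q y))) \<le> norm \<Psi> * ((\<Sum>i<m. \<zeta> + (K / real (Suc k) + \<delta>) * norm (g i)) * norm y)"
      using norm_blinfun[of \<Psi> "?P (Q y)"] by (meson mult_left_mono norm_ge_zero order_trans)
    moreover have "norm (\<Psi> (Q y - ?P (Q y))) \<le> \<eta> * norm y"
      using tail[of "Q y"] mult_left_mono[OF Qle \<eta>] by (rule order_trans)
    moreover have "\<Psi> (Q y) = \<Psi> (?P (Q y)) + \<Psi> (Q y - ?P (Q y))" by (simp flip: blinfun.add_right)
    ultimately show ?thesis
      using norm_triangle_ineq[of "\<Psi> (?P (Q y))" "\<Psi> (Q y - ?P (Q y))"] by (simp add: algebra_simps)
  qed
  let ?t = "truncated_inverse k l v y"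
  have "0 \<le> r * norm (v 1)" using noise[of "v 1"] norm_ge_zero order_trans by blast
  then have r: "0 \<le> r" using eigensystem_orthonormal[of 1 1] by (simp add: norm_eq_1[THEN iffD2])
  have "Psi_hat n k l v x y - \<Psi> y = (emp_cross_cov n x ?t - \<Psi> (?A ?t)) - \<Psi> (Q y)"
    by (simp add: Psi_hat_def emp_cov_truncated_inverse[OF k lk] Q_def blinfun.diff_right)
  also have "norm \<dots> \<le> norm (emp_cross_cov n x ?t - \<Psi> (?A ?t)) + norm (\<Psi> (Q y))"
    by (rule norm_triangle_ineq4)
  also have "\<dots> \<le> r * (norm y / l k)
      + (norm \<Psi> * (\<Sum>i<m. \<zeta> + (K / real (Suc k) + \<delta>) * norm (g i)) + \<eta>) * norm y"
    using order_trans[OF noise mult_left_mono[OF norm_truncated_inverse_le[OF k lk] r]] \<Psi>Q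
    by (intro add_mono) auto
  finally show ?thesis by (simp add: algebra_simps)
qed

end

section \<open>Couplings\<close>

text \<open>The maximal coupling of two laws \<open>p\<close>, \<open>q\<close> on a finite set, given by its density \<open>g\<close> with respect to the
product law: the common part \<open>m = min p q\<close> is put on the diagonal, and the two remainders, of total
mass \<open>\<delta>\<close> each, are coupled independently. Division by zero is harmless: if \<open>\<delta> = 0\<close>, the remainders
vanish, and if \<open>p a = 0\<close> or \<open>q b = 0\<close>, the value of \<open>g\<close> does not affect the sums.\<close>

lemma coupling_weights:
  fixes p q :: "'v \<Rightarrow> real"
  assumes V: "finite V" and nn: "\<And>v. v \<in> V \<Longrightarrow> 0 \<le> p v" "\<And>v. v \<in> V \<Longrightarrow> 0 \<le> q v"
    and sum1: "sum p V = 1" "sum q V = 1"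
  obtains g where "\<And>a b. a \<in> V \<Longrightarrow> b \<in> V \<Longrightarrow> 0 \<le> g a b"
    "\<And>a. a \<in> V \<Longrightarrow> 0 < p a \<Longrightarrow> (\<Sum>b\<in>V. g a b * q b) = 1"
    "\<And>b. b \<in> V \<Longrightarrow> 0 < q b \<Longrightarrow> (\<Sum>a\<in>V. g a b * p a) = 1"
    "(\<Sum>a\<in>V. (\<Sum>b\<in>V. (if a = b then 0 else g a b) * q b) * p a) \<le> (\<Sum>v\<in>V. \<bar>p v - q v\<bar>)"
proof -
  define m where "m v = min (p v) (q v)" for v
  define \<delta> where "\<delta> = 1 - sum m V"
  define r where "r v = (p v - m v) / p v" for v
  define s where "s v = (q v - m v) / q v" for v
  define d where "d v = m v / (p v * q v)" for v
  define g where "g a b = (if a = b then d a else 0) + r a * s b / \<delta>" for a b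
  have mp: "0 \<le> m v" "m v \<le> p v" "m v \<le> q v" if "v \<in> V" for v using nn[OF that] by (auto simp: m_def)
  have rp: "r v * p v = p v - m v" if "v \<in> V" for v using mp[OF that] by (auto simp: r_def)
  have sq: "s v * q v = q v - m v" if "v \<in> V" for v using mp[OF that] by (auto simp: s_def)
  have r0: "0 \<le> r v" and s0: "0 \<le> s v" and d0: "0 \<le> d v" if "v \<in> V" for v
    using mp[OF that] nn[OF that] by (auto simp: r_def s_def d_def)
  have \<delta>p: "(\<Sum>v\<in>V. p v - m v) = \<delta>" and \<delta>q: "(\<Sum>v\<in>V. q v - m v) = \<delta>"
    by (simp_all add: \<delta>_def sum_subtractf sum1)
  have \<delta>0: "0 \<le> \<delta>" unfolding \<delta>p[symmetric] using mp by (intro sum_nonneg) auto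
  have zp: "p v - m v = 0" and zq: "q v - m v = 0" if "\<delta> = 0" "v \<in> V" for v
  proof -
    have "(\<Sum>v\<in>V. p v - m v) = 0" "(\<Sum>v\<in>V. q v - m v) = 0" using \<delta>p \<delta>q that by auto
    then show "p v - m v = 0" "q v - m v = 0"
      using sum_nonneg_0[OF V, of "\<lambda>v. p v - m v" v] sum_nonneg_0[OF V, of "\<lambda>v. q v - m v" v] mp that
      by auto
  qed
  have ssum: "(\<Sum>b\<in>V. s b * q b) = \<delta>" "(\<Sum>a\<in>V. r a * p a) = \<delta>"
    using \<delta>p \<delta>q by (simp_all add: rp sq cong: sum.cong)
  have g1: "(\<Sum>b\<in>V. g a b * q b) = 1" if a: "a \<in> V" "0 < p a" for a
  proof -
    have "(\<Sum>b\<in>V. g a b * q b) = (\<Sum>b\<in>V. if a = b then d a * q a else 0) + (r a / \<delta>) * (\<Sum>b\<in>V. s b * q b)"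
      unfolding sum_distrib_left sum.distrib[symmetric] by (intro sum.cong) (auto simp: g_def algebra_simps)
    also have "\<dots> = d a * q a + r a / \<delta> * \<delta>" using a V by (simp add: ssum)
    also have "d a * q a = m a / p a" using mp[of a] a by (auto simp: d_def)
    also have "r a / \<delta> * \<delta> = (p a - m a) / p a" using zp[OF _ a(1)] by (cases "\<delta> = 0") (auto simp: r_def)
    finally show ?thesis using a by (simp add: diff_divide_distrib)
  qed
  have g2: "(\<Sum>a\<in>V. g a b * p a) = 1" if b: "b \<in> V" "0 < q b" for b
  proof -
    have "(\<Sum>a\<in>V. g a b * p a) = (\<Sum>a\<in>V. if a = b then d b * p b else 0) + (s b / \<delta>) * (\<Sum>a\<in>V. r a * p a)"
      unfolding sum_distrib_left sum.distrib[symmetric] by (intro sum.cong) (auto simp: g_def algebra_simps)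
    also have "\<dots> = d b * p b + s b / \<delta> * \<delta>" using b V by (simp add: ssum)
    also have "d b * p b = m b / q b" using mp[of b] b by (auto simp: d_def)
    also have "s b / \<delta> * \<delta> = (q b - m b) / q b" using zq[OF _ b(1)] by (cases "\<delta> = 0") (auto simp: s_def)
    finally show ?thesis using b by (simp add: diff_divide_distrib)
  qed
  have g0: "0 \<le> g a b" if "a \<in> V" "b \<in> V" for a b
    using r0[OF that(1)] s0[OF that(2)] d0[OF that(1)] \<delta>0 by (auto simp: g_def)
  have "(\<Sum>a\<in>V. (\<Sum>b\<in>V. (if a = b then 0 else g a b) * q b) * p a)
      \<le> (\<Sum>a\<in>V. (\<Sum>b\<in>V. (r a * s b / \<delta>) * q b) * p a)"
    using nn r0 s0 \<delta>0 by (intro sum_mono mult_right_mono) (auto simp: g_def)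
  also have "\<dots> = (\<Sum>a\<in>V. r a * p a) * (\<Sum>b\<in>V. s b * q b) / \<delta>"
  proof -
    have "(\<Sum>b\<in>V. (r a * s b / \<delta>) * q b) = r a * ((\<Sum>b\<in>V. s b * q b) / \<delta>)" for a
      by (simp add: sum_distrib_left sum_divide_distrib mult_ac)
    then have "(\<Sum>a\<in>V. (\<Sum>b\<in>V. (r a * s b / \<delta>) * q b) * p a)
        = (\<Sum>a\<in>V. (r a * p a) * ((\<Sum>b\<in>V. s b * q b) / \<delta>))" by (simp add: mult_ac)
    then show ?thesis by (simp only: sum_distrib_right[symmetric] times_divide_eq_right sum_divide_distrib[symmetric])
  qed
  also have "\<dots> = \<delta>" by (simp add: ssum)
  also have "\<dots> = (\<Sum>v\<in>V. p v - m v)" by (simp add: \<delta>p)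
  also have "\<dots> \<le> (\<Sum>v\<in>V. \<bar>p v - q v\<bar>)" by (intro sum_mono) (auto simp: m_def)
  finally show thesis using g0 g1 g2 by (intro that)
qed

lemma nn_integral_finite_classes:
  assumes "prob_space N" and \<tau>: "\<tau> \<in> N \<rightarrow>\<^sub>M count_space V" and V: "finite V"
  shows "(\<integral>\<^sup>+\<omega>. H (\<tau> \<omega>) \<partial>N) = (\<Sum>v\<in>V. H v * ennreal (measure N {\<omega>\<in>space N. \<tau> \<omega> = v}))"
proof -
  interpret prob_space N by fact
  note [measurable] = \<tau>
  have [measurable]: "{\<omega>\<in>space N. \<tau> \<omega> = v} \<in> sets N" for v by measurable
  have "(\<integral>\<^sup>+\<omega>. H (\<tau> \<omega>) \<partial>N) = (\<integral>\<^sup>+\<omega>. (\<Sum>v\<in>V. H v * indicator {\<omega>\<in>space N. \<tau> \<omega> = v} \<omega>) \<partial>N)"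
  proof (intro nn_integral_cong)
    fix \<omega> assume \<omega>: "\<omega> \<in> space N"
    have "\<tau> \<omega> \<in> V" using measurable_space[OF \<tau> \<omega>] by simp
    moreover have "(\<Sum>v\<in>V. H v * indicator {\<omega>\<in>space N. \<tau> \<omega> = v} \<omega>) = (\<Sum>v\<in>V. if v = \<tau> \<omega> then H v else 0)"
      using \<omega> by (intro sum.cong) (auto simp: indicator_def)
    ultimately show "H (\<tau> \<omega>) = (\<Sum>v\<in>V. H v * indicator {\<omega>\<in>space N. \<tau> \<omega> = v} \<omega>)"
      using V by simp
  qed
  also have "\<dots> = (\<Sum>v\<in>V. H v * ennreal (measure N {\<omega>\<in>space N. \<tau> \<omega> = v}))"
    by (simp add: nn_integral_sum nn_integral_cmult_indicator emeasure_eq_measure)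
  finally show ?thesis .
qed

lemma measure_finite_classes:
  assumes "prob_space N" and "\<tau> \<in> N \<rightarrow>\<^sub>M count_space V" and "finite V"
  shows "(\<Sum>v\<in>V. measure N {\<omega>\<in>space N. \<tau> \<omega> = v}) = 1"
proof -
  interpret prob_space N by fact
  have "ennreal (\<Sum>v\<in>V. measure N {\<omega>\<in>space N. \<tau> \<omega> = v}) = 1"
    using nn_integral_finite_classes[OF assms, of "\<lambda>_. 1"] by (simp add: emeasure_space_1 sum_ennreal)
  then show ?thesis by (simp add: sum_nonneg)
qed

text \<open>Inside each pair of classes the coupling is a multiple of the product measure, so its density is
\<open>coupling_weights\<close> composed with the two class maps, and the marginals are computed class by
class.\<close>

lemma finite_class_coupling:
  assumes N1: "prob_space N1" and N2: "prob_space N2" and V: "finite V"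
    and \<tau>1: "\<tau>1 \<in> N1 \<rightarrow>\<^sub>M count_space V" and \<tau>2: "\<tau>2 \<in> N2 \<rightarrow>\<^sub>M count_space V"
  obtains Q where "prob_space Q" "sets Q = sets (N1 \<Otimes>\<^sub>M N2)"
    "distr Q N1 fst = N1" "distr Q N2 snd = N2"
    "emeasure Q {z\<in>space Q. \<tau>1 (fst z) \<noteq> \<tau>2 (snd z)} \<le>
      ennreal (\<Sum>v\<in>V. \<bar>measure N1 {\<omega>\<in>space N1. \<tau>1 \<omega> = v} - measure N2 {\<omega>\<in>space N2. \<tau>2 \<omega> = v}\<bar>)"
proof -
  interpret N1: prob_space N1 by fact
  interpret N2: prob_space N2 by fact
  interpret P: pair_prob_space N1 N2 ..
  note [measurable] = \<tau>1 \<tau>2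
  define p where "p v = measure N1 {\<omega>\<in>space N1. \<tau>1 \<omega> = v}" for v
  define q where "q v = measure N2 {\<omega>\<in>space N2. \<tau>2 \<omega> = v}" for v
  have sum1: "sum p V = 1" "sum q V = 1"
    unfolding p_def q_def using measure_finite_classes[OF N1 \<tau>1 V] measure_finite_classes[OF N2 \<tau>2 V] by auto
  obtain g where g0: "\<And>a b. a \<in> V \<Longrightarrow> b \<in> V \<Longrightarrow> 0 \<le> g a b"
    and g1: "\<And>a. a \<in> V \<Longrightarrow> 0 < p a \<Longrightarrow> (\<Sum>b\<in>V. g a b * q b) = 1"
    and g2: "\<And>b. b \<in> V \<Longrightarrow> 0 < q b \<Longrightarrow> (\<Sum>a\<in>V. g a b * p a) = 1"
    and goff: "(\<Sum>a\<in>V. (\<Sum>b\<in>V. (if a = b then 0 else g a b) * q b) * p a) \<le> (\<Sum>v\<in>V. \<bar>p v - q v\<bar>)"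
    using coupling_weights[OF V, of p q] sum1 by (auto simp: p_def q_def)
  have nn: "0 \<le> p v" "0 \<le> q v" for v by (simp_all add: p_def q_def)
  have int1: "(\<integral>\<^sup>+\<omega>. H (\<tau>1 \<omega>) \<partial>N1) = (\<Sum>v\<in>V. H v * ennreal (p v))" for H
    unfolding p_def by (rule nn_integral_finite_classes[OF N1 \<tau>1 V])
  have int2: "(\<integral>\<^sup>+\<omega>. H (\<tau>2 \<omega>) \<partial>N2) = (\<Sum>v\<in>V. H v * ennreal (q v))" for H
    unfolding q_def by (rule nn_integral_finite_classes[OF N2 \<tau>2 V])
  have V1: "\<tau>1 \<omega> \<in> V" if "\<omega> \<in> space N1" for \<omega> using measurable_space[OF \<tau>1 that] by simp
  have V2: "\<tau>2 \<omega> \<in> V" if "\<omega> \<in> space N2" for \<omega> using measurable_space[OF \<tau>2 that] by simp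
  have ae1: "AE \<omega> in N1. 0 < p (\<tau>1 \<omega>)"
  proof -
    have "(\<integral>\<^sup>+\<omega>. (if 0 < p (\<tau>1 \<omega>) then 0 else 1) \<partial>N1) = (\<Sum>v\<in>V. (if 0 < p v then 0 else 1) * ennreal (p v))"
      by (rule int1)
    also have "\<dots> = 0" using nn by (intro sum.neutral) (auto simp: not_less order_antisym)
    finally have "AE \<omega> in N1. (if 0 < p (\<tau>1 \<omega>) then 0 else 1 :: ennreal) = 0"
      by (subst (asm) nn_integral_0_iff_AE) (auto intro!: measurable_compose[OF \<tau>1])
    then show ?thesis by eventually_elim (auto split: if_splits)
  qed
  have ae2: "AE \<omega> in N2. 0 < q (\<tau>2 \<omega>)"
  proof -
    have "(\<integral>\<^sup>+\<omega>. (if 0 < q (\<tau>2 \<omega>) then 0 else 1) \<partial>N2) = (\<Sum>v\<in>V. (if 0 < q v then 0 else 1) * ennreal (q v))"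
      by (rule int2)
    also have "\<dots> = 0" using nn by (intro sum.neutral) (auto simp: not_less order_antisym)
    finally have "AE \<omega> in N2. (if 0 < q (\<tau>2 \<omega>) then 0 else 1 :: ennreal) = 0"
      by (subst (asm) nn_integral_0_iff_AE) (auto intro!: measurable_compose[OF \<tau>2])
    then show ?thesis by eventually_elim (auto split: if_splits)
  qed
  define h where "h z = ennreal (g (\<tau>1 (fst z)) (\<tau>2 (snd z)))" for z
  have meas2: "(\<lambda>z. G (\<tau>1 (fst z)) (\<tau>2 (snd z))) \<in> borel_measurable (N1 \<Otimes>\<^sub>M N2)"
    for G :: "_ \<Rightarrow> _ \<Rightarrow> ennreal"
  proof -
    have "(\<lambda>z. (\<tau>1 (fst z), \<tau>2 (snd z))) \<in> N1 \<Otimes>\<^sub>M N2 \<rightarrow>\<^sub>M count_space V \<Otimes>\<^sub>M count_space V" by measurable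
    moreover have "count_space V \<Otimes>\<^sub>M count_space V = count_space (V \<times> V)"
      using V by (rule pair_measure_count_space[OF _ V])
    ultimately have "(\<lambda>z. (\<tau>1 (fst z), \<tau>2 (snd z))) \<in> N1 \<Otimes>\<^sub>M N2 \<rightarrow>\<^sub>M count_space (V \<times> V)" by simp
    from measurable_compose[OF this, of "\<lambda>(a, b). G a b" borel] show ?thesis by simp
  qed
  have hm [measurable]: "h \<in> borel_measurable (N1 \<Otimes>\<^sub>M N2)"
    unfolding h_def by (rule meas2[of "\<lambda>a b. ennreal (g a b)"])
  define Q where "Q = density (N1 \<Otimes>\<^sub>M N2) h"
  have sQ: "sets Q = sets (N1 \<Otimes>\<^sub>M N2)" "space Q = space (N1 \<Otimes>\<^sub>M N2)" by (simp_all add: Q_def)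
  have inner2: "(\<integral>\<^sup>+y. ennreal (g (\<tau>1 x) (\<tau>2 y)) \<partial>N2) = 1" if "x \<in> space N1" "0 < p (\<tau>1 x)" for x
  proof -
    have "(\<integral>\<^sup>+y. ennreal (g (\<tau>1 x) (\<tau>2 y)) \<partial>N2) = (\<Sum>v\<in>V. ennreal (g (\<tau>1 x) v) * ennreal (q v))" by (rule int2)
    also have "\<dots> = ennreal (\<Sum>v\<in>V. g (\<tau>1 x) v * q v)"
      using V1[OF that(1)] g0 nn by (subst sum_ennreal[symmetric]) (auto simp: ennreal_mult intro!: sum.cong)
    finally show ?thesis using g1[OF V1[OF that(1)] that(2)] by simp
  qed
  have inner1: "(\<integral>\<^sup>+x. ennreal (g (\<tau>1 x) (\<tau>2 y)) \<partial>N1) = 1" if "y \<in> space N2" "0 < q (\<tau>2 y)" for y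
  proof -
    have "(\<integral>\<^sup>+x. ennreal (g (\<tau>1 x) (\<tau>2 y)) \<partial>N1) = (\<Sum>v\<in>V. ennreal (g v (\<tau>2 y)) * ennreal (p v))"
      by (rule int1[of "\<lambda>v. ennreal (g v (\<tau>2 y))"])
    also have "\<dots> = ennreal (\<Sum>v\<in>V. g v (\<tau>2 y) * p v)"
      using V2[OF that(1)] g0 nn by (subst sum_ennreal[symmetric]) (auto simp: ennreal_mult intro!: sum.cong)
    finally show ?thesis using g2[OF V2[OF that(1)] that(2)] by simp
  qed
  have fst: "distr Q N1 fst = N1"
  proof (rule measure_eqI)
    fix A assume "A \<in> sets (distr Q N1 fst)"
    then have A[measurable]: "A \<in> sets N1" by simp
    have "emeasure (distr Q N1 fst) A = emeasure Q (fst -` A \<inter> space Q)"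
      by (intro emeasure_distr) (auto simp: Q_def)
    also have "\<dots> = (\<integral>\<^sup>+z. h z * indicator (fst -` A \<inter> space (N1 \<Otimes>\<^sub>M N2)) z \<partial>(N1 \<Otimes>\<^sub>M N2))"
      unfolding sQ(2) unfolding Q_def by (intro emeasure_density) (auto intro!: measurable_sets[OF measurable_fst A])
    also have "\<dots> = (\<integral>\<^sup>+z. h z * indicator A (fst z) \<partial>(N1 \<Otimes>\<^sub>M N2))"
      by (intro nn_integral_cong) (auto simp: indicator_def)
    also have "\<dots> = (\<integral>\<^sup>+x. \<integral>\<^sup>+y. h (x, y) * indicator A x \<partial>N2 \<partial>N1)"
      by (subst N2.nn_integral_fst[symmetric])
       (rule borel_measurable_times_ennreal[OF hm measurable_compose[OF measurable_fst borel_measurable_indicator[OF A]]], simp)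
    also have "\<dots> = (\<integral>\<^sup>+x. (\<integral>\<^sup>+y. ennreal (g (\<tau>1 x) (\<tau>2 y)) \<partial>N2) * indicator A x \<partial>N1)"
      unfolding h_def by (intro nn_integral_cong nn_integral_multc[THEN trans]) (auto intro!: measurable_compose[OF \<tau>2])
    also have "\<dots> = (\<integral>\<^sup>+x. indicator A x \<partial>N1)"
    proof (rule nn_integral_cong_AE)
      show "AE x in N1. (\<integral>\<^sup>+y. ennreal (g (\<tau>1 x) (\<tau>2 y)) \<partial>N2) * indicator A x = indicator A x"
        using ae1 AE_space by eventually_elim (simp add: inner2)
    qed
    also have "\<dots> = emeasure N1 A" by simp
    finally show "emeasure (distr Q N1 fst) A = emeasure N1 A" .
  qed simp
  have snd: "distr Q N2 snd = N2"
  proof (rule measure_eqI)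
    fix A assume "A \<in> sets (distr Q N2 snd)"
    then have A[measurable]: "A \<in> sets N2" by simp
    have "emeasure (distr Q N2 snd) A = emeasure Q (snd -` A \<inter> space Q)"
      by (intro emeasure_distr) (auto simp: Q_def)
    also have "\<dots> = (\<integral>\<^sup>+z. h z * indicator (snd -` A \<inter> space (N1 \<Otimes>\<^sub>M N2)) z \<partial>(N1 \<Otimes>\<^sub>M N2))"
      unfolding sQ(2) unfolding Q_def by (intro emeasure_density) (auto intro!: measurable_sets[OF measurable_snd A])
    also have "\<dots> = (\<integral>\<^sup>+z. h z * indicator A (snd z) \<partial>(N1 \<Otimes>\<^sub>M N2))"
      by (intro nn_integral_cong) (auto simp: indicator_def)
    also have "\<dots> = (\<integral>\<^sup>+y. \<integral>\<^sup>+x. h (x, y) * indicator A y \<partial>N1 \<partial>N2)"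
      by (subst P.nn_integral_snd[symmetric])
       (use borel_measurable_times_ennreal[OF hm measurable_compose[OF measurable_snd borel_measurable_indicator[OF A]]]
        in \<open>simp_all add: split_beta'\<close>)
    also have "\<dots> = (\<integral>\<^sup>+y. (\<integral>\<^sup>+x. ennreal (g (\<tau>1 x) (\<tau>2 y)) \<partial>N1) * indicator A y \<partial>N2)"
      unfolding h_def by (intro nn_integral_cong nn_integral_multc[THEN trans]) (auto intro!: measurable_compose[OF \<tau>1])
    also have "\<dots> = (\<integral>\<^sup>+y. indicator A y \<partial>N2)"
    proof (rule nn_integral_cong_AE)
      show "AE y in N2. (\<integral>\<^sup>+x. ennreal (g (\<tau>1 x) (\<tau>2 y)) \<partial>N1) * indicator A y = indicator A y"
        using ae2 AE_space by eventually_elim (simp add: inner1)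
    qed
    also have "\<dots> = emeasure N2 A" by simp
    finally show "emeasure (distr Q N2 snd) A = emeasure N2 A" .
  qed simp
  have probQ: "prob_space Q"
  proof
    have "emeasure N1 (space N1) = emeasure (distr Q N1 fst) (space N1)" by (simp add: fst)
    also have "\<dots> = emeasure Q (fst -` space N1 \<inter> space Q)" by (intro emeasure_distr) (auto simp: Q_def)
    also have "fst -` space N1 \<inter> space Q = space Q" by (auto simp: sQ(2) space_pair_measure)
    finally show "emeasure Q (space Q) = 1" by (simp add: N1.emeasure_space_1)
  qed
  let ?E = "{z\<in>space (N1 \<Otimes>\<^sub>M N2). \<tau>1 (fst z) \<noteq> \<tau>2 (snd z)}"
  have E: "?E \<in> sets (N1 \<Otimes>\<^sub>M N2)"
  proof -
    let ?G = "\<lambda>z. (if \<tau>1 (fst z) = \<tau>2 (snd z) then 0 else 1 :: ennreal)"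
    have "?G \<in> borel_measurable (N1 \<Otimes>\<^sub>M N2)" by (rule meas2[of "\<lambda>a b. if a = b then 0 else 1"])
    then have "?G -` {1} \<inter> space (N1 \<Otimes>\<^sub>M N2) \<in> sets (N1 \<Otimes>\<^sub>M N2)" by (rule measurable_sets) simp
    also have "?G -` {1} \<inter> space (N1 \<Otimes>\<^sub>M N2) = ?E" by auto
    finally show ?thesis .
  qed
  have "emeasure Q ?E = (\<integral>\<^sup>+z. h z * indicator ?E z \<partial>(N1 \<Otimes>\<^sub>M N2))"
    unfolding Q_def using E by (intro emeasure_density) auto
  also have "\<dots> = (\<integral>\<^sup>+z. (\<lambda>a b. ennreal (if a = b then 0 else g a b)) (\<tau>1 (fst z)) (\<tau>2 (snd z)) \<partial>(N1 \<Otimes>\<^sub>M N2))"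
    by (intro nn_integral_cong) (auto simp: h_def indicator_def)
  also have "\<dots> = (\<integral>\<^sup>+x. \<integral>\<^sup>+y. ennreal (if \<tau>1 x = \<tau>2 y then 0 else g (\<tau>1 x) (\<tau>2 y)) \<partial>N2 \<partial>N1)"
    by (subst N2.nn_integral_fst[symmetric])
       (simp_all only: meas2[of "\<lambda>a b. ennreal (if a = b then 0 else g a b)"] fst_conv snd_conv)
  also have "\<dots> = (\<integral>\<^sup>+x. (\<lambda>a. \<Sum>b\<in>V. ennreal (if a = b then 0 else g a b) * ennreal (q b)) (\<tau>1 x) \<partial>N1)"
    by (intro nn_integral_cong) (simp only: int2[of "\<lambda>b. ennreal (if _ = b then 0 else g _ b)"])
  also have "\<dots> = (\<Sum>a\<in>V. (\<Sum>b\<in>V. ennreal (if a = b then 0 else g a b) * ennreal (q b)) * ennreal (p a))"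
    by (rule int1)
  also have "\<dots> = (\<Sum>a\<in>V. ennreal ((\<Sum>b\<in>V. (if a = b then 0 else g a b) * q b) * p a))"
  proof (rule sum.cong[OF refl])
    fix a assume a: "a \<in> V"
    have "(\<Sum>b\<in>V. ennreal (if a = b then 0 else g a b) * ennreal (q b)) = ennreal (\<Sum>b\<in>V. (if a = b then 0 else g a b) * q b)"
      using g0[OF a] nn by (subst sum_ennreal[symmetric]) (auto simp: ennreal_mult intro!: sum.cong)
    then show "(\<Sum>b\<in>V. ennreal (if a = b then 0 else g a b) * ennreal (q b)) * ennreal (p a)
        = ennreal ((\<Sum>b\<in>V. (if a = b then 0 else g a b) * q b) * p a)"
      using g0[OF a] nn by (simp add: ennreal_mult sum_nonneg)
  qed
  also have "\<dots> = ennreal (\<Sum>a\<in>V. (\<Sum>b\<in>V. (if a = b then 0 else g a b) * q b) * p a)"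
    using g0 nn by (intro sum_ennreal mult_nonneg_nonneg sum_nonneg) auto
  also have "\<dots> \<le> ennreal (\<Sum>v\<in>V. \<bar>p v - q v\<bar>)" using goff by (rule ennreal_leI)
  finally have "emeasure Q {z\<in>space Q. \<tau>1 (fst z) \<noteq> \<tau>2 (snd z)} \<le> ennreal (\<Sum>v\<in>V. \<bar>p v - q v\<bar>)"
    by (simp add: sQ(2))
  then show thesis using probQ sQ(1) fst snd unfolding p_def q_def by (intro that)
qed

lemma ennreal_four:
  assumes "0 \<le> a" "0 \<le> b" "0 \<le> c" "0 \<le> d"
  shows "ennreal (4 * (a + b + c + d)) = 4 * (ennreal a + ennreal b + ennreal c + ennreal d)"
proof -
  have "ennreal (4 * (a + b + c + d)) = ennreal 4 * ennreal (a + b + c + d)"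
    using assms by (intro ennreal_mult) auto
  then show ?thesis using assms by simp
qed

text \<open>The points \<open>y i\<close> play the role of the true innovations and \<open>z i\<close> that of the residuals. The coupling is
first constructed between \<open>F\<close> and the uniform law on the indices, and the indices are then mapped to
the points \<open>z i\<close>; the points \<open>y i\<close> only enter through the cost, which makes it unnecessary to glue two
couplings. The cells are the fibres of the simple function \<open>\<pi>\<close>, whose values serve as centres; the
chain from \<open>x\<close> over \<open>\<pi> x\<close>, \<open>\<pi> (y i)\<close> and \<open>y i\<close> to \<open>z i\<close> has four steps, and the second one is zero unless the
cells differ.\<close>

lemma coupling_with_perturbed_empirical:
  fixes F :: "'a::{real_normed_vector,second_countable_topology} measure" and \<pi> :: "'a \<Rightarrow> 'a"
  assumes F: "prob_space F" "sets F = sets borel" and n: "1 \<le> n"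
    and \<pi>: "simple_function borel \<pi>"
    and D: "\<And>u w. u \<in> range \<pi> \<Longrightarrow> w \<in> range \<pi> \<Longrightarrow> norm (u - w) \<le> D"
    and A: "(\<integral>\<^sup>+x. ennreal ((norm (x - \<pi> x))\<^sup>2) \<partial>F) \<le> ennreal A" "0 \<le> A"
  obtains Q where "Q \<in> couplings F (distr (uniform_count_measure {1..n}) borel z)"
    "(\<integral>\<^sup>+w. ennreal ((norm (fst w - snd w))\<^sup>2) \<partial>Q) \<le> ennreal (4 * (A
      + (\<Sum>i=1..n. (norm (y i - \<pi> (y i)))\<^sup>2) / real n
      + D\<^sup>2 * (\<Sum>v\<in>range \<pi>. \<bar>measure F {x. \<pi> x = v} - real (card {i\<in>{1..n}. \<pi> (y i) = v}) / real n\<bar>)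
      + (\<Sum>i=1..n. (norm (y i - z i))\<^sup>2) / real n))"
proof -
  interpret F: prob_space F by fact
  let ?U = "uniform_count_measure {1..n}"
  have ne: "{1..n} \<noteq> {}" "finite {1..n}" using n by auto
  interpret U: prob_space ?U using ne by (intro prob_space_uniform_count_measure) auto
  have spF: "space F = UNIV" using sets_eq_imp_space_eq[OF F(2)] by simp
  have fV: "finite (range \<pi>)" using simple_functionD(1)[OF \<pi>] by simp
  have \<pi>F: "\<pi> \<in> F \<rightarrow>\<^sub>M count_space (range \<pi>)"
  proof -
    have "\<pi> \<in> F \<rightarrow>\<^sub>M count_space UNIV"
      using measurable_simple_function[OF \<pi>] by (subst measurable_cong_sets[OF F(2) refl])
    then show ?thesis using fV by (intro measurable_count_space_eq2[THEN iffD2]) (auto simp: measurable_count_space_eq2_countable intro: measurable_sets)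
  qed
  have \<pi>B: "\<pi> \<in> borel_measurable borel" using \<pi> by (rule borel_measurable_simple_function)
  have \<pi>U: "(\<lambda>i. \<pi> (y i)) \<in> ?U \<rightarrow>\<^sub>M count_space (range \<pi>)"
    by (simp add: measurable_def space_uniform_count_measure sets_uniform_count_measure)
  obtain Q where Q: "prob_space Q" and sQ: "sets Q = sets (F \<Otimes>\<^sub>M ?U)"
    and Q1: "distr Q F fst = F" and Q2: "distr Q ?U snd = ?U"
    and Qoff: "emeasure Q {z\<in>space Q. \<pi> (fst z) \<noteq> \<pi> (y (snd z))} \<le>
      ennreal (\<Sum>v\<in>range \<pi>. \<bar>measure F {x\<in>space F. \<pi> x = v} - measure ?U {i\<in>space ?U. \<pi> (y i) = v}\<bar>)"
    by (rule finite_class_coupling[OF F(1) U.prob_space_axioms fV \<pi>F \<pi>U])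
  interpret Q: prob_space Q by fact
  \<comment> \<open>Twice the total variation distance between the two laws on the cells.\<close>
  define TV where "TV = (\<Sum>v\<in>range \<pi>. \<bar>measure F {x. \<pi> x = v} - real (card {i\<in>{1..n}. \<pi> (y i) = v}) / real n\<bar>)"
  have mU: "measure ?U {i\<in>space ?U. \<pi> (y i) = v} = real (card {i\<in>{1..n}. \<pi> (y i) = v}) / real n" for v
    by (subst measure_uniform_count_measure) (auto simp: space_uniform_count_measure)
  have off: "emeasure Q {z\<in>space Q. \<pi> (fst z) \<noteq> \<pi> (y (snd z))} \<le> ennreal TV"
    using Qoff unfolding TV_def mU spF by simp
  have mUf: "f \<in> ?U \<rightarrow>\<^sub>M borel" for f :: "nat \<Rightarrow> 'b::topological_space"
    by (simp add: measurable_def space_uniform_count_measure sets_uniform_count_measure)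
  have mfst [measurable]: "fst \<in> Q \<rightarrow>\<^sub>M borel" and mQsnd [measurable]: "snd \<in> Q \<rightarrow>\<^sub>M ?U"
    using measurable_fst[of F ?U] measurable_snd[of F ?U]
    by (simp_all cong: measurable_cong_sets add: sQ F(2))
  have msnd [measurable]: "(\<lambda>w. f (snd w)) \<in> Q \<rightarrow>\<^sub>M borel" for f :: "nat \<Rightarrow> 'b::topological_space"
    by (rule measurable_compose[OF _ mUf]) measurable
  note [measurable] = \<pi>B
  have int1: "(\<integral>\<^sup>+w. f (fst w) \<partial>Q) = (\<integral>\<^sup>+x. f x \<partial>F)" if [measurable]: "f \<in> borel_measurable borel" for f
  proof -
    have "f \<in> borel_measurable F" using that by (simp cong: measurable_cong_sets add: F(2))
    moreover have "fst \<in> Q \<rightarrow>\<^sub>M F" using measurable_fst[of F ?U] by (simp cong: measurable_cong_sets add: sQ)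
    ultimately have "(\<integral>\<^sup>+x. f x \<partial>distr Q F fst) = (\<integral>\<^sup>+w. f (fst w) \<partial>Q)"
      by (intro nn_integral_distr) auto
    then show ?thesis by (simp add: Q1)
  qed
  have int2: "(\<integral>\<^sup>+w. ennreal (f (snd w)) \<partial>Q) = ennreal ((\<Sum>i=1..n. f i) / real n)" if f0: "\<And>i. 0 \<le> f i" for f
  proof -
    have "(\<integral>\<^sup>+w. ennreal (f (snd w)) \<partial>Q) = (\<integral>\<^sup>+i. ennreal (f i) \<partial>distr Q ?U snd)"
      by (subst nn_integral_distr[OF mQsnd]) (simp_all add: mUf)
    also have "\<dots> = (\<integral>\<^sup>+i. ennreal (f i) \<partial>?U)" by (simp only: Q2)
    also have "\<dots> = (\<Sum>i\<in>{1..n}. ennreal (1 / real n) * ennreal (f i))"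
      unfolding uniform_count_measure_def by (subst nn_integral_point_measure_finite) auto
    also have "\<dots> = (\<Sum>i\<in>{1..n}. ennreal (1 / real n * f i))"
      using f0 by (intro sum.cong) (auto simp: ennreal_mult[symmetric])
    also have "\<dots> = ennreal (\<Sum>i\<in>{1..n}. 1 / real n * f i)" using f0 by (intro sum_ennreal) auto
    also have "(\<Sum>i\<in>{1..n}. 1 / real n * f i) = (\<Sum>i=1..n. f i) / real n"
      by (simp add: sum_divide_distrib)
    finally show ?thesis .
  qed
  define P where "P = distr Q (borel \<Otimes>\<^sub>M borel) (\<lambda>w. (fst w, z (snd w)))"
  have mP [measurable]: "(\<lambda>w. (fst w, z (snd w))) \<in> Q \<rightarrow>\<^sub>M borel \<Otimes>\<^sub>M borel" by measurable
  have "P \<in> couplings F (distr ?U borel z)"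
    unfolding couplings_def
  proof (intro CollectI conjI)
    show "prob_space P" unfolding P_def by (rule Q.prob_space_distr) measurable
    show "sets P = sets (borel \<Otimes>\<^sub>M borel)" by (simp add: P_def)
    have "distr P borel fst = distr Q borel fst" unfolding P_def by (subst distr_distr) (auto simp: o_def)
    also have "\<dots> = distr Q F fst" by (rule distr_cong) (auto simp: F(2))
    finally show "distr P borel fst = F" by (simp add: Q1)
    have "distr P borel snd = distr Q borel (\<lambda>w. z (snd w))" unfolding P_def by (subst distr_distr) (auto simp: o_def)
    also have "\<dots> = distr (distr Q ?U snd) borel z" by (subst distr_distr[OF mUf mQsnd]) (simp add: o_def)
    finally show "distr P borel snd = distr ?U borel z" by (simp only: Q2)
  qed
  moreover have "(\<integral>\<^sup>+w. ennreal ((norm (fst w - snd w))\<^sup>2) \<partial>P) \<le> ennreal (4 * (A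
      + (\<Sum>i=1..n. (norm (y i - \<pi> (y i)))\<^sup>2) / real n + D\<^sup>2 * TV
      + (\<Sum>i=1..n. (norm (y i - z i))\<^sup>2) / real n))"
  proof -
    let ?I = "{w\<in>space Q. \<pi> (fst w) \<noteq> \<pi> (y (snd w))}"
    have I [measurable]: "?I \<in> sets Q" by measurable
    have four: "(norm (a + b + c + d))\<^sup>2 \<le> 4 * ((norm a)\<^sup>2 + (norm b)\<^sup>2 + (norm c)\<^sup>2 + (norm d)\<^sup>2)" for a b c d :: 'a
    proof -
      have 1: "norm (a + b + c + d) \<le> norm a + norm b + norm c + norm d"
        by (meson norm_triangle_le add_right_mono norm_triangle_ineq order_trans)
      have "(norm (a + b + c + d))\<^sup>2 \<le> (norm a + norm b + norm c + norm d)\<^sup>2" by (intro power_mono 1) simp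
      also have "\<dots> \<le> 4 * ((norm a)\<^sup>2 + (norm b)\<^sup>2 + (norm c)\<^sup>2 + (norm d)\<^sup>2)"
      proof -
        have "0 \<le> (norm a - norm b)\<^sup>2 + (norm a - norm c)\<^sup>2 + (norm a - norm d)\<^sup>2
          + (norm b - norm c)\<^sup>2 + (norm b - norm d)\<^sup>2 + (norm c - norm d)\<^sup>2" by simp
        then show ?thesis by (simp add: power2_eq_square algebra_simps)
      qed
      finally show ?thesis .
    qed
    have pt: "ennreal ((norm (fst w - z (snd w)))\<^sup>2) \<le> 4 * (ennreal ((norm (fst w - \<pi> (fst w)))\<^sup>2)
        + ennreal ((norm (y (snd w) - \<pi> (y (snd w))))\<^sup>2) + ennreal (D\<^sup>2) * indicator ?I w
        + ennreal ((norm (y (snd w) - z (snd w)))\<^sup>2))" if "w \<in> space Q" for w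
    proof -
      let ?a = "fst w - \<pi> (fst w)" and ?b = "\<pi> (fst w) - \<pi> (y (snd w))"
        and ?c = "\<pi> (y (snd w)) - y (snd w)" and ?d = "y (snd w) - z (snd w)"
      have "fst w - z (snd w) = ?a + ?b + ?c + ?d" by simp
      then have "(norm (fst w - z (snd w)))\<^sup>2 \<le> 4 * ((norm ?a)\<^sup>2 + (norm ?b)\<^sup>2 + (norm ?c)\<^sup>2 + (norm ?d)\<^sup>2)"
        using four by metis
      moreover have "(norm ?b)\<^sup>2 \<le> D\<^sup>2 * indicator ?I w"
        using D[of "\<pi> (fst w)" "\<pi> (y (snd w))"] that by (auto simp: indicator_def intro!: power_mono)
      ultimately have "(norm (fst w - z (snd w)))\<^sup>2
          \<le> 4 * ((norm ?a)\<^sup>2 + (norm ?c)\<^sup>2 + D\<^sup>2 * indicator ?I w + (norm ?d)\<^sup>2)" by simp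
      then have "ennreal ((norm (fst w - z (snd w)))\<^sup>2)
          \<le> ennreal (4 * ((norm ?a)\<^sup>2 + (norm ?c)\<^sup>2 + D\<^sup>2 * indicator ?I w + (norm ?d)\<^sup>2))"
        by (rule ennreal_leI)
      also have "\<dots> = 4 * (ennreal ((norm ?a)\<^sup>2) + ennreal ((norm ?c)\<^sup>2) + ennreal (D\<^sup>2) * indicator ?I w
          + ennreal ((norm ?d)\<^sup>2))"
        by (subst ennreal_four) (auto simp: indicator_def)
      finally show ?thesis by (simp add: norm_minus_commute)
    qed
    have "(\<integral>\<^sup>+w. ennreal ((norm (fst w - snd w))\<^sup>2) \<partial>P) = (\<integral>\<^sup>+w. ennreal ((norm (fst w - z (snd w)))\<^sup>2) \<partial>Q)"
      unfolding P_def by (subst nn_integral_distr) auto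
    also have "\<dots> \<le> (\<integral>\<^sup>+w. 4 * (ennreal ((norm (fst w - \<pi> (fst w)))\<^sup>2)
        + ennreal ((norm (y (snd w) - \<pi> (y (snd w))))\<^sup>2) + ennreal (D\<^sup>2) * indicator ?I w
        + ennreal ((norm (y (snd w) - z (snd w)))\<^sup>2)) \<partial>Q)"
      by (intro nn_integral_mono pt)
    also have "\<dots> = 4 * ((\<integral>\<^sup>+w. ennreal ((norm (fst w - \<pi> (fst w)))\<^sup>2) \<partial>Q)
        + (\<integral>\<^sup>+w. ennreal ((norm (y (snd w) - \<pi> (y (snd w))))\<^sup>2) \<partial>Q) + ennreal (D\<^sup>2) * emeasure Q ?I
        + (\<integral>\<^sup>+w. ennreal ((norm (y (snd w) - z (snd w)))\<^sup>2) \<partial>Q))"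
      by (simp add: nn_integral_cmult nn_integral_add nn_integral_cmult_indicator)
    also have "\<dots> \<le> 4 * (ennreal A + ennreal ((\<Sum>i=1..n. (norm (y i - \<pi> (y i)))\<^sup>2) / real n)
        + ennreal (D\<^sup>2) * ennreal TV + ennreal ((\<Sum>i=1..n. (norm (y i - z i))\<^sup>2) / real n))"
    proof (intro mult_left_mono add_mono off)
      show "(\<integral>\<^sup>+w. ennreal ((norm (fst w - \<pi> (fst w)))\<^sup>2) \<partial>Q) \<le> ennreal A"
        using int1[of "\<lambda>x. ennreal ((norm (x - \<pi> x))\<^sup>2)"] A(1) by simp
    qed (auto simp: int2[of "\<lambda>i. (norm (y i - \<pi> (y i)))\<^sup>2"] int2[of "\<lambda>i. (norm (y i - z i))\<^sup>2"])
    also have "\<dots> = ennreal (4 * (A + (\<Sum>i=1..n. (norm (y i - \<pi> (y i)))\<^sup>2) / real n + D\<^sup>2 * TV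
      + (\<Sum>i=1..n. (norm (y i - z i))\<^sup>2) / real n))"
      using A(2) by (subst ennreal_four) (auto simp: ennreal_mult TV_def sum_nonneg)
    finally show ?thesis .
  qed
  ultimately show thesis unfolding TV_def by (rule that)
qed

section \<open>Events of probability tending to one\<close>

text \<open>Outer measure accommodates events that involve the empirical eigenvectors, which need not be
measurable functions of the data.\<close>

definition with_high_prob :: "'w measure \<Rightarrow> (nat \<Rightarrow> 'w \<Rightarrow> bool) \<Rightarrow> bool"
  where "with_high_prob M P \<longleftrightarrow> (\<lambda>n. outer_measure_of M {\<omega>\<in>space M. \<not> P n \<omega>}) \<longlonglongrightarrow> 0"

lemma outer_measure_of_Un_le:
  assumes "A \<subseteq> space M" "B \<subseteq> space M"
  shows "outer_measure_of M (A \<union> B) \<le> outer_measure_of M A + outer_measure_of M B"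
proof -
  obtain E where E: "E \<in> sets M" "A \<subseteq> E" "outer_measure_of M A = emeasure M E"
    using outer_measure_of_attain[OF assms(1)] by blast
  obtain E' where E': "E' \<in> sets M" "B \<subseteq> E'" "outer_measure_of M B = emeasure M E'"
    using outer_measure_of_attain[OF assms(2)] by blast
  have "outer_measure_of M (A \<union> B) \<le> outer_measure_of M (E \<union> E')"
    using E E' by (intro outer_measure_of_mono) auto
  also have "\<dots> = emeasure M (E \<union> E')" using E E' by (intro outer_measure_of_eq) auto
  also have "\<dots> \<le> emeasure M E + emeasure M E'" using E E' by (intro emeasure_subadditive) auto
  finally show ?thesis by (simp add: E E')
qed

lemma with_high_prob_mono:
  assumes P: "with_high_prob M P"
    and imp: "\<forall>\<^sub>F n in sequentially. \<forall>\<omega>\<in>space M. P n \<omega> \<longrightarrow> Q n \<omega>"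
  shows "with_high_prob M Q"
  unfolding with_high_prob_def
proof (rule tendsto_sandwich[OF _ _ tendsto_const P[unfolded with_high_prob_def]])
  show "\<forall>\<^sub>F n in sequentially. outer_measure_of M {\<omega>\<in>space M. \<not> Q n \<omega>}
      \<le> outer_measure_of M {\<omega>\<in>space M. \<not> P n \<omega>}"
    using imp by eventually_elim (auto intro!: outer_measure_of_mono)
qed simp

lemma with_high_prob_conj:
  assumes P: "with_high_prob M P" and Q: "with_high_prob M Q"
  shows "with_high_prob M (\<lambda>n \<omega>. P n \<omega> \<and> Q n \<omega>)"
  unfolding with_high_prob_def
proof (rule tendsto_sandwich[OF _ _ tendsto_const])
  show "(\<lambda>n. outer_measure_of M {\<omega>\<in>space M. \<not> P n \<omega>} + outer_measure_of M {\<omega>\<in>space M. \<not> Q n \<omega>}) \<longlonglongrightarrow> 0"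
    using tendsto_add[OF P[unfolded with_high_prob_def] Q[unfolded with_high_prob_def]] by simp
  have "{\<omega>\<in>space M. \<not> (P n \<omega> \<and> Q n \<omega>)} = {\<omega>\<in>space M. \<not> P n \<omega>} \<union> {\<omega>\<in>space M. \<not> Q n \<omega>}" for n
    by auto
  then show "\<forall>\<^sub>F n in sequentially. outer_measure_of M {\<omega>\<in>space M. \<not> (P n \<omega> \<and> Q n \<omega>)}
      \<le> outer_measure_of M {\<omega>\<in>space M. \<not> P n \<omega>} + outer_measure_of M {\<omega>\<in>space M. \<not> Q n \<omega>}"
    by (auto intro!: always_eventually outer_measure_of_Un_le)
qed simp

lemma with_high_prob_AE:
  assumes "AE \<omega> in M. P \<omega>"
  shows "with_high_prob M (\<lambda>n. P)"
proof -
  obtain N where N: "{\<omega>\<in>space M. \<not> P \<omega>} \<subseteq> N" "N \<in> null_sets M" using assms by (auto simp: eventually_ae_filter)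
  then have "outer_measure_of M {\<omega>\<in>space M. \<not> P \<omega>} \<le> emeasure M N"
    by (metis outer_measure_of_mono outer_measure_of_eq null_setsD2)
  then have "outer_measure_of M {\<omega>\<in>space M. \<not> P \<omega>} = 0" using N(2) by (simp add: null_setsD1)
  then show ?thesis by (simp add: with_high_prob_def)
qed

lemma with_high_prob_ball:
  assumes "finite V" "\<And>v. v \<in> V \<Longrightarrow> with_high_prob M (P v)"
  shows "with_high_prob M (\<lambda>n \<omega>. \<forall>v\<in>V. P v n \<omega>)"
  using assms
proof (induction V rule: finite_induct)
  case empty
  show ?case by (simp add: with_high_prob_def outer_measure_of_eq[of "{}"])
next
  case (insert v V)
  then show ?case using with_high_prob_conj[of M "P v" "\<lambda>n \<omega>. \<forall>v\<in>V. P v n \<omega>"] by simp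
qed

lemma with_high_prob_markov:
  assumes f: "\<And>n. f n \<in> borel_measurable M" and c: "c \<longlonglongrightarrow> 0" and \<delta>: "0 < \<delta>"
    and le: "\<forall>\<^sub>F n in sequentially. (\<integral>\<^sup>+\<omega>. f n \<omega> \<partial>M) \<le> ennreal (c n)"
  shows "with_high_prob M (\<lambda>n \<omega>. f n \<omega> \<le> ennreal \<delta>)"
  unfolding with_high_prob_def
proof (rule tendsto_sandwich[OF _ _ tendsto_const])
  have "(\<lambda>n. ennreal (1 / \<delta>) * ennreal (c n)) \<longlonglongrightarrow> ennreal (1 / \<delta>) * ennreal 0"
    using c by (intro ennreal_tendsto_cmult tendsto_ennrealI) auto
  then show "(\<lambda>n. ennreal (1 / \<delta>) * ennreal (c n)) \<longlonglongrightarrow> 0" by simp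
  show "\<forall>\<^sub>F n in sequentially. outer_measure_of M {\<omega>\<in>space M. \<not> f n \<omega> \<le> ennreal \<delta>}
      \<le> ennreal (1 / \<delta>) * ennreal (c n)"
    using le
  proof eventually_elim
    case (elim n)
    note [measurable] = f[of n]
    have "{\<omega>\<in>space M. \<not> f n \<omega> \<le> ennreal \<delta>} \<subseteq> {\<omega>\<in>space M. 1 \<le> ennreal (1 / \<delta>) * f n \<omega>}"
    proof (safe)
      fix \<omega> assume "\<not> f n \<omega> \<le> ennreal \<delta>"
      then have "ennreal (1 / \<delta>) * ennreal \<delta> \<le> ennreal (1 / \<delta>) * f n \<omega>" by (intro mult_left_mono) auto
      then show "1 \<le> ennreal (1 / \<delta>) * f n \<omega>" using \<delta> by (simp add: ennreal_mult[symmetric])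
    qed
    then have "outer_measure_of M {\<omega>\<in>space M. \<not> f n \<omega> \<le> ennreal \<delta>}
        \<le> outer_measure_of M {\<omega>\<in>space M. 1 \<le> ennreal (1 / \<delta>) * f n \<omega>}" by (rule outer_measure_of_mono)
    also have "\<dots> = emeasure M {\<omega>\<in>space M. 1 \<le> ennreal (1 / \<delta>) * f n \<omega>}" by (intro outer_measure_of_eq) measurable
    also have "\<dots> \<le> ennreal (1 / \<delta>) * (\<integral>\<^sup>+\<omega>. f n \<omega> * indicator (space M) \<omega> \<partial>M)"
      by (intro nn_integral_Markov_inequality) auto
    also have "(\<integral>\<^sup>+\<omega>. f n \<omega> * indicator (space M) \<omega> \<partial>M) = (\<integral>\<^sup>+\<omega>. f n \<omega> \<partial>M)"
      by (intro nn_integral_cong) auto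
    also have "ennreal (1 / \<delta>) * \<dots> \<le> ennreal (1 / \<delta>) * ennreal (c n)" using elim by (intro mult_left_mono) auto
    finally show ?case .
  qed
qed simp

section \<open>Second moments of sums and contractive recursions\<close>

context prob_space
begin

lemma nn_integral_norm_shifted:
  fixes V :: "'a \<Rightarrow> 'b::{real_inner,banach,second_countable_topology}"
  assumes V: "integrable M V" "integrable M (\<lambda>\<omega>. (norm (V \<omega>))\<^sup>2)"
  shows "(\<integral>\<^sup>+\<omega>. ennreal ((norm (a + c *\<^sub>R V \<omega>))\<^sup>2) \<partial>M)
    = ennreal ((norm a)\<^sup>2 + 2 * c * (a \<bullet> expectation V) + c\<^sup>2 * expectation (\<lambda>\<omega>. (norm (V \<omega>))\<^sup>2))"
proof -
  have eq: "(norm (a + c *\<^sub>R v))\<^sup>2 = (norm a)\<^sup>2 + 2 * c * (a \<bullet> v) + c\<^sup>2 * (norm v)\<^sup>2" for v :: 'b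
    unfolding power2_norm_eq_inner
    by (simp add: inner_add_left inner_add_right inner_commute power2_eq_square algebra_simps)
  have int: "integrable M (\<lambda>\<omega>. (norm (a + c *\<^sub>R V \<omega>))\<^sup>2)" unfolding eq using V by auto
  have "(\<integral>\<^sup>+\<omega>. ennreal ((norm (a + c *\<^sub>R V \<omega>))\<^sup>2) \<partial>M) = ennreal (expectation (\<lambda>\<omega>. (norm (a + c *\<^sub>R V \<omega>))\<^sup>2))"
    using int by (intro nn_integral_eq_integral) auto
  also have "expectation (\<lambda>\<omega>. (norm (a + c *\<^sub>R V \<omega>))\<^sup>2)
      = (norm a)\<^sup>2 + 2 * c * (a \<bullet> expectation V) + c\<^sup>2 * expectation (\<lambda>\<omega>. (norm (V \<omega>))\<^sup>2)"
    unfolding eq using V by (simp add: prob_space)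
  finally show ?thesis .
qed

lemma second_moment_centered_le:
  fixes V :: "'a \<Rightarrow> 'b::{real_inner,banach,second_countable_topology}"
  assumes V: "integrable M V" "integrable M (\<lambda>\<omega>. (norm (V \<omega>))\<^sup>2)"
  shows "(\<integral>\<^sup>+\<omega>. ennreal ((norm (V \<omega> - expectation V))\<^sup>2) \<partial>M) \<le> (\<integral>\<^sup>+\<omega>. ennreal ((norm (V \<omega>))\<^sup>2) \<partial>M)"
proof -
  have "(\<integral>\<^sup>+\<omega>. ennreal ((norm (V \<omega> - expectation V))\<^sup>2) \<partial>M)
      = ennreal ((norm (- expectation V))\<^sup>2 + 2 * 1 * (- expectation V \<bullet> expectation V)
        + 1\<^sup>2 * expectation (\<lambda>\<omega>. (norm (V \<omega>))\<^sup>2))"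
    by (subst nn_integral_norm_shifted[OF V, symmetric]) simp
  also have "\<dots> \<le> ennreal (expectation (\<lambda>\<omega>. (norm (V \<omega>))\<^sup>2))"
    by (intro ennreal_leI) (simp add: power2_norm_eq_inner)
  also have "\<dots> = (\<integral>\<^sup>+\<omega>. ennreal ((norm (V \<omega>))\<^sup>2) \<partial>M)"
    using V by (intro nn_integral_eq_integral[symmetric]) auto
  finally show ?thesis .
qed

text \<open>An increment \<open>c V\<close>, with \<open>V\<close> centred and independent of the past and \<open>c\<close> known from the past, is
orthogonal to the past. Integrating over \<open>V\<close> first gives an identity in the extended nonnegative reals,
so that inductions over sums of such increments carry no integrability conditions on the partial sums.\<close>

lemma second_moment_independent_step:
  fixes V :: "'a \<Rightarrow> 'b::{real_inner,banach,second_countable_topology}"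
  assumes ind: "indep_var N U N' U'" and v [measurable]: "v \<in> borel_measurable N'" and V_def: "V = (\<lambda>\<omega>. v (U' \<omega>))"
    and u [measurable]: "u \<in> borel_measurable N" and c [measurable]: "c \<in> borel_measurable N"
    and V: "integrable M V" "expectation V = 0" "integrable M (\<lambda>\<omega>. (norm (V \<omega>))\<^sup>2)"
  shows "(\<integral>\<^sup>+\<omega>. ennreal ((norm (u (U \<omega>) + c (U \<omega>) *\<^sub>R V \<omega>))\<^sup>2) \<partial>M)
    = (\<integral>\<^sup>+\<omega>. ennreal ((norm (u (U \<omega>)))\<^sup>2) \<partial>M)
      + (\<integral>\<^sup>+\<omega>. ennreal ((c (U \<omega>))\<^sup>2) \<partial>M) * (\<integral>\<^sup>+\<omega>. ennreal ((norm (V \<omega>))\<^sup>2) \<partial>M)"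
proof -
  have U [measurable]: "U \<in> M \<rightarrow>\<^sub>M N" and Vm [measurable]: "U' \<in> M \<rightarrow>\<^sub>M N'"
    and eq: "distr M N U \<Otimes>\<^sub>M distr M N' U' = distr M (N \<Otimes>\<^sub>M N') (\<lambda>\<omega>. (U \<omega>, U' \<omega>))"
    using ind by (auto simp: indep_var_distribution_eq)
  interpret DV: prob_space "distr M N' U'" by (rule prob_space_distr) measurable
  let ?f = "\<lambda>z. ennreal ((norm (u (fst z) + c (fst z) *\<^sub>R v (snd z)))\<^sup>2)"
  have f [measurable]: "?f \<in> borel_measurable (N \<Otimes>\<^sub>M N')" by measurable
  have f': "?f \<in> borel_measurable (distr M N U \<Otimes>\<^sub>M distr M N' U')"
    using f by (simp cong: measurable_cong_sets)
  have "(\<integral>\<^sup>+\<omega>. ennreal ((norm (u (U \<omega>) + c (U \<omega>) *\<^sub>R V \<omega>))\<^sup>2) \<partial>M)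
      = (\<integral>\<^sup>+z. ?f z \<partial>distr M (N \<Otimes>\<^sub>M N') (\<lambda>\<omega>. (U \<omega>, U' \<omega>)))"
    unfolding V_def by (subst nn_integral_distr) auto
  also have "\<dots> = (\<integral>\<^sup>+x. \<integral>\<^sup>+v. ?f (x, v) \<partial>distr M N' U' \<partial>distr M N U)"
    unfolding eq[symmetric] by (rule DV.nn_integral_fst[OF f', symmetric])
  also have "\<dots> = (\<integral>\<^sup>+x. \<integral>\<^sup>+\<omega>. ennreal ((norm (u x + c x *\<^sub>R V \<omega>))\<^sup>2) \<partial>M \<partial>distr M N U)"
    unfolding V_def by (intro nn_integral_cong) (subst nn_integral_distr, auto)
  also have "\<dots> = (\<integral>\<^sup>+x. ennreal ((norm (u x))\<^sup>2) + ennreal ((c x)\<^sup>2) * (\<integral>\<^sup>+\<omega>. ennreal ((norm (V \<omega>))\<^sup>2) \<partial>M) \<partial>distr M N U)"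
    using V by (intro nn_integral_cong) (simp add: nn_integral_norm_shifted nn_integral_eq_integral ennreal_mult)
  also have "\<dots> = (\<integral>\<^sup>+x. ennreal ((norm (u x))\<^sup>2) \<partial>distr M N U)
      + (\<integral>\<^sup>+x. ennreal ((c x)\<^sup>2) \<partial>distr M N U) * (\<integral>\<^sup>+\<omega>. ennreal ((norm (V \<omega>))\<^sup>2) \<partial>M)"
    by (subst nn_integral_add) (auto simp: nn_integral_multc)
  also have "\<dots> = (\<integral>\<^sup>+\<omega>. ennreal ((norm (u (U \<omega>)))\<^sup>2) \<partial>M)
      + (\<integral>\<^sup>+\<omega>. ennreal ((c (U \<omega>))\<^sup>2) \<partial>M) * (\<integral>\<^sup>+\<omega>. ennreal ((norm (V \<omega>))\<^sup>2) \<partial>M)"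
    by (simp add: nn_integral_distr)
  finally show ?thesis .
qed

lemma second_moment_indep_sum:
  fixes Y :: "'i \<Rightarrow> 'a \<Rightarrow> 'b::{real_inner,banach,second_countable_topology}"
  assumes ind: "indep_vars (\<lambda>_. borel) Y I" and J: "finite J" "J \<subseteq> I"
    and Y: "\<And>i. i \<in> J \<Longrightarrow> integrable M (Y i)" "\<And>i. i \<in> J \<Longrightarrow> expectation (Y i) = 0"
      "\<And>i. i \<in> J \<Longrightarrow> integrable M (\<lambda>\<omega>. (norm (Y i \<omega>))\<^sup>2)"
  shows "(\<integral>\<^sup>+\<omega>. ennreal ((norm (\<Sum>i\<in>J. Y i \<omega>))\<^sup>2) \<partial>M) = (\<Sum>i\<in>J. \<integral>\<^sup>+\<omega>. ennreal ((norm (Y i \<omega>))\<^sup>2) \<partial>M)"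
  using J Y
proof (induction J rule: finite_induct)
  case (insert i J)
  have ind': "indep_var (PiM J (\<lambda>_. borel)) (\<lambda>\<omega>. restrict (\<lambda>i. Y i \<omega>) J)
      (PiM {i} (\<lambda>_. borel)) (\<lambda>\<omega>. restrict (\<lambda>i. Y i \<omega>) {i})"
    using insert.hyps insert.prems(1) by (intro indep_var_restrict[OF ind]) auto
  have "(\<lambda>f. \<Sum>j\<in>J. f j) \<in> borel_measurable (PiM J (\<lambda>_. borel :: 'b measure))"
    by measurable
  then have "(\<integral>\<^sup>+\<omega>. ennreal ((norm ((\<Sum>j\<in>J. restrict (\<lambda>i. Y i \<omega>) J j) + 1 *\<^sub>R Y i \<omega>))\<^sup>2) \<partial>M)
    = (\<integral>\<^sup>+\<omega>. ennreal ((norm (\<Sum>j\<in>J. restrict (\<lambda>i. Y i \<omega>) J j))\<^sup>2) \<partial>M)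
      + (\<integral>\<^sup>+\<omega>. ennreal (1\<^sup>2) \<partial>M) * (\<integral>\<^sup>+\<omega>. ennreal ((norm (Y i \<omega>))\<^sup>2) \<partial>M)"
    using insert.prems
    by (intro second_moment_independent_step[OF ind', where c="\<lambda>_. 1" and u="\<lambda>f. \<Sum>j\<in>J. f j" and v="\<lambda>f. f i"])
       (auto intro: measurable_component_singleton)
  then show ?case using insert by (simp add: emeasure_space_1 add.commute)
qed simp

end

text \<open>Convexity of the square, applied to \<open>\<rho> a + (1 - \<rho>) (w / (1 - \<rho>))\<close>.\<close>

lemma contraction_square_le:
  fixes \<rho> :: real
  assumes "0 \<le> \<rho>" "\<rho> < 1"
  shows "(\<rho> * a + w)\<^sup>2 \<le> \<rho> * a\<^sup>2 + w\<^sup>2 / (1 - \<rho>)"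
proof -
  have "\<rho> * a\<^sup>2 + w\<^sup>2 / (1 - \<rho>) - (\<rho> * a + w)\<^sup>2 = \<rho> / (1 - \<rho>) * ((1 - \<rho>) * a - w)\<^sup>2"
    using assms by (simp add: power2_eq_square divide_simps) (simp add: algebra_simps)
  moreover have "0 \<le> \<rho> / (1 - \<rho>) * ((1 - \<rho>) * a - w)\<^sup>2" using assms by simp
  ultimately show ?thesis by linarith
qed

text \<open>The bound is the fixed point of the recursion \<open>s = \<rho> s + u / (1 - \<rho>)\<close> for second moments.
It is used for the moving averages, for the partial sums of the process, and for the difference between
the partial sums of the process and of its bootstrap version.\<close>

lemma contraction_second_moment:
  fixes D :: "nat \<Rightarrow> 'w \<Rightarrow> 'b::{real_normed_vector,second_countable_topology}" and W :: "nat \<Rightarrow> 'w \<Rightarrow> real"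
  assumes D: "\<And>m. m \<le> n \<Longrightarrow> D m \<in> borel_measurable N" and W: "\<And>m. m < n \<Longrightarrow> W m \<in> borel_measurable N"
    and \<rho>: "0 \<le> \<rho>" "\<rho> < 1" and u: "0 \<le> u"
    and D0: "\<And>\<omega>. \<omega> \<in> space N \<Longrightarrow> D 0 \<omega> = 0"
    and step: "\<And>m \<omega>. m < n \<Longrightarrow> \<omega> \<in> space N \<Longrightarrow> norm (D (Suc m) \<omega>) \<le> \<rho> * norm (D m \<omega>) + W m \<omega>"
    and le: "\<And>m. m < n \<Longrightarrow> (\<integral>\<^sup>+\<omega>. ennreal ((W m \<omega>)\<^sup>2) \<partial>N) \<le> ennreal u"
    and "m \<le> n"
  shows "(\<integral>\<^sup>+\<omega>. ennreal ((norm (D m \<omega>))\<^sup>2) \<partial>N) \<le> ennreal (u / (1 - \<rho>)\<^sup>2)"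
  using \<open>m \<le> n\<close>
proof (induction m)
  case 0
  have "(\<integral>\<^sup>+\<omega>. ennreal ((norm (D 0 \<omega>))\<^sup>2) \<partial>N) = (\<integral>\<^sup>+\<omega>. 0 \<partial>N)"
    by (intro nn_integral_cong) (simp add: D0)
  then show ?case by simp
next
  case (Suc m)
  have [measurable]: "D m \<in> borel_measurable N" "W m \<in> borel_measurable N" using D W Suc.prems by auto
  have "(\<integral>\<^sup>+\<omega>. ennreal ((norm (D (Suc m) \<omega>))\<^sup>2) \<partial>N)
      \<le> (\<integral>\<^sup>+\<omega>. ennreal \<rho> * ennreal ((norm (D m \<omega>))\<^sup>2) + ennreal (1 / (1 - \<rho>)) * ennreal ((W m \<omega>)\<^sup>2) \<partial>N)"
  proof (intro nn_integral_mono)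
    fix \<omega> assume \<omega>: "\<omega> \<in> space N"
    have "(norm (D (Suc m) \<omega>))\<^sup>2 \<le> (\<rho> * norm (D m \<omega>) + W m \<omega>)\<^sup>2"
      using step[OF _ \<omega>, of m] Suc.prems by (intro power_mono) auto
    also have "\<dots> \<le> \<rho> * (norm (D m \<omega>))\<^sup>2 + 1 / (1 - \<rho>) * (W m \<omega>)\<^sup>2"
      using contraction_square_le[OF \<rho>, of "norm (D m \<omega>)" "W m \<omega>"] by simp
    finally show "ennreal ((norm (D (Suc m) \<omega>))\<^sup>2)
        \<le> ennreal \<rho> * ennreal ((norm (D m \<omega>))\<^sup>2) + ennreal (1 / (1 - \<rho>)) * ennreal ((W m \<omega>)\<^sup>2)"
      using \<rho> by (simp add: ennreal_mult[symmetric] ennreal_plus[symmetric] ennreal_leI del: ennreal_plus)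
  qed
  also have "\<dots> = ennreal \<rho> * (\<integral>\<^sup>+\<omega>. ennreal ((norm (D m \<omega>))\<^sup>2) \<partial>N)
      + ennreal (1 / (1 - \<rho>)) * (\<integral>\<^sup>+\<omega>. ennreal ((W m \<omega>)\<^sup>2) \<partial>N)"
    by (subst nn_integral_add) (auto simp: nn_integral_cmult)
  also have "\<dots> \<le> ennreal \<rho> * ennreal (u / (1 - \<rho>)\<^sup>2) + ennreal (1 / (1 - \<rho>)) * ennreal u"
    using Suc le[of m] by (intro add_mono mult_left_mono) auto
  also have "\<dots> = ennreal (\<rho> * (u / (1 - \<rho>)\<^sup>2) + 1 / (1 - \<rho>) * u)"
    using \<rho> u by (simp add: ennreal_mult[symmetric] ennreal_plus[symmetric] del: ennreal_plus)
  also have "\<rho> * (u / (1 - \<rho>)\<^sup>2) + 1 / (1 - \<rho>) * u = u / (1 - \<rho>)\<^sup>2"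
    using \<rho> by (simp add: power2_eq_square divide_simps) (simp add: algebra_simps)
  finally show ?case .
qed

section \<open>Stationary autoregressive processes\<close>

fun moving_average :: "('a::real_normed_vector \<Rightarrow>\<^sub>L 'a) \<Rightarrow> nat \<Rightarrow> (int \<Rightarrow> 'a) \<Rightarrow> int \<Rightarrow> 'a" where
  "moving_average \<Psi> 0 z t = 0"
| "moving_average \<Psi> (Suc m) z t = \<Psi> (moving_average \<Psi> m z (t - 1)) + z t"

text \<open>The moving average of infinite order. Stated as a function of the path of innovations, it makes
\<open>X t\<close> visibly a function of the innovations up to time \<open>t\<close>.\<close>

definition causal_solution :: "('a::real_normed_vector \<Rightarrow>\<^sub>L 'a) \<Rightarrow> (int \<Rightarrow> 'a) \<Rightarrow> int \<Rightarrow> 'a" where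
  "causal_solution \<Psi> z t = lim (\<lambda>m. moving_average \<Psi> m z t)"

lemma moving_average_cong:
  "(\<And>s. s \<le> t \<Longrightarrow> z s = z' s) \<Longrightarrow> moving_average \<Psi> m z t = moving_average \<Psi> m z' t"
  by (induction m arbitrary: t) auto

lemma causal_solution_restrict:
  "t \<le> s \<Longrightarrow> causal_solution \<Psi> (restrict z {..s}) t = causal_solution \<Psi> z t"
  unfolding causal_solution_def
  by (intro arg_cong[where f=lim] ext moving_average_cong) auto

lemma measurable_blinfun_apply [measurable]:
  "blinfun_apply \<Psi> \<in> borel_measurable (borel :: 'a::{real_normed_vector,second_countable_topology} measure)"
  by (intro borel_measurable_continuous_onI linear_continuous_on blinfun.bounded_linear_right)

lemma measurable_moving_average:
  fixes \<Psi> :: "'a::{real_normed_vector,second_countable_topology} \<Rightarrow>\<^sub>L 'a"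
  shows "t \<le> s \<Longrightarrow> (\<lambda>z. moving_average \<Psi> m z t) \<in> borel_measurable (PiM {..s} (\<lambda>_. borel))"
proof (induction m arbitrary: t)
  case (Suc m)
  have [measurable]: "(\<lambda>z. moving_average \<Psi> m z (t - 1)) \<in> borel_measurable (PiM {..s} (\<lambda>_. borel))"
    using Suc by simp
  have [measurable]: "(\<lambda>z. z t) \<in> borel_measurable (PiM {..s} (\<lambda>_. borel :: 'a measure))"
    using Suc.prems by (intro measurable_component_singleton) auto
  show ?case unfolding moving_average.simps by measurable
qed simp

lemma measurable_causal_solution:
  fixes \<Psi> :: "'a::{banach,second_countable_topology} \<Rightarrow>\<^sub>L 'a"
  shows "t \<le> s \<Longrightarrow> (\<lambda>z. causal_solution \<Psi> z t) \<in> borel_measurable (PiM {..s} (\<lambda>_. borel))"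
  unfolding causal_solution_def by (intro borel_measurable_lim_metric measurable_moving_average)

locale far1_model = prob_space M for M :: "'w measure" +
  fixes X \<epsilon> :: "int \<Rightarrow> 'w \<Rightarrow> 'a::{real_inner,banach,second_countable_topology}"
    and \<Psi> :: "'a \<Rightarrow>\<^sub>L 'a"
  assumes stationary: "strictly_stationary M X"
    and far1: "far1 M \<Psi> \<epsilon> X"
    and integrable_X: "\<And>t. integrable M (X t)"
    and iid: "iid M \<epsilon>"
    and mean_eps: "\<And>t. integrable M (\<epsilon> t) \<and> (\<integral>\<omega>. \<epsilon> t \<omega> \<partial>M) = 0"
    and moment_eps: "\<And>t. integrable M (\<lambda>\<omega>. norm (\<epsilon> t \<omega>) ^ 4)"
    and norm_Psi: "norm \<Psi> < 1"
begin

definition F :: "'a measure" where "F = distr M borel (\<epsilon> 0)"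

definition sigma2 :: real where "sigma2 = (\<integral>\<omega>. (norm (\<epsilon> 0 \<omega>))\<^sup>2 \<partial>M)"

definition moment2 :: real where "moment2 = sigma2 / (1 - norm \<Psi>)\<^sup>2"

lemma eps_measurable [measurable]: "\<epsilon> t \<in> borel_measurable M"
  using mean_eps[of t] by auto

lemma X_measurable [measurable]: "X t \<in> borel_measurable M"
  using integrable_X[of t] by auto

lemma distr_eps: "distr M borel (\<epsilon> t) = F"
  using iid by (simp add: iid_def F_def)

lemma prob_space_F: "prob_space F" and sets_F: "sets F = sets borel"
  unfolding F_def by (auto intro: prob_space_distr)

lemma indep_eps: "indep_vars (\<lambda>_. borel) \<epsilon> UNIV"
  using iid by (simp add: iid_def)

lemma indep_eps_nat: "indep_vars (\<lambda>_. borel) (\<lambda>j. \<epsilon> (int j)) J"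
proof -
  have "indep_vars (\<lambda>j. PiM {int j} (\<lambda>_. borel)) (\<lambda>j \<omega>. restrict (\<lambda>i. \<epsilon> i \<omega>) {int j}) J"
    by (rule indep_vars_restrict[OF indep_eps]) (auto simp: disjoint_family_on_def)
  from indep_vars_compose2[OF this, where Y="\<lambda>j z. z (int j)" and N="\<lambda>_. borel"]
  show ?thesis by (simp add: measurable_component_singleton)
qed

lemma nn_integral_eps:
  assumes [measurable]: "f \<in> borel_measurable borel"
  shows "(\<integral>\<^sup>+\<omega>. f (\<epsilon> t \<omega>) \<partial>M) = (\<integral>\<^sup>+x. f x \<partial>F)"
  by (simp add: distr_eps[of t, symmetric] nn_integral_distr)

lemma integral_eps:
  fixes f :: "'a \<Rightarrow> 'b::{banach,second_countable_topology}"
  assumes [measurable]: "f \<in> borel_measurable borel"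
  shows "(\<integral>\<omega>. f (\<epsilon> t \<omega>) \<partial>M) = (\<integral>x. f x \<partial>F)" "integrable M (\<lambda>\<omega>. f (\<epsilon> t \<omega>)) \<longleftrightarrow> integrable F f"
  by (simp_all add: distr_eps[of t, symmetric] integral_distr integrable_distr_eq)

lemma integrable_eps_sq: "integrable M (\<lambda>\<omega>. (norm (\<epsilon> t \<omega>))\<^sup>2)"
proof (rule Bochner_Integration.integrable_bound)
  show "integrable M (\<lambda>\<omega>. 1 + norm (\<epsilon> t \<omega>) ^ 4)" using moment_eps by auto
  have "x\<^sup>2 \<le> 1 + x ^ 4" for x :: real
  proof -
    have "0 \<le> (x\<^sup>2 - 1)\<^sup>2 + x\<^sup>2" by simp
    then show ?thesis by (simp add: power2_eq_square power4_eq_xxxx algebra_simps)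
  qed
  then show "AE \<omega> in M. norm ((norm (\<epsilon> t \<omega>))\<^sup>2) \<le> norm (1 + norm (\<epsilon> t \<omega>) ^ 4)" by simp
qed measurable

lemma nn_second_moment_eps: "(\<integral>\<^sup>+\<omega>. ennreal ((norm (\<epsilon> t \<omega>))\<^sup>2) \<partial>M) = ennreal sigma2"
proof -
  have "(\<integral>\<^sup>+\<omega>. ennreal ((norm (\<epsilon> t \<omega>))\<^sup>2) \<partial>M) = (\<integral>\<^sup>+\<omega>. ennreal ((norm (\<epsilon> 0 \<omega>))\<^sup>2) \<partial>M)"
    by (simp add: nn_integral_eps[of "\<lambda>x. ennreal ((norm x)\<^sup>2)"])
  then show ?thesis unfolding sigma2_def using integrable_eps_sq[of 0] by (simp add: nn_integral_eq_integral)
qed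

lemma sigma2_nonneg: "0 \<le> sigma2" unfolding sigma2_def by simp

lemma moment2_nonneg: "0 \<le> moment2" unfolding moment2_def by (simp add: sigma2_nonneg)

lemma AE_path: "AE \<omega> in M. \<forall>t. X (t + 1) \<omega> = \<Psi> (X t \<omega>) + \<epsilon> (t + 1) \<omega>"
  using far1 by (simp add: far1_def AE_all_countable)

lemma distr_X: "distr M borel (X t) = distr M borel (X 0)"
proof -
  let ?P = "PiM (UNIV :: int set) (\<lambda>_. borel :: 'a measure)"
  have m: "(\<lambda>\<omega> s. X (s + h) \<omega>) \<in> M \<rightarrow>\<^sub>M ?P" for h
    by (rule measurable_PiM_single') (auto simp: space_PiM)
  have "distr M borel (X t) = distr (distr M ?P (\<lambda>\<omega> s. X (s + t) \<omega>)) borel (\<lambda>z. z 0)"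
    by (subst distr_distr[OF _ m]) (auto simp: o_def)
  also have "distr M ?P (\<lambda>\<omega> s. X (s + t) \<omega>) = distr M ?P (\<lambda>\<omega> s. X (s + 0) \<omega>)"
    using stationary by (simp add: strictly_stationary_def)
  also have "distr \<dots> borel (\<lambda>z. z 0) = distr M borel (X 0)"
    by (subst distr_distr[OF _ m]) (auto simp: o_def)
  finally show ?thesis .
qed

lemma nn_integral_X:
  assumes [measurable]: "f \<in> borel_measurable borel"
  shows "(\<integral>\<^sup>+\<omega>. f (X t \<omega>) \<partial>M) = (\<integral>\<^sup>+\<omega>. f (X 0 \<omega>) \<partial>M)"
proof -
  have "(\<integral>\<^sup>+\<omega>. f (X t \<omega>) \<partial>M) = (\<integral>\<^sup>+x. f x \<partial>distr M borel (X t))" by (simp add: nn_integral_distr)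
  also have "\<dots> = (\<integral>\<^sup>+\<omega>. f (X 0 \<omega>) \<partial>M)" by (subst distr_X) (simp add: nn_integral_distr)
  finally show ?thesis .
qed

text \<open>Iterating the recursion \<open>m\<close> times leaves an error of at most \<open>(norm \<Psi>) ^ m * norm (X (t - m))\<close>. By stationarity
the expectations of these errors are summable.\<close>

lemma AE_moving_average_tendsto: "AE \<omega> in M. (\<lambda>m. moving_average \<Psi> m (\<lambda>i. \<epsilon> i \<omega>) t) \<longlonglongrightarrow> X t \<omega>"
proof -
  let ?\<rho> = "norm \<Psi>"
  define C where "C = (\<integral>\<omega>. norm (X 0 \<omega>) \<partial>M)"
  have EX: "(\<integral>\<^sup>+\<omega>. ennreal (norm (X s \<omega>)) \<partial>M) = ennreal C" for s
    unfolding nn_integral_X[of "\<lambda>x. ennreal (norm x)" s, simplified] C_def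
    using integrable_X[of 0] by (intro nn_integral_eq_integral) auto
  have "(\<integral>\<^sup>+\<omega>. (\<Sum>m. ennreal (?\<rho> ^ m * norm (X (t - int m) \<omega>))) \<partial>M)
      = (\<Sum>m. \<integral>\<^sup>+\<omega>. ennreal (?\<rho> ^ m * norm (X (t - int m) \<omega>)) \<partial>M)"
    by (intro nn_integral_suminf) measurable
  also have "\<dots> = (\<Sum>m. ennreal (?\<rho> ^ m * C))"
    by (intro suminf_cong) (simp add: ennreal_mult nn_integral_cmult EX C_def)
  also have "\<dots> = ennreal (\<Sum>m. ?\<rho> ^ m * C)"
    using norm_Psi by (intro suminf_ennreal2 summable_mult2 summable_geometric) (auto simp: C_def)
  also have "\<dots> < top" by simp
  finally have "AE \<omega> in M. (\<Sum>m. ennreal (?\<rho> ^ m * norm (X (t - int m) \<omega>))) \<noteq> \<infinity>"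
    by (intro nn_integral_noteq_infinite) auto
  then show ?thesis using AE_path
  proof eventually_elim
    case (elim \<omega>)
    have "summable (\<lambda>m. ?\<rho> ^ m * norm (X (t - int m) \<omega>))"
      using elim(1) by (intro summable_suminf_not_top) auto
    then have lim: "(\<lambda>m. ?\<rho> ^ m * norm (X (t - int m) \<omega>)) \<longlonglongrightarrow> 0" by (rule summable_LIMSEQ_zero)
    have le: "norm (moving_average \<Psi> m (\<lambda>i. \<epsilon> i \<omega>) s - X s \<omega>) \<le> ?\<rho> ^ m * norm (X (s - int m) \<omega>)" for m s
    proof (induction m arbitrary: s)
      case (Suc m)
      have "X s \<omega> = \<Psi> (X (s - 1) \<omega>) + \<epsilon> s \<omega>" using elim(2) by (metis diff_add_cancel)
      then have "moving_average \<Psi> (Suc m) (\<lambda>i. \<epsilon> i \<omega>) s - X s \<omega>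
          = \<Psi> (moving_average \<Psi> m (\<lambda>i. \<epsilon> i \<omega>) (s - 1) - X (s - 1) \<omega>)"
        by (simp add: blinfun.diff_right)
      also have "norm \<dots> \<le> ?\<rho> * (?\<rho> ^ m * norm (X (s - 1 - int m) \<omega>))"
        by (intro order_trans[OF norm_blinfun] mult_left_mono Suc.IH) auto
      finally show ?case by (simp add: mult.assoc algebra_simps)
    qed simp
    have "(\<lambda>m. moving_average \<Psi> m (\<lambda>i. \<epsilon> i \<omega>) t - X t \<omega>) \<longlonglongrightarrow> 0"
      by (rule Lim_null_comparison[OF _ lim]) (use le in auto)
    then show ?case by (simp add: LIM_zero_iff)
  qed
qed

lemma AE_causal: "AE \<omega> in M. \<forall>t. X t \<omega> = causal_solution \<Psi> (\<lambda>i. \<epsilon> i \<omega>) t"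
proof -
  have "AE \<omega> in M. X t \<omega> = causal_solution \<Psi> (\<lambda>i. \<epsilon> i \<omega>) t" for t
    using AE_moving_average_tendsto[of t] by eventually_elim (simp add: causal_solution_def limI)
  then show ?thesis by (simp add: AE_all_countable)
qed

lemma moving_average_eps_measurable [measurable]:
  "(\<lambda>\<omega>. moving_average \<Psi> m (\<lambda>i. \<epsilon> i \<omega>) t) \<in> borel_measurable M"
  by (induction m arbitrary: t) auto

text \<open>Fatou's lemma transfers the uniform bound for the moving averages of finite order to their limit.\<close>

lemma nn_second_moment_X: "(\<integral>\<^sup>+\<omega>. ennreal ((norm (X t \<omega>))\<^sup>2) \<partial>M) \<le> ennreal moment2"
proof -
  have ma: "(\<integral>\<^sup>+\<omega>. ennreal ((norm (moving_average \<Psi> m (\<lambda>i. \<epsilon> i \<omega>) t))\<^sup>2) \<partial>M) \<le> ennreal moment2" for m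
  proof -
    define t0 where "t0 = t - int m"
    have "(\<integral>\<^sup>+\<omega>. ennreal ((norm (moving_average \<Psi> m (\<lambda>i. \<epsilon> i \<omega>) (t0 + int m)))\<^sup>2) \<partial>M) \<le> ennreal moment2"
      unfolding moment2_def
    proof (rule contraction_second_moment[where n=m and D="\<lambda>m \<omega>. moving_average \<Psi> m (\<lambda>i. \<epsilon> i \<omega>) (t0 + int m)"
          and W="\<lambda>m \<omega>. norm (\<epsilon> (t0 + int (Suc m)) \<omega>)"])
      fix l \<omega>
      show "norm (moving_average \<Psi> (Suc l) (\<lambda>i. \<epsilon> i \<omega>) (t0 + int (Suc l)))
        \<le> norm \<Psi> * norm (moving_average \<Psi> l (\<lambda>i. \<epsilon> i \<omega>) (t0 + int l)) + norm (\<epsilon> (t0 + int (Suc l)) \<omega>)"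
        by (simp add: norm_triangle_le norm_blinfun)
    next
      fix l show "(\<integral>\<^sup>+\<omega>. ennreal ((norm (\<epsilon> (t0 + int (Suc l)) \<omega>))\<^sup>2) \<partial>M) \<le> ennreal sigma2"
        by (simp only: nn_second_moment_eps order_refl)
    qed (use norm_Psi sigma2_nonneg in auto)
    then show ?thesis by (simp add: t0_def)
  qed
  have "(\<integral>\<^sup>+\<omega>. ennreal ((norm (X t \<omega>))\<^sup>2) \<partial>M)
      = (\<integral>\<^sup>+\<omega>. liminf (\<lambda>m. ennreal ((norm (moving_average \<Psi> m (\<lambda>i. \<epsilon> i \<omega>) t))\<^sup>2)) \<partial>M)"
  proof (rule nn_integral_cong_AE)
    show "AE \<omega> in M. ennreal ((norm (X t \<omega>))\<^sup>2) = liminf (\<lambda>m. ennreal ((norm (moving_average \<Psi> m (\<lambda>i. \<epsilon> i \<omega>) t))\<^sup>2))"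
      using AE_moving_average_tendsto[of t]
    proof eventually_elim
      case (elim \<omega>)
      have "(\<lambda>m. ennreal ((norm (moving_average \<Psi> m (\<lambda>i. \<epsilon> i \<omega>) t))\<^sup>2)) \<longlonglongrightarrow> ennreal ((norm (X t \<omega>))\<^sup>2)"
        using elim by (intro tendsto_intros tendsto_ennrealI)
      then show ?case by (intro lim_imp_Liminf[symmetric]) auto
    qed
  qed
  also have "\<dots> \<le> liminf (\<lambda>m. \<integral>\<^sup>+\<omega>. ennreal ((norm (moving_average \<Psi> m (\<lambda>i. \<epsilon> i \<omega>) t))\<^sup>2) \<partial>M)"
    by (intro nn_integral_liminf) measurable
  also have "\<dots> \<le> ennreal moment2"
    using ma by (intro order_trans[OF Liminf_le_Limsup Limsup_bounded]) auto
  finally show ?thesis .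
qed

lemma indep_past:
  "indep_var (PiM {..s} (\<lambda>_. borel)) (\<lambda>\<omega>. restrict (\<lambda>i. \<epsilon> i \<omega>) {..s})
    (PiM {s<..} (\<lambda>_. borel)) (\<lambda>\<omega>. restrict (\<lambda>i. \<epsilon> i \<omega>) {s<..})"
  by (intro indep_var_restrict[OF indep_eps]) auto

text \<open>The summands are martingale differences, hence orthogonal: \<open>X j\<close> is a function of the innovations up
to time \<open>j\<close>.\<close>

lemma second_moment_martingale:
  "(\<integral>\<^sup>+\<omega>. ennreal ((norm (\<Sum>j<n. (X (int j) \<omega> \<bullet> b) *\<^sub>R \<epsilon> (int j + 1) \<omega>))\<^sup>2) \<partial>M)
    = (\<Sum>j<n. \<integral>\<^sup>+\<omega>. ennreal ((X (int j) \<omega> \<bullet> b)\<^sup>2) \<partial>M) * ennreal sigma2"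
proof (induction n)
  case (Suc n)
  let ?P = "PiM {..int n} (\<lambda>_. borel :: 'a measure)"
  let ?U = "\<lambda>\<omega>. restrict (\<lambda>i. \<epsilon> i \<omega>) {..int n}"
  define u where "u z = (\<Sum>j<n. (causal_solution \<Psi> z (int j) \<bullet> b) *\<^sub>R z (int j + 1))" for z
  define c where "c z = causal_solution \<Psi> z (int n) \<bullet> b" for z
  have [measurable]: "(\<lambda>z. causal_solution \<Psi> z (int j)) \<in> borel_measurable ?P" if "j \<le> n" for j
    using that by (intro measurable_causal_solution) auto
  have cm: "c \<in> borel_measurable ?P" unfolding c_def by measurable
  have um: "u \<in> borel_measurable ?P"
    unfolding u_def
  proof (intro borel_measurable_sum borel_measurable_scaleR)
    fix j assume "j \<in> {..<n}"
    then show "(\<lambda>z. causal_solution \<Psi> z (int j) \<bullet> b) \<in> borel_measurable ?P"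
      "(\<lambda>z. z (int j + 1)) \<in> borel_measurable ?P"
      by (auto intro!: measurable_component_singleton)
  qed
  have u: "AE \<omega> in M. u (?U \<omega>) = (\<Sum>j<n. (X (int j) \<omega> \<bullet> b) *\<^sub>R \<epsilon> (int j + 1) \<omega>)"
    using AE_causal by eventually_elim (auto simp: u_def causal_solution_restrict intro!: sum.cong)
  have c: "AE \<omega> in M. c (?U \<omega>) = X (int n) \<omega> \<bullet> b"
    using AE_causal by eventually_elim (simp add: c_def causal_solution_restrict)
  have "(\<integral>\<^sup>+\<omega>. ennreal ((norm (\<Sum>j<Suc n. (X (int j) \<omega> \<bullet> b) *\<^sub>R \<epsilon> (int j + 1) \<omega>))\<^sup>2) \<partial>M)
      = (\<integral>\<^sup>+\<omega>. ennreal ((norm (u (?U \<omega>) + c (?U \<omega>) *\<^sub>R \<epsilon> (int n + 1) \<omega>))\<^sup>2) \<partial>M)"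
  proof (rule nn_integral_cong_AE)
    show "AE \<omega> in M. ennreal ((norm (\<Sum>j<Suc n. (X (int j) \<omega> \<bullet> b) *\<^sub>R \<epsilon> (int j + 1) \<omega>))\<^sup>2)
        = ennreal ((norm (u (?U \<omega>) + c (?U \<omega>) *\<^sub>R \<epsilon> (int n + 1) \<omega>))\<^sup>2)"
      using u c by eventually_elim (simp only: sum.lessThan_Suc)
  qed
  also have "\<dots> = (\<integral>\<^sup>+\<omega>. ennreal ((norm (u (?U \<omega>)))\<^sup>2) \<partial>M) + (\<integral>\<^sup>+\<omega>. ennreal ((c (?U \<omega>))\<^sup>2) \<partial>M) * ennreal sigma2"
    unfolding nn_second_moment_eps[of "int n + 1", symmetric]
  proof (rule second_moment_independent_step[OF indep_past _ _ um cm])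
    show "(\<lambda>z. z (int n + 1)) \<in> borel_measurable (PiM {int n<..} (\<lambda>_. borel :: 'a measure))"
      by (intro measurable_component_singleton) auto
  qed (use mean_eps integrable_eps_sq in auto)
  also have "(\<integral>\<^sup>+\<omega>. ennreal ((norm (u (?U \<omega>)))\<^sup>2) \<partial>M)
      = (\<integral>\<^sup>+\<omega>. ennreal ((norm (\<Sum>j<n. (X (int j) \<omega> \<bullet> b) *\<^sub>R \<epsilon> (int j + 1) \<omega>))\<^sup>2) \<partial>M)"
    using u by (intro nn_integral_cong_AE) auto
  also have "(\<integral>\<^sup>+\<omega>. ennreal ((c (?U \<omega>))\<^sup>2) \<partial>M) = (\<integral>\<^sup>+\<omega>. ennreal ((X (int n) \<omega> \<bullet> b)\<^sup>2) \<partial>M)"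
    using c by (intro nn_integral_cong_AE) auto
  finally show ?case unfolding Suc.IH by (simp add: distrib_right)
qed simp

lemma second_moment_iid_average:
  fixes f :: "'a \<Rightarrow> 'b::{real_inner,banach,second_countable_topology}"
  assumes f [measurable]: "f \<in> borel_measurable borel" and sq: "integrable F (\<lambda>x. (norm (f x))\<^sup>2)" and n: "1 \<le> n"
  shows "(\<integral>\<^sup>+\<omega>. ennreal ((norm ((1 / real n) *\<^sub>R (\<Sum>j=1..n. f (\<epsilon> (int j) \<omega>)) - (\<integral>x. f x \<partial>F)))\<^sup>2) \<partial>M)
    \<le> ennreal ((1 / real n) * (\<integral>x. (norm (f x))\<^sup>2 \<partial>F))"
proof -
  interpret F: prob_space F by (rule prob_space_F)
  note [measurable_cong] = sets_F
  have fF [measurable]: "f \<in> borel_measurable F" using f by (simp cong: measurable_cong_sets add: sets_F)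
  have intf: "integrable F f"
  proof (rule Bochner_Integration.integrable_bound)
    show "integrable F (\<lambda>x. 1 + (norm (f x))\<^sup>2)" using sq by auto
    have "t \<le> 1 + t\<^sup>2" for t :: real using zero_le_power2[of "t - 1/2"] by (simp add: power2_eq_square algebra_simps)
    then show "AE x in F. norm (f x) \<le> norm (1 + (norm (f x))\<^sup>2)" by (simp add: abs_of_nonneg)
  qed measurable
  define \<mu> where "\<mu> = (\<integral>x. f x \<partial>F)"
  define Y where "Y j \<omega> = f (\<epsilon> (int j) \<omega>) - \<mu>" for j \<omega>
  have Ysq: "(\<integral>\<^sup>+\<omega>. ennreal ((norm (Y j \<omega>))\<^sup>2) \<partial>M) \<le> ennreal (\<integral>x. (norm (f x))\<^sup>2 \<partial>F)" for j
  proof -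
    have "(\<integral>\<^sup>+\<omega>. ennreal ((norm (Y j \<omega>))\<^sup>2) \<partial>M) = (\<integral>\<^sup>+x. ennreal ((norm (f x - \<mu>))\<^sup>2) \<partial>F)"
      unfolding Y_def by (rule nn_integral_eps[of "\<lambda>x. ennreal ((norm (f x - \<mu>))\<^sup>2)"]) measurable
    also have "\<dots> \<le> (\<integral>\<^sup>+x. ennreal ((norm (f x))\<^sup>2) \<partial>F)"
      unfolding \<mu>_def by (rule F.second_moment_centered_le[OF intf sq])
    also have "\<dots> = ennreal (\<integral>x. (norm (f x))\<^sup>2 \<partial>F)" using sq by (intro nn_integral_eq_integral) auto
    finally show ?thesis .
  qed
  have ind: "indep_vars (\<lambda>_. borel) Y {1..n}"
  proof -
    have "indep_vars (\<lambda>i. borel) (\<lambda>j \<omega>. f (\<epsilon> (int j) \<omega>) - \<mu>) {1..n}"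
      by (rule indep_vars_compose2[OF indep_eps_nat]) measurable
    then show ?thesis by (simp add: Y_def[abs_def])
  qed
  have YI: "integrable M (Y j)" "expectation (Y j) = 0" "integrable M (\<lambda>\<omega>. (norm (Y j \<omega>))\<^sup>2)" for j
  proof -
    show i: "integrable M (Y j)" unfolding Y_def using intf by (auto simp: integral_eps(2))
    show "expectation (Y j) = 0"
      unfolding Y_def using intf by (subst Bochner_Integration.integral_diff) (auto simp: integral_eps prob_space \<mu>_def)
    have "(\<integral>\<^sup>+\<omega>. ennreal ((norm (Y j \<omega>))\<^sup>2) \<partial>M) < \<infinity>" using Ysq[of j] by (auto simp: le_less_trans[OF _ ennreal_less_top])
    then show "integrable M (\<lambda>\<omega>. (norm (Y j \<omega>))\<^sup>2)"
      using i by (intro integrableI_bounded) auto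
  qed
  have eq: "(1 / real n) *\<^sub>R (\<Sum>j=1..n. f (\<epsilon> (int j) \<omega>)) - \<mu> = (1 / real n) *\<^sub>R (\<Sum>j\<in>{1..n}. Y j \<omega>)" for \<omega>
    using n by (simp add: Y_def sum_subtractf scaleR_diff_right sum_constant_scaleR)
  have [measurable]: "Y j \<in> borel_measurable M" for j using YI(1)[of j] by auto
  have "(\<integral>\<^sup>+\<omega>. ennreal ((norm ((1 / real n) *\<^sub>R (\<Sum>j=1..n. f (\<epsilon> (int j) \<omega>)) - \<mu>))\<^sup>2) \<partial>M)
      = (\<integral>\<^sup>+\<omega>. ennreal ((1 / real n)\<^sup>2) * ennreal ((norm (\<Sum>j\<in>{1..n}. Y j \<omega>))\<^sup>2) \<partial>M)"
    unfolding eq by (intro nn_integral_cong) (simp add: power_divide ennreal_mult[symmetric])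
  also have "\<dots> = ennreal ((1 / real n)\<^sup>2) * (\<Sum>j\<in>{1..n}. \<integral>\<^sup>+\<omega>. ennreal ((norm (Y j \<omega>))\<^sup>2) \<partial>M)"
    unfolding second_moment_indep_sum[OF ind finite_atLeastAtMost order_refl YI, symmetric]
    by (rule nn_integral_cmult) measurable
  also have "\<dots> \<le> ennreal ((1 / real n)\<^sup>2) * (\<Sum>j\<in>{1..n}. ennreal (\<integral>x. (norm (f x))\<^sup>2 \<partial>F))"
    by (intro mult_left_mono sum_mono Ysq) auto
  also have "\<dots> = ennreal ((1 / real n)\<^sup>2 * (real n * (\<integral>x. (norm (f x))\<^sup>2 \<partial>F)))"
    by (simp add: sum_ennreal ennreal_mult ennreal_of_nat_eq_real_of_nat)
  also have "(1 / real n)\<^sup>2 * (real n * (\<integral>x. (norm (f x))\<^sup>2 \<partial>F)) = (1 / real n) * (\<integral>x. (norm (f x))\<^sup>2 \<partial>F)"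
    using n by (simp add: power2_eq_square)
  finally show ?thesis by (simp add: \<mu>_def)
qed

end

section \<open>Convergence of the covariance operators\<close>

context prob_space
begin

lemma
  fixes Y :: "'a \<Rightarrow> 'b::{real_inner,banach,second_countable_topology}"
  assumes Y [measurable]: "Y \<in> borel_measurable M" and sq: "integrable M (\<lambda>\<omega>. (norm (Y \<omega>))\<^sup>2)"
  shows integrable_inner_inner: "integrable M (\<lambda>\<omega>. (Y \<omega> \<bullet> y) * (Y \<omega> \<bullet> z))"
    and cov_operator_inner: "cov_operator M Y y \<bullet> z = expectation (\<lambda>\<omega>. (Y \<omega> \<bullet> y) * (Y \<omega> \<bullet> z))"
    and cov_operator_symmetric: "cov_operator M Y y \<bullet> z = y \<bullet> cov_operator M Y z"
    and bounded_linear_cov_operator: "bounded_linear (cov_operator M Y)"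
proof -
  have int: "integrable M (\<lambda>\<omega>. (Y \<omega> \<bullet> y) *\<^sub>R Y \<omega>)" for y
  proof (rule Bochner_Integration.integrable_bound)
    show "integrable M (\<lambda>\<omega>. norm y * (norm (Y \<omega>))\<^sup>2)" using sq by auto
    have "\<bar>Y \<omega> \<bullet> y\<bar> * norm (Y \<omega>) \<le> norm y * (norm (Y \<omega>))\<^sup>2" for \<omega>
      using mult_right_mono[OF Cauchy_Schwarz_ineq2[of "Y \<omega>" y], of "norm (Y \<omega>)"]
      by (simp add: power2_eq_square mult_ac)
    then show "AE \<omega> in M. norm ((Y \<omega> \<bullet> y) *\<^sub>R Y \<omega>) \<le> norm (norm y * (norm (Y \<omega>))\<^sup>2)" by simp
  qed measurable
  from integrable_inner_left[of z, OF int] show "integrable M (\<lambda>\<omega>. (Y \<omega> \<bullet> y) * (Y \<omega> \<bullet> z))" by simp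
  have inner: "cov_operator M Y y \<bullet> z = expectation (\<lambda>\<omega>. (Y \<omega> \<bullet> y) * (Y \<omega> \<bullet> z))" for y z
    unfolding cov_operator_def tensor_def using int by (subst integral_inner_left[symmetric]) auto
  show "cov_operator M Y y \<bullet> z = expectation (\<lambda>\<omega>. (Y \<omega> \<bullet> y) * (Y \<omega> \<bullet> z))" by (rule inner)
  show sym: "cov_operator M Y y \<bullet> z = y \<bullet> cov_operator M Y z"
    by (simp add: inner inner_commute[of y "cov_operator M Y z"] mult.commute)
  show "bounded_linear (cov_operator M Y)"
  proof (rule bounded_linear_intro[where K="expectation (\<lambda>\<omega>. (norm (Y \<omega>))\<^sup>2)"])
    fix x y :: 'b and r :: real
    show "cov_operator M Y (x + y) = cov_operator M Y x + cov_operator M Y y"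
      unfolding cov_operator_def tensor_def using int by (simp add: inner_add_right scaleR_add_left)
    show "cov_operator M Y (r *\<^sub>R x) = r *\<^sub>R cov_operator M Y x"
      unfolding cov_operator_def tensor_def using int by (simp add: integral_scaleR_right[symmetric] del: integral_scaleR_right)
    have "norm (cov_operator M Y x) \<le> expectation (\<lambda>\<omega>. norm ((Y \<omega> \<bullet> x) *\<^sub>R Y \<omega>))"
      unfolding cov_operator_def tensor_def by (rule integral_norm_bound)
    also have "\<dots> \<le> expectation (\<lambda>\<omega>. norm x * (norm (Y \<omega>))\<^sup>2)"
    proof (intro integral_mono integrable_norm int)
      fix \<omega>
      show "norm ((Y \<omega> \<bullet> x) *\<^sub>R Y \<omega>) \<le> norm x * (norm (Y \<omega>))\<^sup>2"
        using mult_right_mono[OF Cauchy_Schwarz_ineq2[of "Y \<omega>" x], of "norm (Y \<omega>)"]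
        by (simp add: power2_eq_square mult_ac)
    qed (use sq in auto)
    finally show "norm (cov_operator M Y x) \<le> norm x * expectation (\<lambda>\<omega>. (norm (Y \<omega>))\<^sup>2)" by simp
  qed
qed

end

context far1_model
begin

abbreviation \<Gamma> :: "'a \<Rightarrow> 'a" where "\<Gamma> \<equiv> cov_operator M (X 0)"

abbreviation C\<^sub>\<epsilon> :: "'a \<Rightarrow> 'a" where "C\<^sub>\<epsilon> \<equiv> cov_operator M (\<epsilon> 0)"

text \<open>By \<open>emp_cross_cov_sample\<close> this is the part of the empirical cross-covariance operator that \<open>\<Psi>\<close> and
the empirical covariance operator do not explain.\<close>

definition noise :: "nat \<Rightarrow> 'w \<Rightarrow> 'a \<Rightarrow> 'a" where
  "noise n \<omega> y = (1 / real n) *\<^sub>R (\<Sum>j<n. (X (int j) \<omega> \<bullet> y) *\<^sub>R \<epsilon> (int j + 1) \<omega>)"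

definition eps_cov_error :: "nat \<Rightarrow> 'w \<Rightarrow> 'a \<Rightarrow> 'a" where
  "eps_cov_error n \<omega> y = (1 / real n) *\<^sub>R (\<Sum>j=1..n. (\<epsilon> (int j) \<omega> \<bullet> y) *\<^sub>R \<epsilon> (int j) \<omega>) - C\<^sub>\<epsilon> y"

lemma integrable_X_sq: "integrable M (\<lambda>\<omega>. (norm (X t \<omega>))\<^sup>2)"
  by (rule integrableI_bounded) (auto simp: le_less_trans[OF nn_second_moment_X ennreal_less_top])

lemma bounded_linear_noise: "bounded_linear (noise n \<omega>)"
  unfolding noise_def
  by (intro bounded_linear_compose[OF bounded_linear_scaleR_right] bounded_linear_sum
      bounded_linear_compose[OF bounded_linear_scaleR_left] bounded_linear_inner_right)

lemma bounded_linear_Ceps: "bounded_linear C\<^sub>\<epsilon>"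
  by (intro bounded_linear_cov_operator integrable_eps_sq) measurable

lemma bounded_linear_Gamma: "bounded_linear \<Gamma>"
  by (intro bounded_linear_cov_operator integrable_X_sq) measurable

lemma bounded_linear_eps_cov_error: "bounded_linear (eps_cov_error n \<omega>)"
  unfolding eps_cov_error_def
  by (intro bounded_linear_sub bounded_linear_Ceps bounded_linear_compose[OF bounded_linear_scaleR_right]
      bounded_linear_sum bounded_linear_compose[OF bounded_linear_scaleR_left] bounded_linear_inner_right)

text \<open>Markov's inequality for the squared Hilbert-Schmidt norm.\<close>

lemma with_high_prob_operator_bound:
  fixes A :: "nat \<Rightarrow> 'w \<Rightarrow> 'a \<Rightarrow> 'a"
  assumes e: "orthonormal_frame (e :: nat \<Rightarrow> 'a)" and A: "\<And>n \<omega>. bounded_linear (A n \<omega>)"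
    and Am [measurable]: "\<And>n y. (\<lambda>\<omega>. A n \<omega> y) \<in> borel_measurable M"
    and le: "\<And>n. 1 \<le> n \<Longrightarrow> (\<Sum>i. \<integral>\<^sup>+\<omega>. ennreal ((norm (A n \<omega> (e i)))\<^sup>2) \<partial>M) \<le> ennreal (C / real n)"
    and C: "0 \<le> C" and s: "\<And>n. 0 < s n" and lim: "(\<lambda>n. 1 / (real n * (s n)\<^sup>2)) \<longlonglongrightarrow> 0"
  shows "with_high_prob M (\<lambda>n \<omega>. \<forall>y. norm (A n \<omega> y) \<le> s n * norm y)"
proof -
  define f where "f n \<omega> = ennreal (1 / (s n)\<^sup>2) * (\<Sum>i. ennreal ((norm (A n \<omega> (e i)))\<^sup>2))" for n \<omega>
  have [measurable]: "f n \<in> borel_measurable M" for n unfolding f_def by measurable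
  have "with_high_prob M (\<lambda>n \<omega>. f n \<omega> \<le> ennreal 1)"
  proof (rule with_high_prob_markov)
    show "(\<lambda>n. C * (1 / (real n * (s n)\<^sup>2))) \<longlonglongrightarrow> 0" using tendsto_mult_right_zero[OF lim] by simp
    show "\<forall>\<^sub>F n in sequentially. (\<integral>\<^sup>+\<omega>. f n \<omega> \<partial>M) \<le> ennreal (C * (1 / (real n * (s n)\<^sup>2)))"
      using eventually_ge_at_top[of 1]
    proof eventually_elim
      case (elim n)
      have "(\<integral>\<^sup>+\<omega>. f n \<omega> \<partial>M) = ennreal (1 / (s n)\<^sup>2) * (\<Sum>i. \<integral>\<^sup>+\<omega>. ennreal ((norm (A n \<omega> (e i)))\<^sup>2) \<partial>M)"
        unfolding f_def by (subst nn_integral_cmult) (auto simp: nn_integral_suminf)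
      also have "\<dots> \<le> ennreal (1 / (s n)\<^sup>2) * ennreal (C / real n)" by (intro mult_left_mono le elim) auto
      also have "\<dots> = ennreal (C * (1 / (real n * (s n)\<^sup>2)))" using C by (simp add: ennreal_mult[symmetric] mult.commute)
      finally show ?case .
    qed
  qed auto
  then show ?thesis
  proof (rule with_high_prob_mono, intro always_eventually allI ballI impI)
    fix n \<omega> y assume f: "f n \<omega> \<le> ennreal 1"
    have "(\<Sum>i. ennreal ((norm (A n \<omega> (e i)))\<^sup>2)) = ennreal ((s n)\<^sup>2) * f n \<omega>"
      unfolding f_def using s[of n] by (simp add: mult.assoc[symmetric] ennreal_mult[symmetric])
    also have "\<dots> \<le> ennreal ((s n)\<^sup>2) * ennreal 1" by (intro mult_left_mono f) simp
    finally show "norm (A n \<omega> y) \<le> s n * norm y"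
      using norm_le_hilbert_schmidt[OF e A] s[of n] by (simp add: less_imp_le)
  qed
qed

lemma noise_small:
  assumes e: "orthonormal_frame (e :: nat \<Rightarrow> 'a)" and s: "\<And>n. 0 < s n" and lim: "(\<lambda>n. 1 / (real n * (s n)\<^sup>2)) \<longlonglongrightarrow> 0"
  shows "with_high_prob M (\<lambda>n \<omega>. \<forall>y. norm (noise n \<omega> y) \<le> s n * norm y)"
proof (rule with_high_prob_operator_bound[where e=e and A=noise and s=s and C="moment2 * sigma2", OF e])
  show "bounded_linear (noise n \<omega>)" for n \<omega> by (rule bounded_linear_noise)
  show "0 < s n" for n by (rule s)
  show "(\<lambda>n. 1 / (real n * (s n)\<^sup>2)) \<longlonglongrightarrow> 0" by (rule lim)
  show "(\<lambda>\<omega>. noise n \<omega> y) \<in> borel_measurable M" for n y unfolding noise_def by measurable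
  show "0 \<le> moment2 * sigma2" by (simp add: moment2_nonneg sigma2_nonneg)
  fix n :: nat assume n: "1 \<le> n"
  have "(\<Sum>i. \<integral>\<^sup>+\<omega>. ennreal ((norm (noise n \<omega> (e i)))\<^sup>2) \<partial>M)
      = (\<Sum>i. ennreal ((1 / real n)\<^sup>2) * ((\<Sum>j<n. \<integral>\<^sup>+\<omega>. ennreal ((X (int j) \<omega> \<bullet> e i)\<^sup>2) \<partial>M) * ennreal sigma2))"
  proof (rule suminf_cong)
    fix i
    have "(\<integral>\<^sup>+\<omega>. ennreal ((norm (noise n \<omega> (e i)))\<^sup>2) \<partial>M)
        = (\<integral>\<^sup>+\<omega>. ennreal ((1 / real n)\<^sup>2) * ennreal ((norm (\<Sum>j<n. (X (int j) \<omega> \<bullet> e i) *\<^sub>R \<epsilon> (int j + 1) \<omega>))\<^sup>2) \<partial>M)"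
      unfolding noise_def by (intro nn_integral_cong) (simp add: power_divide ennreal_mult[symmetric])
    also have "\<dots> = ennreal ((1 / real n)\<^sup>2) * ((\<Sum>j<n. \<integral>\<^sup>+\<omega>. ennreal ((X (int j) \<omega> \<bullet> e i)\<^sup>2) \<partial>M) * ennreal sigma2)"
      by (subst nn_integral_cmult) (measurable, simp only: second_moment_martingale)
    finally show "(\<integral>\<^sup>+\<omega>. ennreal ((norm (noise n \<omega> (e i)))\<^sup>2) \<partial>M)
      = ennreal ((1 / real n)\<^sup>2) * ((\<Sum>j<n. \<integral>\<^sup>+\<omega>. ennreal ((X (int j) \<omega> \<bullet> e i)\<^sup>2) \<partial>M) * ennreal sigma2)" .
  qed
  also have "\<dots> = ennreal ((1 / real n)\<^sup>2) * ((\<Sum>i. \<Sum>j<n. \<integral>\<^sup>+\<omega>. ennreal ((X (int j) \<omega> \<bullet> e i)\<^sup>2) \<partial>M) * ennreal sigma2)"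
    by simp
  also have "(\<Sum>i. \<Sum>j<n. \<integral>\<^sup>+\<omega>. ennreal ((X (int j) \<omega> \<bullet> e i)\<^sup>2) \<partial>M)
      = (\<Sum>j<n. \<integral>\<^sup>+\<omega>. (\<Sum>i. ennreal ((X (int j) \<omega> \<bullet> e i)\<^sup>2)) \<partial>M)"
    by (subst suminf_sum) (auto simp: nn_integral_suminf intro: summableI)
  also have "\<dots> \<le> (\<Sum>j<n. ennreal moment2)"
    by (intro sum_mono order_trans[OF nn_integral_mono[OF bessel[OF e]] nn_second_moment_X])
  also have "\<dots> = ennreal (real n * moment2)"
    by (simp add: ennreal_mult moment2_nonneg ennreal_of_nat_eq_real_of_nat)
  also have "ennreal ((1 / real n)\<^sup>2) * (ennreal (real n * moment2) * ennreal sigma2)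
      = ennreal ((1 / real n)\<^sup>2 * (real n * moment2 * sigma2))"
    by (simp add: ennreal_mult[symmetric] moment2_nonneg sigma2_nonneg)
  also have "(1 / real n)\<^sup>2 * (real n * moment2 * sigma2) = moment2 * sigma2 / real n"
    using n by (simp add: power2_eq_square)
  finally show "(\<Sum>i. \<integral>\<^sup>+\<omega>. ennreal ((norm (noise n \<omega> (e i)))\<^sup>2) \<partial>M) \<le> ennreal (moment2 * sigma2 / real n)"
    by (simp add: mult_left_mono mult_right_mono)
qed

lemma eps_cov_small:
  assumes e: "orthonormal_frame (e :: nat \<Rightarrow> 'a)" and s: "\<And>n. 0 < s n" and lim: "(\<lambda>n. 1 / (real n * (s n)\<^sup>2)) \<longlonglongrightarrow> 0"
  shows "with_high_prob M (\<lambda>n \<omega>. \<forall>y. norm (eps_cov_error n \<omega> y) \<le> s n * norm y)"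
proof (rule with_high_prob_operator_bound[where e=e and A=eps_cov_error and s=s
      and C="\<integral>x. norm x ^ 4 \<partial>F", OF e])
  show "bounded_linear (eps_cov_error n \<omega>)" for n \<omega> by (rule bounded_linear_eps_cov_error)
  show "0 < s n" for n by (rule s)
  show "(\<lambda>n. 1 / (real n * (s n)\<^sup>2)) \<longlonglongrightarrow> 0" by (rule lim)
  note [measurable_cong] = sets_F
  show "(\<lambda>\<omega>. eps_cov_error n \<omega> y) \<in> borel_measurable M" for n y unfolding eps_cov_error_def by measurable
  show "0 \<le> (\<integral>x. norm x ^ 4 \<partial>F)" by simp
  have m4: "integrable F (\<lambda>x. norm x ^ 4)" using moment_eps[of 0] integral_eps(2)[of "\<lambda>x. norm x ^ 4" 0] by simp
  have fb: "(norm ((x \<bullet> b) *\<^sub>R x))\<^sup>2 = (x \<bullet> b)\<^sup>2 * (norm x)\<^sup>2" for x b :: 'a by (simp add: power_mult_distrib)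
  have int: "integrable F (\<lambda>x. (norm ((x \<bullet> b) *\<^sub>R x))\<^sup>2)" for b
  proof (rule Bochner_Integration.integrable_bound)
    show "integrable F (\<lambda>x. (norm b)\<^sup>2 * norm x ^ 4)" using m4 by auto
    have "(x \<bullet> b)\<^sup>2 * (norm x)\<^sup>2 \<le> ((norm x)\<^sup>2 * (norm b)\<^sup>2) * (norm x)\<^sup>2" for x
      using Cauchy_Schwarz_ineq[of x b] by (intro mult_right_mono) (auto simp: power2_norm_eq_inner)
    then show "AE x in F. norm ((norm ((x \<bullet> b) *\<^sub>R x))\<^sup>2) \<le> norm ((norm b)\<^sup>2 * norm x ^ 4)"
      unfolding fb by (simp add: power4_eq_xxxx power2_eq_square mult_ac abs_mult)
  qed measurable
  fix n :: nat assume n: "1 \<le> n"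
  have one: "(\<integral>\<^sup>+\<omega>. ennreal ((norm (eps_cov_error n \<omega> b))\<^sup>2) \<partial>M)
      \<le> ennreal (1 / real n) * (\<integral>\<^sup>+x. ennreal ((x \<bullet> b)\<^sup>2) * ennreal ((norm x)\<^sup>2) \<partial>F)" for b
  proof -
    have "C\<^sub>\<epsilon> b = (\<integral>x. (x \<bullet> b) *\<^sub>R x \<partial>F)"
      unfolding cov_operator_def tensor_def by (rule integral_eps) measurable
    then have "(\<integral>\<^sup>+\<omega>. ennreal ((norm (eps_cov_error n \<omega> b))\<^sup>2) \<partial>M)
        \<le> ennreal ((1 / real n) * (\<integral>x. (norm ((x \<bullet> b) *\<^sub>R x))\<^sup>2 \<partial>F))"
      unfolding eps_cov_error_def using second_moment_iid_average[OF _ int n, of b] by simp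
    also have "\<dots> = ennreal (1 / real n) * ennreal (\<integral>x. (norm ((x \<bullet> b) *\<^sub>R x))\<^sup>2 \<partial>F)"
      by (intro ennreal_mult) auto
    also have "ennreal (\<integral>x. (norm ((x \<bullet> b) *\<^sub>R x))\<^sup>2 \<partial>F) = (\<integral>\<^sup>+x. ennreal ((norm ((x \<bullet> b) *\<^sub>R x))\<^sup>2) \<partial>F)"
      using int by (intro nn_integral_eq_integral[symmetric]) auto
    finally show ?thesis unfolding fb by (simp add: ennreal_mult)
  qed
  have "(\<Sum>i. \<integral>\<^sup>+\<omega>. ennreal ((norm (eps_cov_error n \<omega> (e i)))\<^sup>2) \<partial>M)
      \<le> (\<Sum>i. ennreal (1 / real n) * (\<integral>\<^sup>+x. ennreal ((x \<bullet> e i)\<^sup>2) * ennreal ((norm x)\<^sup>2) \<partial>F))"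
    by (intro suminf_le one summableI)
  also have "\<dots> = ennreal (1 / real n) * (\<integral>\<^sup>+x. (\<Sum>i. ennreal ((x \<bullet> e i)\<^sup>2)) * ennreal ((norm x)\<^sup>2) \<partial>F)"
    by (simp add: nn_integral_suminf[symmetric])
  also have "\<dots> \<le> ennreal (1 / real n) * (\<integral>\<^sup>+x. ennreal (norm x ^ 4) \<partial>F)"
  proof (intro mult_left_mono nn_integral_mono)
    fix x :: 'a
    have "(\<Sum>i. ennreal ((x \<bullet> e i)\<^sup>2)) * ennreal ((norm x)\<^sup>2) \<le> ennreal ((norm x)\<^sup>2) * ennreal ((norm x)\<^sup>2)"
      by (intro mult_right_mono bessel[OF e]) simp
    then show "(\<Sum>i. ennreal ((x \<bullet> e i)\<^sup>2)) * ennreal ((norm x)\<^sup>2) \<le> ennreal (norm x ^ 4)"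
      by (simp add: ennreal_mult[symmetric] power2_eq_square power4_eq_xxxx mult.assoc)
  qed simp
  also have "(\<integral>\<^sup>+x. ennreal (norm x ^ 4) \<partial>F) = ennreal (\<integral>x. norm x ^ 4 \<partial>F)"
    using m4 by (intro nn_integral_eq_integral) auto
  also have "ennreal (1 / real n) * ennreal (\<integral>x. norm x ^ 4 \<partial>F) = ennreal ((\<integral>x. norm x ^ 4 \<partial>F) / real n)"
    by (simp add: ennreal_mult[symmetric])
  finally show "(\<Sum>i. \<integral>\<^sup>+\<omega>. ennreal ((norm (eps_cov_error n \<omega> (e i)))\<^sup>2) \<partial>M) \<le> ennreal ((\<integral>x. norm x ^ 4 \<partial>F) / real n)" .
qed

lemma iid_average_close:
  fixes f :: "'a \<Rightarrow> 'b::{real_inner,banach,second_countable_topology}"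
  assumes f [measurable]: "f \<in> borel_measurable borel" and sq: "integrable F (\<lambda>x. (norm (f x))\<^sup>2)" and \<delta>: "0 < \<delta>"
  shows "with_high_prob M (\<lambda>n \<omega>. norm ((1 / real n) *\<^sub>R (\<Sum>j=1..n. f (\<epsilon> (int j) \<omega>)) - (\<integral>x. f x \<partial>F)) \<le> \<delta>)"
proof -
  have "with_high_prob M (\<lambda>n \<omega>. ennreal ((norm ((1 / real n) *\<^sub>R (\<Sum>j=1..n. f (\<epsilon> (int j) \<omega>)) - (\<integral>x. f x \<partial>F)))\<^sup>2) \<le> ennreal (\<delta>\<^sup>2))"
  proof (rule with_high_prob_markov)
    show "(\<lambda>n. (1 / real n) * (\<integral>x. (norm (f x))\<^sup>2 \<partial>F)) \<longlonglongrightarrow> 0"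
      by (intro tendsto_mult_left_zero lim_1_over_n)
    show "\<forall>\<^sub>F n in sequentially. (\<integral>\<^sup>+\<omega>. ennreal ((norm ((1 / real n) *\<^sub>R (\<Sum>j=1..n. f (\<epsilon> (int j) \<omega>)) - (\<integral>x. f x \<partial>F)))\<^sup>2) \<partial>M)
        \<le> ennreal ((1 / real n) * (\<integral>x. (norm (f x))\<^sup>2 \<partial>F))"
      using eventually_ge_at_top[of 1] by eventually_elim (rule second_moment_iid_average[OF f sq])
  qed (use \<delta> in \<open>auto\<close>)
  then show ?thesis
    by (rule with_high_prob_mono)
       (use \<delta> in \<open>auto simp: ennreal_le_iff dest: power2_le_imp_le[rotated]\<close>)
qed

lemma X_over_n_small:
  assumes s: "\<And>n. 0 < s n" and lim: "(\<lambda>n. 1 / (real n * s n)) \<longlonglongrightarrow> 0"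
  shows "with_high_prob M (\<lambda>n \<omega>. (norm (X (t n) \<omega>))\<^sup>2 / real n \<le> s n)"
proof -
  have "with_high_prob M (\<lambda>n \<omega>. ennreal (1 / (real n * s n)) * ennreal ((norm (X (t n) \<omega>))\<^sup>2) \<le> ennreal 1)"
  proof (rule with_high_prob_markov)
    show "(\<lambda>n. (1 / (real n * s n)) * moment2) \<longlonglongrightarrow> 0" by (intro tendsto_mult_left_zero lim)
    have "(\<integral>\<^sup>+\<omega>. ennreal (1 / (real n * s n)) * ennreal ((norm (X (t n) \<omega>))\<^sup>2) \<partial>M)
        \<le> ennreal (1 / (real n * s n)) * ennreal moment2" for n
      by (subst nn_integral_cmult) (auto intro!: mult_left_mono nn_second_moment_X)
    also have "ennreal (1 / (real n * s n)) * ennreal moment2 = ennreal ((1 / (real n * s n)) * moment2)" for n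
      using s[of n] moment2_nonneg by (simp add: ennreal_mult[symmetric])
    finally show "\<forall>\<^sub>F n in sequentially. (\<integral>\<^sup>+\<omega>. ennreal (1 / (real n * s n)) * ennreal ((norm (X (t n) \<omega>))\<^sup>2) \<partial>M)
        \<le> ennreal ((1 / (real n * s n)) * moment2)" by simp
  qed auto
  then show ?thesis
  proof (rule with_high_prob_mono, intro always_eventually allI ballI impI)
    fix n \<omega> assume "ennreal (1 / (real n * s n)) * ennreal ((norm (X (t n) \<omega>))\<^sup>2) \<le> ennreal 1"
    then have "ennreal (1 / (real n * s n) * (norm (X (t n) \<omega>))\<^sup>2) \<le> ennreal 1"
      using s[of n] by (subst ennreal_mult) (auto simp: less_imp_le)
    then have "1 / (real n * s n) * (norm (X (t n) \<omega>))\<^sup>2 \<le> 1" by (simp only: ennreal_le_iff zero_le_one)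
    then show "(norm (X (t n) \<omega>))\<^sup>2 / real n \<le> s n"
      using s[of n] by (cases "n = 0") (auto simp: field_simps)
  qed
qed

text \<open>\<open>X 1 = \<Psi> (X 0) + \<epsilon> 1\<close> has the same law as \<open>X 0\<close>, and \<open>X 0\<close> is uncorrelated with \<open>\<epsilon> 1\<close>.\<close>

lemma Gamma_stationarity:
  assumes adj: "\<And>x y. \<Psi> x \<bullet> y = x \<bullet> \<Psi>' y"
  shows "\<Gamma> y \<bullet> z = \<Gamma> (\<Psi>' y) \<bullet> \<Psi>' z + C\<^sub>\<epsilon> y \<bullet> z"
proof -
  have cross: "expectation (\<lambda>\<omega>. (X 0 \<omega> \<bullet> a) * (\<epsilon> 1 \<omega> \<bullet> b)) = 0"
    and crossI: "integrable M (\<lambda>\<omega>. (X 0 \<omega> \<bullet> a) * (\<epsilon> 1 \<omega> \<bullet> b))" for a b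
  proof -
    let ?U = "\<lambda>\<omega>. restrict (\<lambda>i. \<epsilon> i \<omega>) {..0}" and ?U' = "\<lambda>\<omega>. restrict (\<lambda>i. \<epsilon> i \<omega>) {0<..}"
    have m1: "(\<lambda>z. causal_solution \<Psi> z 0 \<bullet> a) \<in> borel_measurable (PiM {..0} (\<lambda>_. borel))"
      using measurable_causal_solution[of 0 0 \<Psi>] by simp
    have m2: "(\<lambda>z. z 1 \<bullet> b) \<in> borel_measurable (PiM {(0::int)<..} (\<lambda>_. borel))"
    proof -
      have "(\<lambda>z. z 1) \<in> borel_measurable (PiM {(0::int)<..} (\<lambda>_. borel :: 'a measure))"
        by (intro measurable_component_singleton) auto
      then show ?thesis by (rule borel_measurable_inner) simp
    qed
    have ind: "indep_var borel (\<lambda>\<omega>. causal_solution \<Psi> (\<lambda>i. \<epsilon> i \<omega>) 0 \<bullet> a) borel (\<lambda>\<omega>. \<epsilon> 1 \<omega> \<bullet> b)"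
      using indep_var_compose[OF indep_past m1 m2] by (simp add: o_def causal_solution_restrict)
    have ae: "AE \<omega> in M. X 0 \<omega> \<bullet> a = causal_solution \<Psi> (\<lambda>i. \<epsilon> i \<omega>) 0 \<bullet> a"
      using AE_causal by eventually_elim simp
    have m: "(\<lambda>\<omega>. causal_solution \<Psi> (\<lambda>i. \<epsilon> i \<omega>) 0 \<bullet> a) \<in> borel_measurable M"
      unfolding causal_solution_def by measurable
    have i1: "integrable M (\<lambda>\<omega>. causal_solution \<Psi> (\<lambda>i. \<epsilon> i \<omega>) 0 \<bullet> a)"
      using integrable_X[of 0] by (subst integrable_cong_AE[OF m _ AE_symmetric[OF ae]]) auto
    have i2: "integrable M (\<lambda>\<omega>. \<epsilon> 1 \<omega> \<bullet> b)" "expectation (\<lambda>\<omega>. \<epsilon> 1 \<omega> \<bullet> b) = 0" using mean_eps[of 1] by auto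
    have ae2: "AE \<omega> in M. (X 0 \<omega> \<bullet> a) * (\<epsilon> 1 \<omega> \<bullet> b) = (causal_solution \<Psi> (\<lambda>i. \<epsilon> i \<omega>) 0 \<bullet> a) * (\<epsilon> 1 \<omega> \<bullet> b)"
      using ae by eventually_elim simp
    show "expectation (\<lambda>\<omega>. (X 0 \<omega> \<bullet> a) * (\<epsilon> 1 \<omega> \<bullet> b)) = 0"
      using indep_var_lebesgue_integral[OF ind i1 i2(1)] i2(2) m by (subst integral_cong_AE[OF _ _ ae2]) auto
    show "integrable M (\<lambda>\<omega>. (X 0 \<omega> \<bullet> a) * (\<epsilon> 1 \<omega> \<bullet> b))"
      using indep_var_integrable[OF ind i1 i2(1)] m by (subst integrable_cong_AE[OF _ _ ae2]) auto
  qed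
  note I = integrable_inner_inner[OF X_measurable integrable_X_sq] integrable_inner_inner[OF eps_measurable integrable_eps_sq]
  have "\<Gamma> y \<bullet> z = (\<integral>\<omega>. (X 0 \<omega> \<bullet> y) * (X 0 \<omega> \<bullet> z) \<partial>M)"
    by (intro cov_operator_inner integrable_X_sq) measurable
  also have "\<dots> = (\<integral>x. (x \<bullet> y) * (x \<bullet> z) \<partial>distr M borel (X 0))" by (subst integral_distr) auto
  also have "\<dots> = (\<integral>\<omega>. (X 1 \<omega> \<bullet> y) * (X 1 \<omega> \<bullet> z) \<partial>M)"
    by (subst distr_X[of 1, symmetric], subst integral_distr) auto
  also have "\<dots> = (\<integral>\<omega>. (X 0 \<omega> \<bullet> \<Psi>' y) * (X 0 \<omega> \<bullet> \<Psi>' z) + (X 0 \<omega> \<bullet> \<Psi>' y) * (\<epsilon> 1 \<omega> \<bullet> z)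
      + (X 0 \<omega> \<bullet> \<Psi>' z) * (\<epsilon> 1 \<omega> \<bullet> y) + (\<epsilon> 1 \<omega> \<bullet> y) * (\<epsilon> 1 \<omega> \<bullet> z) \<partial>M)"
  proof (rule integral_cong_AE)
    show "AE \<omega> in M. (X 1 \<omega> \<bullet> y) * (X 1 \<omega> \<bullet> z) = (X 0 \<omega> \<bullet> \<Psi>' y) * (X 0 \<omega> \<bullet> \<Psi>' z) + (X 0 \<omega> \<bullet> \<Psi>' y) * (\<epsilon> 1 \<omega> \<bullet> z)
      + (X 0 \<omega> \<bullet> \<Psi>' z) * (\<epsilon> 1 \<omega> \<bullet> y) + (\<epsilon> 1 \<omega> \<bullet> y) * (\<epsilon> 1 \<omega> \<bullet> z)"
      using AE_path
    proof eventually_elim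
      case (elim \<omega>)
      have "X 1 \<omega> = \<Psi> (X 0 \<omega>) + \<epsilon> 1 \<omega>" using elim[rule_format, of 0] by simp
      then show ?case by (simp add: inner_add_left adj algebra_simps)
    qed
  qed measurable
  also have "\<dots> = (\<integral>\<omega>. (X 0 \<omega> \<bullet> \<Psi>' y) * (X 0 \<omega> \<bullet> \<Psi>' z) \<partial>M) + (\<integral>\<omega>. (\<epsilon> 1 \<omega> \<bullet> y) * (\<epsilon> 1 \<omega> \<bullet> z) \<partial>M)"
    using I crossI by (simp add: cross)
  also have "(\<integral>\<omega>. (X 0 \<omega> \<bullet> \<Psi>' y) * (X 0 \<omega> \<bullet> \<Psi>' z) \<partial>M) = \<Gamma> (\<Psi>' y) \<bullet> \<Psi>' z"
    by (intro cov_operator_inner[symmetric] integrable_X_sq) measurable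
  also have "(\<integral>\<omega>. (\<epsilon> 1 \<omega> \<bullet> y) * (\<epsilon> 1 \<omega> \<bullet> z) \<partial>M) = (\<integral>\<omega>. (\<epsilon> 0 \<omega> \<bullet> y) * (\<epsilon> 0 \<omega> \<bullet> z) \<partial>M)"
    by (simp only: integral_eps(1)[of "\<lambda>x. (x \<bullet> y) * (x \<bullet> z)"] borel_measurable_times borel_measurable_inner
        borel_measurable_const measurable_ident_sets[OF refl])
  also have "\<dots> = C\<^sub>\<epsilon> y \<bullet> z"
    by (intro cov_operator_inner[symmetric] integrable_eps_sq) measurable
  finally show ?thesis .
qed

lemma emp_cov_sample:
  "emp_cov n (sample X n \<omega>) y = (1 / real n) *\<^sub>R (\<Sum>j<n. (X (int j) \<omega> \<bullet> y) *\<^sub>R X (int j) \<omega>)"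
  unfolding emp_cov_def tensor_def sample_def by (intro arg_cong[where f="\<lambda>x. _ *\<^sub>R x"] sum.cong) auto

lemma emp_cross_cov_sample:
  assumes path: "\<forall>t. X (t + 1) \<omega> = \<Psi> (X t \<omega>) + \<epsilon> (t + 1) \<omega>"
  shows "emp_cross_cov n (sample X n \<omega>) y - \<Psi> (emp_cov n (sample X n \<omega>) y) = noise n \<omega> y"
proof -
  have "emp_cross_cov n (sample X n \<omega>) y = (1 / real n) *\<^sub>R (\<Sum>j<n. (X (int j) \<omega> \<bullet> y) *\<^sub>R X (int j + 1) \<omega>)"
    unfolding emp_cross_cov_def tensor_def sample_def
    by (intro arg_cong[where f="\<lambda>x. _ *\<^sub>R x"] sum.cong) (auto simp: add.commute)
  also have "\<dots> = (1 / real n) *\<^sub>R (\<Sum>j<n. (X (int j) \<omega> \<bullet> y) *\<^sub>R \<Psi> (X (int j) \<omega>)) + noise n \<omega> y"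
    unfolding noise_def by (simp add: path scaleR_add_right sum.distrib)
  also have "(1 / real n) *\<^sub>R (\<Sum>j<n. (X (int j) \<omega> \<bullet> y) *\<^sub>R \<Psi> (X (int j) \<omega>)) = \<Psi> (emp_cov n (sample X n \<omega>) y)"
    by (simp add: emp_cov_sample blinfun.scaleR_right blinfun.sum_right)
  finally show ?thesis by simp
qed

text \<open>With \<open>\<Psi>'\<close> the adjoint of \<open>\<Psi>\<close>, the products \<open>(X (j + 1) \<bullet> y) (X (j + 1) \<bullet> z)\<close> are expressed by those of \<open>X j\<close> with
\<open>\<Psi>' y\<close> and \<open>\<Psi>' z\<close>. Averaging, and subtracting the corresponding identity for \<open>\<Gamma>\<close>, shows that the error
\<open>D\<close> equals \<open>\<Psi> D \<Psi>'\<close> up to noise, the error for the innovations, and boundary terms. Since \<open>\<Psi>\<close> is a contraction, \<open>D\<close> is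
bounded by these. No covariances between products at different times have to be estimated.\<close>

lemma emp_cov_recursion:
  assumes path: "\<forall>t. X (t + 1) \<omega> = \<Psi> (X t \<omega>) + \<epsilon> (t + 1) \<omega>" and n: "1 \<le> n"
    and r: "\<And>y. norm (noise n \<omega> y) \<le> r * norm y" and c: "\<And>y. norm (eps_cov_error n \<omega> y) \<le> c * norm y"
  shows "norm (emp_cov n (sample X n \<omega>) y - \<Gamma> y)
    \<le> (2 * r + c + ((norm (X 0 \<omega>))\<^sup>2 / real n + (norm (X (int n) \<omega>))\<^sup>2 / real n)) / (1 - norm \<Psi>) * norm y"
proof -
  obtain \<Psi>' where adj: "\<And>x y. \<Psi> x \<bullet> y = x \<bullet> \<Psi>' y" and \<Psi>': "\<And>y. norm (\<Psi>' y) \<le> norm \<Psi> * norm y"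
    using adjoint_exists[of \<Psi>] by blast
  let ?A = "emp_cov n (sample X n \<omega>)"
  let ?D = "\<lambda>y. ?A y - \<Gamma> y"
  define b where "b = (norm (X 0 \<omega>))\<^sup>2 / real n + (norm (X (int n) \<omega>))\<^sup>2 / real n"
  define d where "d = onorm ?D"
  have D: "bounded_linear ?D" by (intro bounded_linear_sub bounded_linear_emp_cov bounded_linear_Gamma)
  have d0: "0 \<le> d" unfolding d_def by (rule onorm_pos_le[OF D])
  have Dd: "norm (?D y) \<le> d * norm y" for y unfolding d_def by (rule onorm[OF D])
  define g where "g y z t = (X t \<omega> \<bullet> y) * (X t \<omega> \<bullet> z)" for y z t
  have inner: "?A y \<bullet> z = (1 / real n) * (\<Sum>j<n. g y z (int j))" for y z
    by (simp add: emp_cov_sample inner_sum_left g_def)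
  have id: "?D y \<bullet> z = ?D (\<Psi>' y) \<bullet> \<Psi>' z + noise n \<omega> (\<Psi>' y) \<bullet> z + noise n \<omega> (\<Psi>' z) \<bullet> y
      + eps_cov_error n \<omega> y \<bullet> z + (1 / real n) * (g y z 0 - g y z (int n))" for y z
  proof -
    have step: "g y z (int j + 1) = g (\<Psi>' y) (\<Psi>' z) (int j) + (X (int j) \<omega> \<bullet> \<Psi>' y) * (\<epsilon> (int j + 1) \<omega> \<bullet> z)
        + (X (int j) \<omega> \<bullet> \<Psi>' z) * (\<epsilon> (int j + 1) \<omega> \<bullet> y) + (\<epsilon> (int j + 1) \<omega> \<bullet> y) * (\<epsilon> (int j + 1) \<omega> \<bullet> z)" for j
      by (simp only: g_def path[rule_format]) (simp add: inner_add_left adj algebra_simps)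
    have tele: "(\<Sum>j<n. g y z (int j + 1)) = (\<Sum>j<n. g y z (int j)) + g y z (int n) - g y z 0"
      using sum_lessThan_telescope[of "\<lambda>j. g y z (int j)" n] by (simp add: sum_subtractf add.commute)
    have shift: "(\<Sum>j=Suc 0..n. (\<epsilon> (int j) \<omega> \<bullet> y) * (\<epsilon> (int j) \<omega> \<bullet> z))
        = (\<Sum>j<n. (\<epsilon> (int j + 1) \<omega> \<bullet> y) * (\<epsilon> (int j + 1) \<omega> \<bullet> z))"
      by (rule sum.reindex_bij_witness[of _ Suc "\<lambda>j. j - 1"]) (auto simp: add.commute)
    have "noise n \<omega> (\<Psi>' y) \<bullet> z + noise n \<omega> (\<Psi>' z) \<bullet> y + (eps_cov_error n \<omega> y + C\<^sub>\<epsilon> y) \<bullet> z + ?A (\<Psi>' y) \<bullet> \<Psi>' z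
      = (1 / real n) * (\<Sum>j<n. g y z (int j + 1))"
      unfolding step inner noise_def eps_cov_error_def
      by (simp add: inner_sum_left inner_add_left sum.distrib distrib_left shift add_divide_distrib)
    also have "\<dots> = ?A y \<bullet> z - (1 / real n) * (g y z 0 - g y z (int n))"
      unfolding tele inner by (simp add: algebra_simps diff_divide_distrib add_divide_distrib)
    finally show ?thesis
      using Gamma_stationarity[OF adj, of y z] by (simp add: inner_diff_left inner_add_left)
  qed
  define \<rho> where "\<rho> = norm \<Psi>"
  have \<rho>: "0 \<le> \<rho>" "\<rho> < 1" using norm_Psi by (auto simp: \<rho>_def)
  have nonneg: "0 \<le> r" "0 \<le> c" if ex: "\<exists>y::'a. y \<noteq> 0"
  proof -
    obtain y :: 'a where "y \<noteq> 0" using ex by blast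
    then have y: "0 < norm y" by simp
    have "0 \<le> r * norm y" "0 \<le> c * norm y"
      by (rule order_trans[OF norm_ge_zero r], rule order_trans[OF norm_ge_zero c])
    with y show "0 \<le> r" "0 \<le> c" by (auto simp: zero_le_mult_iff)
  qed
  show ?thesis
  proof (cases "\<exists>y::'a. y \<noteq> 0")
    case False
    then have "y = 0" "?D y = 0" by metis+
    then show ?thesis by simp
  next
    case True
    note r0 = nonneg[OF True]
    let ?B = "\<rho> * d + 2 * r + c + b"
    have bil: "\<bar>?D y \<bullet> z\<bar> \<le> ?B * norm y * norm z" for y z
    proof -
      have \<Psi>1: "norm (\<Psi>' y) \<le> norm y" for y
        using order_trans[OF \<Psi>'[of y] mult_right_mono[of "norm \<Psi>" 1 "norm y"]] norm_Psi by simp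
      have 1: "\<bar>?D (\<Psi>' y) \<bullet> \<Psi>' z\<bar> \<le> \<rho> * d * norm y * norm z"
      proof -
        have "\<bar>?D (\<Psi>' y) \<bullet> \<Psi>' z\<bar> \<le> norm (?D (\<Psi>' y)) * norm (\<Psi>' z)" by (rule Cauchy_Schwarz_ineq2)
        also have "\<dots> \<le> (d * (\<rho> * norm y)) * norm z"
          using order_trans[OF Dd mult_left_mono[OF \<Psi>' d0]] \<Psi>1 d0 \<rho> by (intro mult_mono) (auto simp: \<rho>_def)
        finally show ?thesis by (simp add: mult_ac)
      qed
      have 2: "\<bar>noise n \<omega> (\<Psi>' y) \<bullet> z\<bar> \<le> r * norm y * norm z" for y z
        using order_trans[OF Cauchy_Schwarz_ineq2 mult_right_mono[OF order_trans[OF r mult_left_mono[OF \<Psi>1 r0(1)]], of "norm z"]]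
        by simp
      have 3: "\<bar>eps_cov_error n \<omega> y \<bullet> z\<bar> \<le> c * norm y * norm z"
        using order_trans[OF Cauchy_Schwarz_ineq2 mult_right_mono[OF c, of "norm z"]] by simp
      have g: "\<bar>g y z t\<bar> \<le> (norm (X t \<omega>))\<^sup>2 * (norm y * norm z)" for t
      proof -
        have "\<bar>g y z t\<bar> \<le> (norm (X t \<omega>) * norm y) * (norm (X t \<omega>) * norm z)"
          unfolding g_def abs_mult by (intro mult_mono Cauchy_Schwarz_ineq2) auto
        then show ?thesis by (simp add: power2_eq_square mult_ac)
      qed
      have 4: "\<bar>(1 / real n) * (g y z 0 - g y z (int n))\<bar> \<le> b * norm y * norm z"
      proof -
        have "\<bar>g y z 0 - g y z (int n)\<bar> \<le> ((norm (X 0 \<omega>))\<^sup>2 + (norm (X (int n) \<omega>))\<^sup>2) * (norm y * norm z)"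
          using g[of 0] g[of "int n"] by (simp add: distrib_right)
        then have "(1 / real n) * \<bar>g y z 0 - g y z (int n)\<bar>
            \<le> (1 / real n) * (((norm (X 0 \<omega>))\<^sup>2 + (norm (X (int n) \<omega>))\<^sup>2) * (norm y * norm z))"
          by (intro mult_left_mono) auto
        then show ?thesis by (simp add: b_def abs_mult add_divide_distrib distrib_right)
      qed
      have "\<bar>?D y \<bullet> z\<bar> \<le> \<bar>?D (\<Psi>' y) \<bullet> \<Psi>' z\<bar> + \<bar>noise n \<omega> (\<Psi>' y) \<bullet> z\<bar> + \<bar>noise n \<omega> (\<Psi>' z) \<bullet> y\<bar>
          + \<bar>eps_cov_error n \<omega> y \<bullet> z\<bar> + \<bar>(1 / real n) * (g y z 0 - g y z (int n))\<bar>"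
        unfolding id[of y z] by linarith
      also have "\<dots> \<le> \<rho> * d * norm y * norm z + r * norm y * norm z + r * norm z * norm y
          + c * norm y * norm z + b * norm y * norm z"
        by (intro add_mono 1 2 3 4)
      also have "\<dots> = ?B * norm y * norm z" by (simp add: algebra_simps)
      finally show ?thesis .
    qed
    have B0: "0 \<le> ?B" using \<rho> d0 r0 by (simp add: b_def)
    have Dle: "norm (?D y) \<le> ?B * norm y" for y
    proof (cases "?D y = 0")
      case False
      have "norm (?D y) * norm (?D y) \<le> ?B * norm y * norm (?D y)"
        using bil[of y "?D y"] by (simp add: power2_norm_eq_inner[symmetric] power2_eq_square)
      then show ?thesis using False by simp
    qed (use B0 in simp)
    have "onorm ?D \<le> ?B" by (rule onorm_bound[OF B0 Dle])
    then have "d \<le> ?B" unfolding d_def[symmetric] .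
    then have "d * (1 - \<rho>) \<le> 2 * r + c + b" by (simp add: algebra_simps)
    then have "d \<le> (2 * r + c + b) / (1 - \<rho>)" using \<rho> by (simp add: pos_le_divide_eq)
    then show ?thesis unfolding b_def \<rho>_def by (rule order_trans[OF Dd mult_right_mono]) simp
  qed
qed

end

section \<open>Coupling the process with its bootstrap version\<close>

lemma sum_boot_path:
  assumes "linear T"
  shows "(\<Sum>t<Suc m. boot_path T x e t) = x + T (\<Sum>t<m. boot_path T x e t) + (\<Sum>t\<in>{1..m}. e t)"
proof (induction m)
  case (Suc m)
  interpret linear T by fact
  have "(\<Sum>t<Suc (Suc m). boot_path T x e t) = (\<Sum>t<Suc m. boot_path T x e t) + (T (boot_path T x e m) + e (Suc m))"
    by simp
  also have "\<dots> = x + (T (\<Sum>t<m. boot_path T x e t) + T (boot_path T x e m)) + ((\<Sum>t\<in>{1..m}. e t) + e (Suc m))"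
    unfolding Suc.IH by (simp only: add_ac)
  also have "T (\<Sum>t<m. boot_path T x e t) + T (boot_path T x e m) = T (\<Sum>t<Suc m. boot_path T x e t)"
    by (simp add: add)
  finally show ?case by simp
qed (use assms in \<open>simp add: linear_0\<close>)

lemma boot_path_cong: "(\<And>i. 1 \<le> i \<Longrightarrow> i \<le> t \<Longrightarrow> e i = e' i) \<Longrightarrow> boot_path T x e t = boot_path T x e' t"
  by (induction t) auto

lemma measurable_boot_path:
  fixes T :: "'a::{real_normed_vector,second_countable_topology} \<Rightarrow> 'a"
  assumes T: "bounded_linear T" and g [measurable]: "g \<in> borel_measurable N"
    and h: "\<And>i. i \<in> {1..n} \<Longrightarrow> (\<lambda>w. h w i) \<in> borel_measurable N" and "t \<le> n"
  shows "(\<lambda>w. boot_path T (g w) (h w) t) \<in> borel_measurable N"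
  using \<open>t \<le> n\<close>
proof (induction t)
  case (Suc t)
  have [measurable]: "T \<in> borel_measurable borel"
    using T by (intro borel_measurable_continuous_onI linear_continuous_on)
  have [measurable]: "(\<lambda>w. boot_path T (g w) (h w) t) \<in> borel_measurable N" "(\<lambda>w. h w (Suc t)) \<in> borel_measurable N"
    using Suc h by auto
  show ?case unfolding boot_path.simps by measurable
qed simp

text \<open>\<open>sum_boot_path\<close> turns the recursion for the paths into one for their partial sums, and
\<open>S\<close> is replaced by \<open>T\<close> at the expense of \<open>\<tau>\<close>.\<close>

lemma boot_path_difference:
  fixes T S :: "'a::real_normed_vector \<Rightarrow> 'a"
  assumes T: "linear T" and S: "linear S"
    and \<kappa>: "\<And>y. norm (T y) \<le> \<kappa> * norm y" and \<tau>: "\<And>y. norm (T y - S y) \<le> \<tau> * norm y"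
  shows "norm ((\<Sum>t<Suc m. boot_path S x e t) - (\<Sum>t<Suc m. boot_path T x' e' t))
    \<le> \<kappa> * norm ((\<Sum>t<m. boot_path S x e t) - (\<Sum>t<m. boot_path T x' e' t))
      + (norm (x - x') + \<tau> * norm (\<Sum>t<m. boot_path S x e t) + norm (\<Sum>t\<in>{1..m}. e t - e' t))"
proof -
  let ?s = "\<Sum>t<m. boot_path S x e t" and ?s' = "\<Sum>t<m. boot_path T x' e' t"
  have eq: "(\<Sum>t<Suc m. boot_path S x e t) - (\<Sum>t<Suc m. boot_path T x' e' t)
      = T (?s - ?s') + (x - x') - (T ?s - S ?s) + (\<Sum>t\<in>{1..m}. e t - e' t)"
    unfolding sum_boot_path[OF T] sum_boot_path[OF S] by (simp add: linear_diff[OF T] sum_subtractf)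
  show ?thesis
    unfolding eq
    using norm_triangle_ineq[of "T (?s - ?s') + (x - x') - (T ?s - S ?s)" "\<Sum>t\<in>{1..m}. e t - e' t"]
      norm_triangle_ineq4[of "T (?s - ?s') + (x - x')" "T ?s - S ?s"] norm_triangle_ineq[of "T (?s - ?s')" "x - x'"]
      \<kappa>[of "?s - ?s'"] \<tau>[of ?s]
    by linarith
qed

lemma square_sum3_le: "(a + b + c)\<^sup>2 \<le> 3 * (a\<^sup>2 + b\<^sup>2 + (c::real)\<^sup>2)"
proof -
  have "0 \<le> (a - b)\<^sup>2 + (a - c)\<^sup>2 + (b - c)\<^sup>2" by simp
  then show ?thesis by (simp add: power2_eq_square algebra_simps)
qed

lemma square_sum2_le: "(a + b)\<^sup>2 \<le> 2 * (a\<^sup>2 + (b::real)\<^sup>2)"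
proof -
  have "0 \<le> (a - b)\<^sup>2" by simp
  then show ?thesis by (simp add: power2_eq_square algebra_simps)
qed

lemma measurable_PiM_coordinate_compose:
  assumes "i \<in> I" "f \<in> Q \<rightarrow>\<^sub>M L"
  shows "(\<lambda>w. f (w i)) \<in> PiM I (\<lambda>_. Q) \<rightarrow>\<^sub>M L"
  using measurable_component_singleton[OF assms(1), of "\<lambda>_. Q"] assms(2) by (rule measurable_compose)

lemma indep_vars_PiM_coordinates:
  assumes Q: "prob_space Q" and I: "I \<noteq> {}"
  shows "prob_space.indep_vars (PiM I (\<lambda>_. Q)) (\<lambda>_. Q) (\<lambda>i w. w i) I"
proof -
  interpret P: prob_space "PiM I (\<lambda>_. Q)" by (rule prob_space_PiM) (rule Q)
  have "distr (PiM I (\<lambda>_. Q)) (PiM I (\<lambda>_. Q)) (\<lambda>w. \<lambda>i\<in>I. w i) = distr (PiM I (\<lambda>_. Q)) (PiM I (\<lambda>_. Q)) (\<lambda>w. w)"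
    by (intro distr_cong) (auto simp: space_PiM PiE_restrict)
  also have "\<dots> = PiM I (\<lambda>_. Q)" by (rule distr_id2) simp
  also have "\<dots> = PiM I (\<lambda>i. distr (PiM I (\<lambda>_. Q)) Q (\<lambda>w. w i))"
    by (intro PiM_cong refl distr_PiM_component[symmetric] Q)
  finally show ?thesis using I by (subst P.indep_vars_iff_distr_eq_PiM') auto
qed

lemma second_moment_PiM_sum:
  fixes f :: "'c \<Rightarrow> 'b::{real_inner,banach,second_countable_topology}"
  assumes Q: "prob_space Q" and f [measurable]: "f \<in> borel_measurable Q"
    and mean: "integrable Q f" "integral\<^sup>L Q f = 0" and q: "(\<integral>\<^sup>+x. ennreal ((norm (f x))\<^sup>2) \<partial>Q) \<le> ennreal q" "0 \<le> q"
    and J: "J \<subseteq> {1..n}"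
  shows "(\<integral>\<^sup>+w. ennreal ((norm (\<Sum>t\<in>J. f (w t)))\<^sup>2) \<partial>PiM {1..n::nat} (\<lambda>_. Q)) \<le> ennreal (real n * q)"
proof (cases "n = 0")
  case True
  then show ?thesis using J by simp
next
  case False
  let ?P = "PiM {1..n} (\<lambda>_. Q)"
  interpret P: prob_space ?P by (rule prob_space_PiM) (rule Q)
  have ind: "P.indep_vars (\<lambda>_. borel) (\<lambda>t w. f (w t)) {1..n}"
    using False by (intro P.indep_vars_compose2[OF indep_vars_PiM_coordinates[OF Q]]) auto
  have D: "distr ?P Q (\<lambda>w. w t) = Q" if "t \<in> {1..n}" for t using Q that by (intro distr_PiM_component) auto
  have mt [measurable]: "(\<lambda>w. w t) \<in> ?P \<rightarrow>\<^sub>M Q" if "t \<in> {1..n}" for t using that by (rule measurable_component_singleton)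
  have sq: "integrable Q (\<lambda>x. (norm (f x))\<^sup>2)"
    by (rule integrableI_bounded) (auto simp: le_less_trans[OF q(1) ennreal_less_top])
  have fin: "finite J" using J finite_subset by blast
  have "(\<integral>\<^sup>+w. ennreal ((norm (\<Sum>t\<in>J. f (w t)))\<^sup>2) \<partial>?P) = (\<Sum>t\<in>J. \<integral>\<^sup>+w. ennreal ((norm (f (w t)))\<^sup>2) \<partial>?P)"
  proof (rule P.second_moment_indep_sum[OF ind fin J])
    fix t assume "t \<in> J"
    then have t: "t \<in> {1..n}" using J by blast
    note mt' = mt[OF t]
    show "integrable ?P (\<lambda>w. f (w t))"
      using integrable_distr_eq[OF mt', of f] mean(1) f unfolding D[OF t] by simp
    show "P.expectation (\<lambda>w. f (w t)) = 0"
      using integral_distr[OF mt', of f] mean(2) f unfolding D[OF t] by simp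
    show "integrable ?P (\<lambda>w. (norm (f (w t)))\<^sup>2)"
      using integrable_distr_eq[OF mt', of "\<lambda>x. (norm (f x))\<^sup>2"] sq unfolding D[OF t] by simp
  qed
  also have "\<dots> = (\<Sum>t\<in>J. \<integral>\<^sup>+x. ennreal ((norm (f x))\<^sup>2) \<partial>Q)"
  proof (rule sum.cong[OF refl])
    fix t assume "t \<in> J"
    then have t: "t \<in> {1..n}" using J by blast
    show "(\<integral>\<^sup>+w. ennreal ((norm (f (w t)))\<^sup>2) \<partial>?P) = (\<integral>\<^sup>+x. ennreal ((norm (f x))\<^sup>2) \<partial>Q)"
      using nn_integral_distr[OF mt[OF t], of "\<lambda>x. ennreal ((norm (f x))\<^sup>2)"] unfolding D[OF t] by simp
  qed
  also have "\<dots> \<le> (\<Sum>t\<in>{1..n}. ennreal q)"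
    using J by (intro order_trans[OF sum_mono sum_mono2]) (auto intro: q)
  also have "\<dots> = ennreal (real n * q)" using q(2) by (simp add: ennreal_mult ennreal_of_nat_eq_real_of_nat)
  finally show ?thesis .
qed

lemma integral_uniform_count_measure:
  fixes z :: "nat \<Rightarrow> 'a::{banach,second_countable_topology}"
  assumes "finite A"
  shows "integral\<^sup>L (uniform_count_measure A) z = (1 / real (card A)) *\<^sub>R (\<Sum>i\<in>A. z i)"
    and "integrable (uniform_count_measure A) z"
  unfolding uniform_count_measure_def using assms
  by (auto simp: lebesgue_integral_point_measure_finite scaleR_sum_right integrable_point_measure_finite)

context far1_model
begin

definition D0 :: "'a measure" where "D0 = distr M borel (X 0)"

lemma prob_space_D0: "prob_space D0" and sets_D0: "sets D0 = sets borel"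
  unfolding D0_def by (auto intro: prob_space_distr)

lemma second_moment_D0: "(\<integral>\<^sup>+y. ennreal ((norm y)\<^sup>2) \<partial>D0) \<le> ennreal moment2"
  unfolding D0_def using nn_second_moment_X[of 0] by (subst nn_integral_distr) auto

lemma second_moment_F: "(\<integral>\<^sup>+x. ennreal ((norm x)\<^sup>2) \<partial>F) = ennreal sigma2"
  using nn_integral_eps[of "\<lambda>x. ennreal ((norm x)\<^sup>2)" 0] nn_second_moment_eps[of 0] by simp

text \<open>\<open>X 0\<close> is a function of the innovations up to time \<open>0\<close>.\<close>

lemma law_initial_and_innovations:
  assumes n: "1 \<le> n"
  shows "distr M (borel \<Otimes>\<^sub>M PiM {1..n} (\<lambda>_. borel)) (\<lambda>\<omega>. (X 0 \<omega>, \<lambda>j\<in>{1..n}. \<epsilon> (int j) \<omega>))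
    = D0 \<Otimes>\<^sub>M PiM {1..n} (\<lambda>_. F)"
proof -
  let ?U = "\<lambda>\<omega>. restrict (\<lambda>i. \<epsilon> i \<omega>) {..0}" and ?U' = "\<lambda>\<omega>. restrict (\<lambda>i. \<epsilon> i \<omega>) {0<..}"
  let ?A = "PiM {..0::int} (\<lambda>_. borel :: 'a measure)" and ?B = "PiM {0::int<..} (\<lambda>_. borel :: 'a measure)"
  let ?C = "PiM {1..n} (\<lambda>_. borel :: 'a measure)"
  let ?g = "\<lambda>z. causal_solution \<Psi> z 0" and ?h = "\<lambda>z::int \<Rightarrow> 'a. \<lambda>j\<in>{1..n}. z (int j)"
  have eq: "distr M ?A ?U \<Otimes>\<^sub>M distr M ?B ?U' = distr M (?A \<Otimes>\<^sub>M ?B) (\<lambda>\<omega>. (?U \<omega>, ?U' \<omega>))"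
    and U: "?U \<in> M \<rightarrow>\<^sub>M ?A" and U': "?U' \<in> M \<rightarrow>\<^sub>M ?B"
    using indep_past[of 0] by (auto simp: indep_var_distribution_eq)
  have g: "?g \<in> ?A \<rightarrow>\<^sub>M borel" by (rule measurable_causal_solution) simp
  have h: "?h \<in> ?B \<rightarrow>\<^sub>M ?C" by (intro measurable_restrict measurable_component_singleton) auto
  have hU': "?h (?U' \<omega>) = (\<lambda>j\<in>{1..n}. \<epsilon> (int j) \<omega>)" for \<omega> by (auto simp: fun_eq_iff)
  have gU: "AE \<omega> in M. ?g (?U \<omega>) = X 0 \<omega>"
    using AE_causal by eventually_elim (simp add: causal_solution_restrict)
  have gUm: "(\<lambda>\<omega>. ?g (?U \<omega>)) \<in> M \<rightarrow>\<^sub>M borel" using measurable_comp[OF U g] by (simp add: o_def)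
  have DA: "distr (distr M ?A ?U) borel ?g = D0"
    unfolding D0_def by (subst distr_distr[OF g U], rule distr_cong_AE) (use gU gUm in \<open>auto simp: o_def\<close>)
  have DB: "distr (distr M ?B ?U') ?C ?h = PiM {1..n} (\<lambda>_. F)"
  proof -
    have "distr (distr M ?B ?U') ?C ?h = distr M ?C (\<lambda>\<omega>. \<lambda>j\<in>{1..n}. \<epsilon> (int j) \<omega>)"
      unfolding distr_distr[OF h U'] o_def hU' ..
    also have "\<dots> = PiM {1..n} (\<lambda>j. distr M borel (\<epsilon> (int j)))"
      using indep_eps_nat[of "{1..n}"] n by (subst (asm) indep_vars_iff_distr_eq_PiM') auto
    finally show ?thesis by (simp add: distr_eps)
  qed
  have "sigma_finite_measure (distr (distr M ?B ?U') ?C ?h)"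
    unfolding DB by (intro prob_space_imp_sigma_finite prob_space_PiM prob_space_F)
  moreover have "?g \<in> distr M ?A ?U \<rightarrow>\<^sub>M borel" "?h \<in> distr M ?B ?U' \<rightarrow>\<^sub>M ?C" using g h by simp_all
  ultimately
  have "D0 \<Otimes>\<^sub>M PiM {1..n} (\<lambda>_. F) = distr (distr M ?A ?U \<Otimes>\<^sub>M distr M ?B ?U') (borel \<Otimes>\<^sub>M ?C) (\<lambda>(x, y). (?g x, ?h y))"
    using pair_measure_distr[of ?g "distr M ?A ?U" borel ?h "distr M ?B ?U'" ?C] unfolding DA DB by blast
  also have "\<dots> = distr M (borel \<Otimes>\<^sub>M ?C) (\<lambda>\<omega>. (?g (?U \<omega>), ?h (?U' \<omega>)))"
    unfolding eq by (subst distr_distr) (use g h U U' in \<open>auto simp: o_def\<close>)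
  also have "\<dots> = distr M (borel \<Otimes>\<^sub>M ?C) (\<lambda>\<omega>. (X 0 \<omega>, \<lambda>j\<in>{1..n}. \<epsilon> (int j) \<omega>))"
  proof (rule distr_cong_AE)
    show "AE \<omega> in M. (?g (?U \<omega>), ?h (?U' \<omega>)) = (X 0 \<omega>, \<lambda>j\<in>{1..n}. \<epsilon> (int j) \<omega>)"
      using gU by eventually_elim (simp only: hU')
    show "(\<lambda>\<omega>. (?g (?U \<omega>), ?h (?U' \<omega>))) \<in> M \<rightarrow>\<^sub>M borel \<Otimes>\<^sub>M ?C"
      using gUm measurable_comp[OF U' h] by (intro measurable_Pair) (simp_all add: o_def)
    show "(\<lambda>\<omega>. (X 0 \<omega>, \<lambda>j\<in>{1..n}. \<epsilon> (int j) \<omega>)) \<in> M \<rightarrow>\<^sub>M borel \<Otimes>\<^sub>M ?C"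
      by (intro measurable_Pair measurable_restrict) auto
  qed (rule refl)+
  finally show ?thesis by simp
qed

definition path_mean :: "nat \<Rightarrow> ('a \<Rightarrow> 'a) \<Rightarrow> 'a \<Rightarrow> (nat \<Rightarrow> 'a) \<Rightarrow> 'a"
  where "path_mean n T x e = (1 / real n) *\<^sub>R (\<Sum>t<n. boot_path T x e t)"

lemma path_mean_restrict: "path_mean n T x (restrict e {1..n}) = path_mean n T x e"
  unfolding path_mean_def by (intro arg_cong[where f="\<lambda>s. _ *\<^sub>R s"] sum.cong boot_path_cong) auto

lemma measurable_path_mean:
  assumes T: "bounded_linear T" and g: "g \<in> borel_measurable N"
    and h: "\<And>i. i \<in> {1..n} \<Longrightarrow> (\<lambda>w. h w i) \<in> borel_measurable N"
  shows "(\<lambda>w. path_mean n T (g w) (h w)) \<in> borel_measurable N"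
  unfolding path_mean_def
  by (intro borel_measurable_scaleR borel_measurable_const borel_measurable_sum measurable_boot_path[OF T g h]) auto

lemma mean_distr_eq:
  assumes n: "1 \<le> n"
  shows "mean_distr M X n = distr (D0 \<Otimes>\<^sub>M PiM {1..n} (\<lambda>_. F)) borel (\<lambda>(y, e). path_mean n \<Psi> y e)"
proof -
  let ?C = "PiM {1..n} (\<lambda>_. borel :: 'a measure)"
  have m: "(\<lambda>(y, e). path_mean n \<Psi> y e) \<in> borel_measurable (borel \<Otimes>\<^sub>M ?C)"
    unfolding split_beta'
    by (intro measurable_path_mean blinfun.bounded_linear_right measurable_fst
        measurable_compose[OF measurable_snd measurable_component_singleton])
  have jm: "(\<lambda>\<omega>. (X 0 \<omega>, \<lambda>j\<in>{1..n}. \<epsilon> (int j) \<omega>)) \<in> M \<rightarrow>\<^sub>M borel \<Otimes>\<^sub>M ?C"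
    by (intro measurable_Pair measurable_restrict) auto
  have "distr (D0 \<Otimes>\<^sub>M PiM {1..n} (\<lambda>_. F)) borel (\<lambda>(y, e). path_mean n \<Psi> y e)
      = distr M borel (\<lambda>\<omega>. path_mean n \<Psi> (X 0 \<omega>) (\<lambda>j\<in>{1..n}. \<epsilon> (int j) \<omega>))"
    unfolding law_initial_and_innovations[OF n, symmetric] by (subst distr_distr[OF m jm]) (simp add: o_def)
  also have "\<dots> = mean_distr M X n"
    unfolding mean_distr_def
  proof (rule distr_cong_AE)
    show "AE \<omega> in M. path_mean n \<Psi> (X 0 \<omega>) (\<lambda>j\<in>{1..n}. \<epsilon> (int j) \<omega>) = (1 / real n) *\<^sub>R (\<Sum>t<n. X (int t) \<omega>)"
      using AE_path
    proof eventually_elim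
      case (elim \<omega>)
      have "boot_path \<Psi> (X 0 \<omega>) (\<lambda>j. \<epsilon> (int j) \<omega>) t = X (int t) \<omega>" for t
      proof (induction t)
        case (Suc t)
        then show ?case using elim[rule_format, of "int t"] by (simp add: add.commute)
      qed simp
      then show ?case unfolding path_mean_restrict by (simp add: path_mean_def)
    qed
    show "(\<lambda>\<omega>. path_mean n \<Psi> (X 0 \<omega>) (\<lambda>j\<in>{1..n}. \<epsilon> (int j) \<omega>)) \<in> borel_measurable M"
      using measurable_comp[OF jm m] by (simp add: o_def)
  qed auto
  finally show ?thesis by simp
qed

lemma distr_pair_PiM_compose:
  fixes G :: "'a measure"
  assumes Q: "prob_space Q" and G: "prob_space G" "sets G = sets borel"
    and f: "f \<in> Q \<rightarrow>\<^sub>M borel" "distr Q borel f = G"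
  shows "distr (D0 \<Otimes>\<^sub>M PiM {1..n::nat} (\<lambda>_. Q)) (borel \<Otimes>\<^sub>M PiM {1..n} (\<lambda>_. borel)) (\<lambda>(y, w). (y, compose {1..n} f w))
    = D0 \<Otimes>\<^sub>M PiM {1..n} (\<lambda>_. G)"
proof -
  have fG: "f \<in> Q \<rightarrow>\<^sub>M G" using f(1) G(2) by (simp cong: measurable_cong_sets)
  have "distr Q G f = distr Q borel f" using G(2) by (intro distr_cong) auto
  then have fQ: "distr (PiM {1..n} (\<lambda>_. Q)) (PiM {1..n} (\<lambda>_. G)) (compose {1..n} f) = PiM {1..n} (\<lambda>_. G)"
    using f(2) Q G(1) fG by (subst distr_PiM_finite_prob_space') auto
  have mc: "compose {1..n} f \<in> PiM {1..n} (\<lambda>_. Q) \<rightarrow>\<^sub>M PiM {1..n} (\<lambda>_. G)"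
    unfolding compose_def
    by (intro measurable_restrict measurable_PiM_coordinate_compose fG)
  have id: "distr D0 D0 (\<lambda>x. x) = D0" by (rule distr_id2) simp
  have "sigma_finite_measure (distr (PiM {1..n} (\<lambda>_. Q)) (PiM {1..n} (\<lambda>_. G)) (compose {1..n} f))"
    unfolding fQ using G(1) by (intro prob_space_imp_sigma_finite prob_space_PiM)
  from pair_measure_distr[OF measurable_ident_sets[OF refl] mc this, of D0]
  have "D0 \<Otimes>\<^sub>M PiM {1..n} (\<lambda>_. G) = distr (D0 \<Otimes>\<^sub>M PiM {1..n} (\<lambda>_. Q)) (D0 \<Otimes>\<^sub>M PiM {1..n} (\<lambda>_. G))
      (\<lambda>(y, w). (y, compose {1..n} f w))"
    unfolding fQ id .
  also have "\<dots> = distr (D0 \<Otimes>\<^sub>M PiM {1..n} (\<lambda>_. Q)) (borel \<Otimes>\<^sub>M PiM {1..n} (\<lambda>_. borel))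
      (\<lambda>(y, w). (y, compose {1..n} f w))"
    using G(2) sets_D0 by (intro distr_cong sets_pair_measure_cong sets_PiM_cong) auto
  finally show ?thesis by simp
qed

text \<open>The coupling of the two means is realised on the product of the law of \<open>X 0\<close> with \<open>n\<close> copies of \<open>Q\<close>. In the
three parts of the bound, the first comes from the initial values, the second from the difference of the
operators applied to partial sums whose second moment is of order \<open>n\<close>, and the third from the sum of the
independent centred differences of innovations.\<close>

lemma bootstrap_mean_distance:
  fixes T :: "'a \<Rightarrow> 'a"
  assumes T: "bounded_linear T" and \<kappa>: "\<And>y. norm (T y) \<le> \<kappa> * norm y" "0 \<le> \<kappa>" "\<kappa> < 1"
    and \<tau>: "\<And>y. norm (T y - \<Psi> y) \<le> \<tau> * norm y" "0 \<le> \<tau>" and n: "1 \<le> n"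
    and G: "residual_distr n T x = G"
    and Qc: "Q \<in> couplings F G" and q: "(\<integral>\<^sup>+w. ennreal ((norm (fst w - snd w))\<^sup>2) \<partial>Q) \<le> ennreal q" "0 \<le> q"
  shows "of_nat n * mallows_dist_sq (mean_distr M X n) (boot_mean_distr n T x0 x)
    \<le> ennreal (3 / (1 - \<kappa>)\<^sup>2 * (2 * (moment2 + (norm x0)\<^sup>2) / real n
        + \<tau>\<^sup>2 * (2 * (moment2 + sigma2) / (1 - norm \<Psi>)\<^sup>2) + q))"
proof -
  let ?I = "{1..n}" and ?U = "uniform_count_measure {1..n}"
  define z where "z = centered_residual n T x"
  have Gz: "G = distr ?U borel z" using G by (simp add: residual_distr_def z_def)
  have mU: "f \<in> ?U \<rightarrow>\<^sub>M borel" for f :: "nat \<Rightarrow> 'b::topological_space"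
    by (simp add: measurable_def space_uniform_count_measure sets_uniform_count_measure)
  have "prob_space ?U" using n by (intro prob_space_uniform_count_measure) auto
  then have G': "prob_space G" "sets G = sets borel"
    unfolding Gz by (auto intro!: prob_space.prob_space_distr mU)
  have z0: "(\<Sum>i\<in>?I. z i) = 0"
    using n by (simp add: z_def centered_residual_def sum_subtractf sum_constant_scaleR)
  have Q: "prob_space Q" and sQ: "sets Q = sets (borel \<Otimes>\<^sub>M borel)"
    and Q1: "distr Q borel fst = F" and Q2: "distr Q borel snd = G"
    using Qc by (auto simp: couplings_def)
  interpret Q: prob_space Q by fact
  note [measurable_cong] = sQ
  have f1 [measurable]: "fst \<in> Q \<rightarrow>\<^sub>M borel" and f2 [measurable]: "snd \<in> Q \<rightarrow>\<^sub>M borel"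
    using measurable_fst[of borel borel] measurable_snd[of borel borel] by (simp_all cong: measurable_cong_sets add: sQ)
  have F0: "integrable F (\<lambda>x. x)" "(\<integral>x. x \<partial>F) = 0"
    using integral_eps[of "\<lambda>x. x" 0] mean_eps[of 0] by auto
  have idb: "(\<lambda>x::'a. x) \<in> borel_measurable borel" by simp
  have Qf: "integrable Q fst" "integral\<^sup>L Q fst = 0"
    using F0 unfolding Q1[symmetric] integrable_distr_eq[OF f1 idb] integral_distr[OF f1 idb] by simp_all
  have Gi: "integrable G (\<lambda>x. x)" "(\<integral>x. x \<partial>G) = 0"
    unfolding Gz integrable_distr_eq[OF mU idb] integral_distr[OF mU idb]
    by (simp_all add: integral_uniform_count_measure z0[simplified])
  have Qs: "integrable Q snd" "integral\<^sup>L Q snd = 0"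
    using Gi unfolding Q2[symmetric] integrable_distr_eq[OF f2 idb] integral_distr[OF f2 idb] by simp_all
  have Qf2: "(\<integral>\<^sup>+w. ennreal ((norm (fst w))\<^sup>2) \<partial>Q) \<le> ennreal sigma2"
  proof -
    have "(\<integral>\<^sup>+w. ennreal ((norm (fst w))\<^sup>2) \<partial>Q) = (\<integral>\<^sup>+x. ennreal ((norm x)\<^sup>2) \<partial>distr Q borel fst)"
      by (subst nn_integral_distr[OF f1]) auto
    then show ?thesis unfolding Q1 second_moment_F by simp
  qed
  let ?P = "PiM ?I (\<lambda>_. Q)"
  interpret P: prob_space ?P by (rule prob_space_PiM) (rule Q)
  interpret D0: prob_space D0 by (rule prob_space_D0)
  interpret PD: pair_prob_space D0 ?P ..
  define N where "N = D0 \<Otimes>\<^sub>M ?P"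
  have sN: "sets N = sets (borel \<Otimes>\<^sub>M ?P)"
    unfolding N_def using sets_D0 by (intro sets_pair_measure_cong) auto
  have fstN [measurable]: "fst \<in> N \<rightarrow>\<^sub>M borel" and sndN [measurable]: "snd \<in> N \<rightarrow>\<^sub>M ?P"
    using measurable_fst[of borel ?P] measurable_snd[of borel ?P] by (simp_all cong: measurable_cong_sets add: sN)
  have coord [measurable]: "(\<lambda>v. snd v i) \<in> N \<rightarrow>\<^sub>M Q" if "i \<in> ?I" for i
    using that by (intro measurable_compose[OF sndN measurable_component_singleton])
  have c1: "(\<lambda>v. fst (snd v i)) \<in> borel_measurable N" and c2: "(\<lambda>v. snd (snd v i)) \<in> borel_measurable N" if "i \<in> ?I" for i
    using measurable_compose[OF coord[OF that] f1] measurable_compose[OF coord[OF that] f2] by auto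
  have intsnd: "(\<integral>\<^sup>+v. g (snd v) \<partial>N) = (\<integral>\<^sup>+w. g w \<partial>?P)" if "g \<in> borel_measurable ?P" for g
    unfolding N_def using that by (subst P.nn_integral_fst[symmetric]) (auto simp: D0.emeasure_space_1)
  have intfst: "(\<integral>\<^sup>+v. g (fst v) \<partial>N) = (\<integral>\<^sup>+y. g y \<partial>D0)" if "g \<in> borel_measurable borel" for g
  proof -
    have [measurable]: "g \<in> borel_measurable D0" using that by (simp cong: measurable_cong_sets add: sets_D0)
    show ?thesis unfolding N_def by (subst P.nn_integral_fst[symmetric]) (auto simp: P.emeasure_space_1[simplified])
  qed
  let ?e = "\<lambda>(v :: 'a \<times> (nat \<Rightarrow> 'a \<times> 'a)) i. fst (snd v i)"
    and ?e' = "\<lambda>(v :: 'a \<times> (nat \<Rightarrow> 'a \<times> 'a)) i. snd (snd v i)"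
  let ?s = "\<lambda>m v. \<Sum>t<m. boot_path \<Psi> (fst v) (?e v) t" and ?s' = "\<lambda>m v. \<Sum>t<m. boot_path T x0 (?e' v) t"
  let ?E = "\<lambda>m v. \<Sum>t\<in>{1..m}. ?e v t - ?e' v t"
  have bp: "(\<lambda>v. boot_path \<Psi> (fst v) (?e v) t) \<in> borel_measurable N" if "t \<le> n" for t
    using that c1 by (intro measurable_boot_path[where n=n] blinfun.bounded_linear_right) auto
  have bp': "(\<lambda>v. boot_path T x0 (?e' v) t) \<in> borel_measurable N" if "t \<le> n" for t
    using that c2 by (intro measurable_boot_path[where n=n] T) auto
  have sm: "?s m \<in> borel_measurable N" "?s' m \<in> borel_measurable N" if "m \<le> n" for m
    using that bp bp' by (auto intro!: borel_measurable_sum)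
  have Em: "?E m \<in> borel_measurable N" "(\<lambda>v. \<Sum>t\<in>{1..m}. ?e v t) \<in> borel_measurable N" if "m \<le> n" for m
    using that c1 c2 by (auto intro!: borel_measurable_sum borel_measurable_diff)
  have sqe: "(\<integral>\<^sup>+v. ennreal ((norm (\<Sum>t\<in>{1..m}. ?e v t))\<^sup>2) \<partial>N) \<le> ennreal (real n * sigma2)" if "m \<le> n" for m
  proof -
    have "(\<integral>\<^sup>+v. ennreal ((norm (\<Sum>t\<in>{1..m}. ?e v t))\<^sup>2) \<partial>N) = (\<integral>\<^sup>+w. ennreal ((norm (\<Sum>t\<in>{1..m}. fst (w t)))\<^sup>2) \<partial>?P)"
    proof (rule intsnd)
      have "(\<lambda>w. fst (w i)) \<in> borel_measurable ?P" if "i \<in> {1..m}" for i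
        using that \<open>m \<le> n\<close> by (intro measurable_PiM_coordinate_compose f1) auto
      then have [measurable]: "(\<lambda>w. \<Sum>t\<in>{1..m}. fst (w t)) \<in> borel_measurable ?P"
        by (intro borel_measurable_sum)
      show "(\<lambda>w. ennreal ((norm (\<Sum>t\<in>{1..m}. fst (w t)))\<^sup>2)) \<in> borel_measurable ?P" by measurable
    qed
    also have "\<dots> \<le> ennreal (real n * sigma2)"
      using that by (intro second_moment_PiM_sum Q Qf Qf2 f1 sigma2_nonneg) auto
    finally show ?thesis .
  qed
  have sqE: "(\<integral>\<^sup>+v. ennreal ((norm (?E m v))\<^sup>2) \<partial>N) \<le> ennreal (real n * q)" if "m \<le> n" for m
  proof -
    have "(\<integral>\<^sup>+v. ennreal ((norm (?E m v))\<^sup>2) \<partial>N) = (\<integral>\<^sup>+w. ennreal ((norm (\<Sum>t\<in>{1..m}. fst (w t) - snd (w t)))\<^sup>2) \<partial>?P)"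
    proof (rule intsnd)
      have "(\<lambda>w. fst (w i) - snd (w i)) \<in> borel_measurable ?P" if "i \<in> {1..m}" for i
        using that \<open>m \<le> n\<close>
        by (intro borel_measurable_diff measurable_PiM_coordinate_compose f1 f2) auto
      then have [measurable]: "(\<lambda>w. \<Sum>t\<in>{1..m}. fst (w t) - snd (w t)) \<in> borel_measurable ?P"
        by (intro borel_measurable_sum)
      show "(\<lambda>w. ennreal ((norm (\<Sum>t\<in>{1..m}. fst (w t) - snd (w t)))\<^sup>2)) \<in> borel_measurable ?P" by measurable
    qed
    also have "\<dots> \<le> ennreal (real n * q)"
      using that Qf Qs by (intro second_moment_PiM_sum[where f="\<lambda>w. fst w - snd w"] Q q) auto
    finally show ?thesis .
  qed
  have sq0: "(\<integral>\<^sup>+v. ennreal ((norm (fst v))\<^sup>2) \<partial>N) \<le> ennreal moment2"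
    using second_moment_D0 intfst[of "\<lambda>y. ennreal ((norm y)\<^sup>2)"] by simp
  define \<rho> where "\<rho> = norm \<Psi>"
  define CS where "CS = 2 * (moment2 + sigma2) / (1 - \<rho>)\<^sup>2"
  have CS0: "0 \<le> CS" by (simp add: CS_def moment2_nonneg sigma2_nonneg)
  have sqS: "(\<integral>\<^sup>+v. ennreal ((norm (?s m v))\<^sup>2) \<partial>N) \<le> ennreal (real n * CS)" if "m \<le> n" for m
  proof -
    have "(\<integral>\<^sup>+v. ennreal ((norm (?s m v))\<^sup>2) \<partial>N) \<le> ennreal (2 * (moment2 + real n * sigma2) / (1 - \<rho>)\<^sup>2)"
    proof (rule contraction_second_moment[where n=n and D="?s" and W="\<lambda>m v. norm (fst v) + norm (\<Sum>t\<in>{1..m}. ?e v t)"])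
      show "0 \<le> \<rho>" "\<rho> < 1" using norm_Psi by (auto simp: \<rho>_def)
      show "0 \<le> 2 * (moment2 + real n * sigma2)" by (simp add: moment2_nonneg sigma2_nonneg)
      fix m assume m: "m < n"
      show "(\<lambda>v. norm (fst v) + norm (\<Sum>t\<in>{1..m}. ?e v t)) \<in> borel_measurable N"
        using Em(2)[of m] m by (intro borel_measurable_add borel_measurable_norm) auto
      show "norm (?s (Suc m) v) \<le> \<rho> * norm (?s m v) + (norm (fst v) + norm (\<Sum>t\<in>{1..m}. ?e v t))"
        for v :: "'a \<times> (nat \<Rightarrow> 'a \<times> 'a)"
        unfolding sum_boot_path[OF bounded_linear.linear[OF blinfun.bounded_linear_right]] \<rho>_def
        using norm_blinfun[of \<Psi> "?s m v"] norm_triangle_ineq[of "fst v + \<Psi> (?s m v)" "\<Sum>t\<in>{1..m}. ?e v t"]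
          norm_triangle_ineq[of "fst v" "\<Psi> (?s m v)"] by linarith
      have "(\<integral>\<^sup>+v. ennreal ((norm (fst v) + norm (\<Sum>t\<in>{1..m}. ?e v t))\<^sup>2) \<partial>N)
          \<le> (\<integral>\<^sup>+v. 2 * (ennreal ((norm (fst v))\<^sup>2) + ennreal ((norm (\<Sum>t\<in>{1..m}. ?e v t))\<^sup>2)) \<partial>N)"
      proof (intro nn_integral_mono)
        fix v :: "'a \<times> (nat \<Rightarrow> 'a \<times> 'a)"
        have "ennreal ((norm (fst v) + norm (\<Sum>t\<in>{1..m}. ?e v t))\<^sup>2)
            \<le> ennreal (2 * ((norm (fst v))\<^sup>2 + (norm (\<Sum>t\<in>{1..m}. ?e v t))\<^sup>2))"
          by (intro ennreal_leI square_sum2_le)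
        also have "\<dots> = ennreal 2 * ennreal ((norm (fst v))\<^sup>2 + (norm (\<Sum>t\<in>{1..m}. ?e v t))\<^sup>2)"
          by (rule ennreal_mult) auto
        finally show "ennreal ((norm (fst v) + norm (\<Sum>t\<in>{1..m}. ?e v t))\<^sup>2)
            \<le> 2 * (ennreal ((norm (fst v))\<^sup>2) + ennreal ((norm (\<Sum>t\<in>{1..m}. ?e v t))\<^sup>2))" by simp
      qed
      also have "\<dots> = 2 * ((\<integral>\<^sup>+v. ennreal ((norm (fst v))\<^sup>2) \<partial>N) + (\<integral>\<^sup>+v. ennreal ((norm (\<Sum>t\<in>{1..m}. ?e v t))\<^sup>2) \<partial>N))"
        using Em(2)[of m] m by (subst nn_integral_cmult, simp, subst nn_integral_add) auto
      also have "\<dots> \<le> 2 * (ennreal moment2 + ennreal (real n * sigma2))"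
        using m by (intro mult_left_mono add_mono sq0 sqe) auto
      also have "\<dots> = ennreal 2 * ennreal (moment2 + real n * sigma2)"
        by (simp add: moment2_nonneg sigma2_nonneg)
      also have "\<dots> = ennreal (2 * (moment2 + real n * sigma2))"
        by (rule ennreal_mult[symmetric]) (auto simp: moment2_nonneg sigma2_nonneg)
      finally show "(\<integral>\<^sup>+v. ennreal ((norm (fst v) + norm (\<Sum>t\<in>{1..m}. ?e v t))\<^sup>2) \<partial>N)
          \<le> ennreal (2 * (moment2 + real n * sigma2))" .
    qed (use sm that in auto)
    also have "2 * (moment2 + real n * sigma2) / (1 - \<rho>)\<^sup>2 \<le> real n * CS"
    proof -
      have "moment2 \<le> real n * moment2" using n moment2_nonneg by (simp add: mult_le_cancel_right1)
      then have "2 * (moment2 + real n * sigma2) / (1 - \<rho>)\<^sup>2 \<le> real n * (2 * (moment2 + sigma2)) / (1 - \<rho>)\<^sup>2"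
        by (intro divide_right_mono) (auto simp: algebra_simps)
      then show ?thesis by (simp add: CS_def)
    qed
    finally show ?thesis by (simp add: ennreal_leI)
  qed
  \<comment> \<open>Bound for the second moment of the inhomogeneous part of the recursion for the difference.\<close>
  define u where "u = 3 * (2 * (moment2 + (norm x0)\<^sup>2) + \<tau>\<^sup>2 * (real n * CS) + real n * q)"
  have u0: "0 \<le> u" using CS0 q(2) by (simp add: u_def moment2_nonneg)
  have sqD: "(\<integral>\<^sup>+v. ennreal ((norm (?s n v - ?s' n v))\<^sup>2) \<partial>N) \<le> ennreal (u / (1 - \<kappa>)\<^sup>2)"
  proof (rule contraction_second_moment[where n=n and m=n and D="\<lambda>m v. ?s m v - ?s' m v"
        and W="\<lambda>m v. norm (fst v - x0) + \<tau> * norm (?s m v) + norm (?E m v)"])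
    fix m assume m: "m < n"
    have [measurable]: "?s m \<in> borel_measurable N" "?E m \<in> borel_measurable N" using sm Em m by auto
    show "(\<lambda>v. norm (fst v - x0) + \<tau> * norm (?s m v) + norm (?E m v)) \<in> borel_measurable N" by measurable
    show "norm (?s (Suc m) v - ?s' (Suc m) v) \<le> \<kappa> * norm (?s m v - ?s' m v)
        + (norm (fst v - x0) + \<tau> * norm (?s m v) + norm (?E m v))"
      for v :: "'a \<times> (nat \<Rightarrow> 'a \<times> 'a)"
      by (intro boot_path_difference bounded_linear.linear[OF T] \<kappa>(1) \<tau>(1)
          bounded_linear.linear[OF blinfun.bounded_linear_right])
    have "(\<integral>\<^sup>+v. ennreal ((norm (fst v - x0) + \<tau> * norm (?s m v) + norm (?E m v))\<^sup>2) \<partial>N)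
        \<le> (\<integral>\<^sup>+v. 3 * (2 * (ennreal ((norm (fst v))\<^sup>2) + ennreal ((norm x0)\<^sup>2))
            + ennreal (\<tau>\<^sup>2) * ennreal ((norm (?s m v))\<^sup>2) + ennreal ((norm (?E m v))\<^sup>2)) \<partial>N)"
    proof (intro nn_integral_mono)
      fix v :: "'a \<times> (nat \<Rightarrow> 'a \<times> 'a)"
      have "(norm (fst v - x0))\<^sup>2 \<le> (norm (fst v) + norm x0)\<^sup>2"
        by (intro power_mono norm_triangle_ineq4) simp
      also have "\<dots> \<le> 2 * ((norm (fst v))\<^sup>2 + (norm x0)\<^sup>2)" by (rule square_sum2_le)
      finally have "(norm (fst v - x0) + \<tau> * norm (?s m v) + norm (?E m v))\<^sup>2
          \<le> 3 * (2 * ((norm (fst v))\<^sup>2 + (norm x0)\<^sup>2) + \<tau>\<^sup>2 * (norm (?s m v))\<^sup>2 + (norm (?E m v))\<^sup>2)"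
        using square_sum3_le[of "norm (fst v - x0)" "\<tau> * norm (?s m v)" "norm (?E m v)"]
        by (simp add: power_mult_distrib)
      then have "ennreal ((norm (fst v - x0) + \<tau> * norm (?s m v) + norm (?E m v))\<^sup>2)
          \<le> ennreal (3 * (2 * ((norm (fst v))\<^sup>2 + (norm x0)\<^sup>2) + \<tau>\<^sup>2 * (norm (?s m v))\<^sup>2 + (norm (?E m v))\<^sup>2))"
        by (rule ennreal_leI)
      also have "\<dots> = ennreal 3 * (ennreal 2 * (ennreal ((norm (fst v))\<^sup>2) + ennreal ((norm x0)\<^sup>2))
            + ennreal (\<tau>\<^sup>2) * ennreal ((norm (?s m v))\<^sup>2) + ennreal ((norm (?E m v))\<^sup>2))"
        by (simp only: ennreal_mult ennreal_plus zero_le_power2 add_nonneg_nonneg mult_nonneg_nonneg zero_le_numeral)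
      finally show "ennreal ((norm (fst v - x0) + \<tau> * norm (?s m v) + norm (?E m v))\<^sup>2)
          \<le> 3 * (2 * (ennreal ((norm (fst v))\<^sup>2) + ennreal ((norm x0)\<^sup>2))
            + ennreal (\<tau>\<^sup>2) * ennreal ((norm (?s m v))\<^sup>2) + ennreal ((norm (?E m v))\<^sup>2))" by simp
    qed
    also have "\<dots> = 3 * (2 * ((\<integral>\<^sup>+v. ennreal ((norm (fst v))\<^sup>2) \<partial>N) + ennreal ((norm x0)\<^sup>2))
            + ennreal (\<tau>\<^sup>2) * (\<integral>\<^sup>+v. ennreal ((norm (?s m v))\<^sup>2) \<partial>N) + (\<integral>\<^sup>+v. ennreal ((norm (?E m v))\<^sup>2) \<partial>N))"
    proof -
      have "emeasure N (space N) = 1" unfolding N_def by (rule PD.emeasure_space_1)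
      then have comb: "(\<integral>\<^sup>+v. 3 * (2 * (f v + c) + d * g v + h v) \<partial>N)
          = 3 * (2 * ((\<integral>\<^sup>+v. f v \<partial>N) + c) + d * (\<integral>\<^sup>+v. g v \<partial>N) + (\<integral>\<^sup>+v. h v \<partial>N))"
        if [measurable]: "f \<in> borel_measurable N" "g \<in> borel_measurable N" "h \<in> borel_measurable N"
        for f g h and c d :: ennreal
        by (simp add: nn_integral_cmult nn_integral_add)
      show ?thesis by (rule comb) measurable
    qed
    also have "\<dots> \<le> ennreal 3 * (ennreal 2 * (ennreal moment2 + ennreal ((norm x0)\<^sup>2))
            + ennreal (\<tau>\<^sup>2) * ennreal (real n * CS) + ennreal (real n * q))"
      using m by (simp only: ennreal_numeral) (intro mult_left_mono add_mono sq0 sqS sqE; simp)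
    also have "\<dots> = ennreal u"
      using moment2_nonneg CS0 q(2) unfolding u_def
      by (simp only: ennreal_mult ennreal_plus zero_le_power2 add_nonneg_nonneg mult_nonneg_nonneg zero_le_numeral of_nat_0_le_iff)
    finally show "(\<integral>\<^sup>+v. ennreal ((norm (fst v - x0) + \<tau> * norm (?s m v) + norm (?E m v))\<^sup>2) \<partial>N) \<le> ennreal u" .
  qed (use sm \<kappa> u0 in auto)
  define H where "H v = (path_mean n \<Psi> (fst v) (?e v), path_mean n T x0 (?e' v))" for v
  have H1: "(\<lambda>v. path_mean n \<Psi> (fst v) (?e v)) \<in> borel_measurable N"
    by (intro measurable_path_mean blinfun.bounded_linear_right fstN c1)
  have H2: "(\<lambda>v. path_mean n T x0 (?e' v)) \<in> borel_measurable N"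
    by (intro measurable_path_mean T borel_measurable_const c2)
  have Hm: "H \<in> N \<rightarrow>\<^sub>M borel \<Otimes>\<^sub>M borel" unfolding H_def by (intro measurable_Pair H1 H2)
  define R where "R = distr N (borel \<Otimes>\<^sub>M borel) H"
  have probN: "prob_space N" unfolding N_def by (rule PD.prob_space_axioms)
  have "R \<in> couplings (mean_distr M X n) (boot_mean_distr n T x0 x)"
    unfolding couplings_def
  proof (intro CollectI conjI)
    show "prob_space R" unfolding R_def by (rule prob_space.prob_space_distr[OF probN Hm])
    show "sets R = sets (borel \<Otimes>\<^sub>M borel)" by (simp add: R_def)
    have comp: "path_mean n S y (compose ?I f w) = path_mean n S y (\<lambda>i. f (w i))"
      for S y and f :: "'a \<times> 'a \<Rightarrow> 'a" and w
      unfolding compose_def by (rule path_mean_restrict)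
    have mp: "(\<lambda>v. path_mean n S (fst v) (snd v)) \<in> borel_measurable (borel \<Otimes>\<^sub>M PiM ?I (\<lambda>_. borel))"
      and mp': "(\<lambda>v. path_mean n S y (snd v)) \<in> borel_measurable (borel \<Otimes>\<^sub>M PiM ?I (\<lambda>_. borel))"
      if "bounded_linear S" for S y
      using that by (auto intro!: measurable_path_mean measurable_fst
          measurable_compose[OF measurable_snd measurable_component_singleton])
    have mc: "(\<lambda>(y, w). (y, compose ?I f w)) \<in> N \<rightarrow>\<^sub>M borel \<Otimes>\<^sub>M PiM ?I (\<lambda>_. borel)"
      if "f \<in> Q \<rightarrow>\<^sub>M borel" for f :: "'a \<times> 'a \<Rightarrow> 'a"
      unfolding split_beta' compose_def
      by (intro measurable_Pair fstN measurable_restrict measurable_compose[OF coord that])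
    have "distr R borel fst = distr N borel (\<lambda>v. path_mean n \<Psi> (fst v) (?e v))"
      unfolding R_def by (subst distr_distr[OF measurable_fst Hm]) (simp add: o_def H_def)
    also have "\<dots> = distr (distr N (borel \<Otimes>\<^sub>M PiM ?I (\<lambda>_. borel)) (\<lambda>(y, w). (y, compose ?I fst w))) borel
        (\<lambda>v. path_mean n \<Psi> (fst v) (snd v))"
      by (subst distr_distr[OF mp[OF blinfun.bounded_linear_right] mc[OF f1]]) (simp only: o_def split_beta' comp fst_conv snd_conv)
    also have "\<dots> = mean_distr M X n"
      unfolding N_def distr_pair_PiM_compose[OF Q prob_space_F sets_F f1 Q1] mean_distr_eq[OF n] by (simp add: split_beta')
    finally show "distr R borel fst = mean_distr M X n" .
    have "distr R borel snd = distr N borel (\<lambda>v. path_mean n T x0 (?e' v))"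
      unfolding R_def by (subst distr_distr[OF measurable_snd Hm]) (simp add: o_def H_def)
    also have "\<dots> = distr (distr N (borel \<Otimes>\<^sub>M PiM ?I (\<lambda>_. borel)) (\<lambda>(y, w). (y, compose ?I snd w))) borel
        (\<lambda>v. path_mean n T x0 (snd v))"
      by (subst distr_distr[OF mp'[OF T] mc[OF f2]]) (simp only: o_def split_beta' comp fst_conv snd_conv)
    also have "\<dots> = distr (D0 \<Otimes>\<^sub>M PiM ?I (\<lambda>_. G)) borel (\<lambda>v. path_mean n T x0 (snd v))"
      unfolding N_def distr_pair_PiM_compose[OF Q G' f2 Q2] ..
    also have "\<dots> = distr (PiM ?I (\<lambda>_. G)) borel (path_mean n T x0)"
    proof -
      interpret PG: prob_space "PiM ?I (\<lambda>_. G)" by (rule prob_space_PiM) (rule G'(1))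
      interpret PDG: pair_prob_space D0 "PiM ?I (\<lambda>_. G)" ..
      have m: "path_mean n T x0 \<in> borel_measurable (PiM ?I (\<lambda>_. G))"
      proof (rule measurable_path_mean[OF T borel_measurable_const])
        fix i assume "i \<in> ?I"
        then have "(\<lambda>w. w i) \<in> PiM ?I (\<lambda>_. G) \<rightarrow>\<^sub>M G" by (rule measurable_component_singleton)
        then show "(\<lambda>w. w i) \<in> borel_measurable (PiM ?I (\<lambda>_. G))" using G'(2) by (simp cong: measurable_cong_sets)
      qed
      have "distr (D0 \<Otimes>\<^sub>M PiM ?I (\<lambda>_. G)) (PiM ?I (\<lambda>_. G)) snd = PiM ?I (\<lambda>_. G)"
      proof (rule measure_eqI)
        fix A assume "A \<in> sets (distr (D0 \<Otimes>\<^sub>M PiM ?I (\<lambda>_. G)) (PiM ?I (\<lambda>_. G)) snd)"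
        then have A: "A \<in> sets (PiM ?I (\<lambda>_. G))" by simp
        have "snd -` A \<inter> space (D0 \<Otimes>\<^sub>M PiM ?I (\<lambda>_. G)) = space D0 \<times> A"
          using sets.sets_into_space[OF A] by (auto simp: space_pair_measure)
        then show "emeasure (distr (D0 \<Otimes>\<^sub>M PiM ?I (\<lambda>_. G)) (PiM ?I (\<lambda>_. G)) snd) A = emeasure (PiM ?I (\<lambda>_. G)) A"
          using A by (simp add: emeasure_distr PG.emeasure_pair_measure_Times[simplified] D0.emeasure_space_1)
      qed simp
      then have "distr (PiM ?I (\<lambda>_. G)) borel (path_mean n T x0)
          = distr (distr (D0 \<Otimes>\<^sub>M PiM ?I (\<lambda>_. G)) (PiM ?I (\<lambda>_. G)) snd) borel (path_mean n T x0)" by simp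
      also have "\<dots> = distr (D0 \<Otimes>\<^sub>M PiM ?I (\<lambda>_. G)) borel (\<lambda>v. path_mean n T x0 (snd v))"
        by (subst distr_distr[OF m measurable_snd]) (simp add: o_def)
      finally show ?thesis by simp
    qed
    also have "\<dots> = boot_mean_distr n T x0 x"
      unfolding boot_mean_distr_def G path_mean_def[abs_def] ..
    finally show "distr R borel snd = boot_mean_distr n T x0 x" .
  qed
  then have "mallows_dist_sq (mean_distr M X n) (boot_mean_distr n T x0 x)
      \<le> (\<integral>\<^sup>+p. ennreal ((norm (fst p - snd p))\<^sup>2) \<partial>R)"
    unfolding mallows_dist_sq_def by (rule INF_lower)
  also have "\<dots> = (\<integral>\<^sup>+v. ennreal ((norm (fst (H v) - snd (H v)))\<^sup>2) \<partial>N)"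
    unfolding R_def by (rule nn_integral_distr[OF Hm]) measurable
  also have "\<dots> = (\<integral>\<^sup>+v. ennreal ((1 / real n)\<^sup>2) * ennreal ((norm (?s n v - ?s' n v))\<^sup>2) \<partial>N)"
  proof (intro nn_integral_cong)
    fix v :: "'a \<times> (nat \<Rightarrow> 'a \<times> 'a)"
    have "fst (H v) - snd (H v) = (1 / real n) *\<^sub>R (?s n v - ?s' n v)"
      by (simp add: H_def path_mean_def scaleR_diff_right)
    then have "(norm (fst (H v) - snd (H v)))\<^sup>2 = (1 / real n)\<^sup>2 * (norm (?s n v - ?s' n v))\<^sup>2"
      by (simp add: power_divide)
    then show "ennreal ((norm (fst (H v) - snd (H v)))\<^sup>2) = ennreal ((1 / real n)\<^sup>2) * ennreal ((norm (?s n v - ?s' n v))\<^sup>2)"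
      by (simp only: ennreal_mult zero_le_power2)
  qed
  also have "\<dots> = ennreal ((1 / real n)\<^sup>2) * (\<integral>\<^sup>+v. ennreal ((norm (?s n v - ?s' n v))\<^sup>2) \<partial>N)"
  proof (rule nn_integral_cmult)
    have [measurable]: "?s n \<in> borel_measurable N" "?s' n \<in> borel_measurable N" using sm by auto
    show "(\<lambda>v. ennreal ((norm (?s n v - ?s' n v))\<^sup>2)) \<in> borel_measurable N" by measurable
  qed
  also have "\<dots> \<le> ennreal ((1 / real n)\<^sup>2) * ennreal (u / (1 - \<kappa>)\<^sup>2)" by (intro mult_left_mono sqD) simp
  finally have "of_nat n * mallows_dist_sq (mean_distr M X n) (boot_mean_distr n T x0 x)
      \<le> ennreal (real n) * (ennreal ((1 / real n)\<^sup>2) * ennreal (u / (1 - \<kappa>)\<^sup>2))"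
    unfolding ennreal_of_nat_eq_real_of_nat by (intro mult_left_mono) auto
  also have "\<dots> = ennreal (real n * ((1 / real n)\<^sup>2 * (u / (1 - \<kappa>)\<^sup>2)))"
    using u0 by (simp only: ennreal_mult zero_le_power2 mult_nonneg_nonneg of_nat_0_le_iff divide_nonneg_nonneg)
  also have "real n * ((1 / real n)\<^sup>2 * (u / (1 - \<kappa>)\<^sup>2)) = 3 / (1 - \<kappa>)\<^sup>2 * (2 * (moment2 + (norm x0)\<^sup>2) / real n
        + \<tau>\<^sup>2 * (2 * (moment2 + sigma2) / (1 - norm \<Psi>)\<^sup>2) + q)"
  proof -
    have "real n * ((1 / real n)\<^sup>2 * (u / (1 - \<kappa>)\<^sup>2)) = (u / real n) / (1 - \<kappa>)\<^sup>2"
      using n by (simp add: power2_eq_square)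
    also have "u / real n = 3 * (2 * (moment2 + (norm x0)\<^sup>2) / real n + \<tau>\<^sup>2 * CS + q)"
      using n by (simp add: u_def add_divide_distrib distrib_left)
    finally show ?thesis by (simp add: CS_def \<rho>_def)
  qed
  finally show ?thesis .
qed

end

section \<open>Consistency of the estimated operator\<close>

context far1_model
begin

text \<open>The recursion bounds the average of \<open>(norm (X i))\<^sup>2\<close> by that of \<open>(norm (\<epsilon> i))\<^sup>2\<close>, to which the weak law of large
numbers applies.\<close>

lemma trace_bounded:
  obtains K where "0 < K" "with_high_prob M (\<lambda>n \<omega>. (1 / real n) * (\<Sum>i<n. (norm (X (int i) \<omega>))\<^sup>2) \<le> K)"
proof -
  define \<rho> where "\<rho> = norm \<Psi>"
  have \<rho>: "0 \<le> \<rho>" "\<rho> < 1" using norm_Psi by (auto simp: \<rho>_def)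
  define K where "K = (1 + (sigma2 + 1) / (1 - \<rho>)) / (1 - \<rho>)"
  have "0 < K" using \<rho> sigma2_nonneg by (auto simp: K_def intro!: divide_pos_pos add_pos_nonneg)
  have int4: "integrable F (\<lambda>x. (norm ((norm x)\<^sup>2))\<^sup>2)"
    using moment_eps[of 0] integral_eps(2)[of "\<lambda>x. norm x ^ 4" 0] by (simp flip: power_mult)
  have E2: "(\<integral>x. (norm x)\<^sup>2 \<partial>F) = sigma2"
    unfolding sigma2_def by (rule integral_eps(1)[symmetric]) measurable
  have "with_high_prob M (\<lambda>n \<omega>. norm ((1 / real n) *\<^sub>R (\<Sum>j=1..n. (norm (\<epsilon> (int j) \<omega>))\<^sup>2) - (\<integral>x. (norm x)\<^sup>2 \<partial>F)) \<le> 1)"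
    by (rule iid_average_close[OF _ int4]) auto
  moreover have "with_high_prob M (\<lambda>n \<omega>. (norm (X 0 \<omega>))\<^sup>2 / real n \<le> 1)"
    using X_over_n_small[of "\<lambda>_. 1" "\<lambda>_. 0"] lim_1_over_n by simp
  ultimately have "with_high_prob M (\<lambda>n \<omega>.
      (norm ((1 / real n) *\<^sub>R (\<Sum>j=1..n. (norm (\<epsilon> (int j) \<omega>))\<^sup>2) - (\<integral>x. (norm x)\<^sup>2 \<partial>F)) \<le> 1 \<and> (norm (X 0 \<omega>))\<^sup>2 / real n \<le> 1)
      \<and> (\<forall>t. X (t + 1) \<omega> = \<Psi> (X t \<omega>) + \<epsilon> (t + 1) \<omega>))"
    (is "with_high_prob M ?P") by (intro with_high_prob_conj with_high_prob_AE[OF AE_path])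
  then have "with_high_prob M (\<lambda>n \<omega>. (1 / real n) * (\<Sum>i<n. (norm (X (int i) \<omega>))\<^sup>2) \<le> K)"
  proof (rule with_high_prob_mono, intro eventually_mono[OF eventually_ge_at_top[of 1]] ballI impI)
    fix n :: nat and \<omega>
    assume n: "1 \<le> n" and "?P n \<omega>"
    then have eps: "(1 / real n) * (\<Sum>j=1..n. (norm (\<epsilon> (int j) \<omega>))\<^sup>2) \<le> sigma2 + 1"
      and X0: "(norm (X 0 \<omega>))\<^sup>2 / real n \<le> 1" and path: "\<And>t. X (t + 1) \<omega> = \<Psi> (X t \<omega>) + \<epsilon> (t + 1) \<omega>"
      unfolding E2 by auto
    define S where "S = (\<Sum>i<n. (norm (X (int i) \<omega>))\<^sup>2)"
    define e where "e = (\<Sum>j=1..n. (norm (\<epsilon> (int j) \<omega>))\<^sup>2)"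
    have step: "(norm (X (int i + 1) \<omega>))\<^sup>2 \<le> \<rho> * (norm (X (int i) \<omega>))\<^sup>2 + (norm (\<epsilon> (int i + 1) \<omega>))\<^sup>2 / (1 - \<rho>)" for i
    proof -
      have "norm (X (int i + 1) \<omega>) \<le> \<rho> * norm (X (int i) \<omega>) + norm (\<epsilon> (int i + 1) \<omega>)"
        unfolding path \<rho>_def by (intro norm_triangle_le add_mono norm_blinfun) auto
      then have "(norm (X (int i + 1) \<omega>))\<^sup>2 \<le> (\<rho> * norm (X (int i) \<omega>) + norm (\<epsilon> (int i + 1) \<omega>))\<^sup>2"
        by (intro power_mono) auto
      then show ?thesis using contraction_square_le[OF \<rho>] by (rule order_trans)
    qed
    have "(\<Sum>i<Suc n. (norm (X (int i) \<omega>))\<^sup>2) = (norm (X 0 \<omega>))\<^sup>2 + (\<Sum>i<n. (norm (X (int i + 1) \<omega>))\<^sup>2)"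
      by (subst sum.lessThan_Suc_shift) (simp add: add.commute)
    moreover have "S \<le> (\<Sum>i<Suc n. (norm (X (int i) \<omega>))\<^sup>2)" by (simp add: S_def)
    moreover have "(\<Sum>i<n. (norm (X (int i + 1) \<omega>))\<^sup>2)
        \<le> (\<Sum>i<n. \<rho> * (norm (X (int i) \<omega>))\<^sup>2 + (norm (\<epsilon> (int i + 1) \<omega>))\<^sup>2 / (1 - \<rho>))"
      by (intro sum_mono step)
    moreover have "(\<Sum>i<n. (norm (\<epsilon> (int i + 1) \<omega>))\<^sup>2) = e"
      unfolding e_def by (rule sum.reindex_bij_witness[of _ "\<lambda>j. j - 1" Suc]) (auto simp: add.commute)
    moreover have "(\<Sum>i<n. \<rho> * (norm (X (int i) \<omega>))\<^sup>2 + (norm (\<epsilon> (int i + 1) \<omega>))\<^sup>2 / (1 - \<rho>))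
        = \<rho> * S + (\<Sum>i<n. (norm (\<epsilon> (int i + 1) \<omega>))\<^sup>2) / (1 - \<rho>)"
      by (simp add: sum.distrib sum_distrib_left sum_divide_distrib S_def)
    ultimately have "S \<le> (norm (X 0 \<omega>))\<^sup>2 + (\<rho> * S + e / (1 - \<rho>))" by simp
    then have "(1 - \<rho>) * S \<le> (norm (X 0 \<omega>))\<^sup>2 + e / (1 - \<rho>)" by (simp add: algebra_simps)
    then have "(1 - \<rho>) * S / real n \<le> ((norm (X 0 \<omega>))\<^sup>2 + e / (1 - \<rho>)) / real n"
      by (rule divide_right_mono) simp
    also have "\<dots> = (norm (X 0 \<omega>))\<^sup>2 / real n + ((1 / real n) * e) / (1 - \<rho>)" by (simp add: add_divide_distrib)
    also have "\<dots> \<le> 1 + (sigma2 + 1) / (1 - \<rho>)"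
      using X0 eps \<rho> by (intro add_mono divide_right_mono) (auto simp: e_def)
    finally have "(1 - \<rho>) * ((1 / real n) * S) \<le> 1 + (sigma2 + 1) / (1 - \<rho>)" by simp
    then show "(1 / real n) * (\<Sum>i<n. (norm (X (int i) \<omega>))\<^sup>2) \<le> K"
      using \<rho> unfolding K_def S_def[symmetric] by (subst pos_le_divide_eq) (auto simp: mult.commute)
  qed
  with \<open>0 < K\<close> show thesis by (rule that)
qed

text \<open>The factor \<open>5\<close> collects two noise terms, the error for the innovations and two boundary
terms in \<open>emp_cov_recursion\<close>.\<close>

lemma cov_close:
  assumes e: "orthonormal_frame (e :: nat \<Rightarrow> 'a)" and d: "0 < d" and L: "\<And>n. 0 < L n" "\<And>n. L n \<le> L1"
    and lim: "(\<lambda>n. 1 / (real n * (L n)\<^sup>2)) \<longlonglongrightarrow> 0"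
  shows "with_high_prob M (\<lambda>n \<omega>.
    (\<forall>y. norm (emp_cross_cov n (sample X n \<omega>) y - \<Psi> (emp_cov n (sample X n \<omega>) y)) \<le> d * L n * norm y)
    \<and> (\<forall>y. norm (emp_cov n (sample X n \<omega>) y - \<Gamma> y) \<le> 5 * d / (1 - norm \<Psi>) * L n * norm y))"
  (is "with_high_prob M ?Q")
proof -
  have dL: "0 < d * L n" for n using d L(1) by simp
  have lim2: "(\<lambda>n. 1 / (real n * (d * L n)\<^sup>2)) \<longlonglongrightarrow> 0"
    using tendsto_mult_right_zero[OF lim, of "1 / d\<^sup>2"] by (simp add: power_mult_distrib mult_ac)
  have lim1: "(\<lambda>n. 1 / (real n * (d * L n))) \<longlonglongrightarrow> 0"
  proof (rule tendsto_sandwich[OF _ _ tendsto_const])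
    show "(\<lambda>n. L1 / d * (1 / (real n * (L n)\<^sup>2))) \<longlonglongrightarrow> 0" by (rule tendsto_mult_right_zero[OF lim])
    have "1 / (real n * (d * L n)) \<le> L1 / d * (1 / (real n * (L n)\<^sup>2))" for n
    proof (cases "n = 0")
      case False
      have "1 / (real n * (d * L n)) = L n * (1 / (d * (real n * (L n)\<^sup>2)))"
        using d L(1)[of n] False by (simp add: power2_eq_square)
      also have "\<dots> \<le> L1 * (1 / (d * (real n * (L n)\<^sup>2)))"
        using d L by (intro mult_right_mono) auto
      finally show ?thesis by simp
    qed simp
    then show "\<forall>\<^sub>F n in sequentially. 1 / (real n * (d * L n)) \<le> L1 / d * (1 / (real n * (L n)\<^sup>2))" by simp
    show "\<forall>\<^sub>F n in sequentially. 0 \<le> 1 / (real n * (d * L n))"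
      using dL by (intro always_eventually allI divide_nonneg_nonneg mult_nonneg_nonneg) (use d L(1) in \<open>auto intro: less_imp_le\<close>)
  qed
  have "with_high_prob M (\<lambda>n \<omega>. (\<forall>y. norm (noise n \<omega> y) \<le> d * L n * norm y)
    \<and> (\<forall>y. norm (eps_cov_error n \<omega> y) \<le> d * L n * norm y)
    \<and> (norm (X 0 \<omega>))\<^sup>2 / real n \<le> d * L n \<and> (norm (X (int n) \<omega>))\<^sup>2 / real n \<le> d * L n
    \<and> (\<forall>t. X (t + 1) \<omega> = \<Psi> (X t \<omega>) + \<epsilon> (t + 1) \<omega>))"
    (is "with_high_prob M ?P")
    by (intro with_high_prob_conj with_high_prob_AE[OF AE_path] noise_small[OF e] eps_cov_small[OF e]
        X_over_n_small dL lim2 lim1)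
  then show ?thesis
  proof (rule with_high_prob_mono, intro eventually_mono[OF eventually_ge_at_top[of 1]] ballI impI)
    fix n :: nat and \<omega>
    assume n: "1 \<le> n" and *: "?P n \<omega>"
    then have path: "\<forall>t. X (t + 1) \<omega> = \<Psi> (X t \<omega>) + \<epsilon> (t + 1) \<omega>" by blast
    have b: "norm (emp_cov n (sample X n \<omega>) y - \<Gamma> y) \<le> 5 * d / (1 - norm \<Psi>) * L n * norm y" for y
    proof -
      have "norm (emp_cov n (sample X n \<omega>) y - \<Gamma> y)
          \<le> (2 * (d * L n) + d * L n + ((norm (X 0 \<omega>))\<^sup>2 / real n + (norm (X (int n) \<omega>))\<^sup>2 / real n)) / (1 - norm \<Psi>) * norm y"
        using * by (intro emp_cov_recursion[OF path n]) auto
      also have "\<dots> \<le> (5 * (d * L n)) / (1 - norm \<Psi>) * norm y"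
        using * norm_Psi by (intro mult_right_mono divide_right_mono) auto
      finally show ?thesis by simp
    qed
    show "?Q n \<omega>"
      using * b by (simp add: emp_cross_cov_sample[OF path])
  qed
qed

lemma orthonormal_eigenvectors:
  assumes spectrum: "simple_positive_spectrum \<Gamma> lam"
  obtains u where "\<And>i j. 1 \<le> i \<Longrightarrow> 1 \<le> j \<Longrightarrow> u i \<bullet> u j = (if i = j then 1 else 0)"
    "\<And>i. 1 \<le> i \<Longrightarrow> \<Gamma> (u i) = lam i *\<^sub>R u i"
proof -
  interpret G: bounded_linear \<Gamma> by (rule bounded_linear_Gamma)
  have "\<exists>x. x \<noteq> 0 \<and> \<Gamma> x = lam i *\<^sub>R x" if "1 \<le> i" for i
  proof -
    have "lam i \<in> eigenvalues \<Gamma>" using spectrum that by (auto simp: simple_positive_spectrum_def)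
    then show ?thesis by (simp add: eigenvalues_def)
  qed
  then obtain w where w: "\<And>i. 1 \<le> i \<Longrightarrow> w i \<noteq> 0 \<and> \<Gamma> (w i) = lam i *\<^sub>R w i" by metis
  have orth: "w i \<bullet> w j = 0" if ij: "1 \<le> i" "1 \<le> j" "i \<noteq> j" for i j
  proof -
    have "lam i \<noteq> lam j"
      using spectrum ij by (cases i j rule: linorder_cases) (fastforce simp: simple_positive_spectrum_def monotone_on_def)+
    moreover have "lam i * (w i \<bullet> w j) = lam j * (w i \<bullet> w j)"
      using cov_operator_symmetric[OF X_measurable integrable_X_sq, of 0 "w i" "w j"] w ij by simp
    ultimately show ?thesis by simp
  qed
  show thesis
  proof (rule that[of "\<lambda>i. (1 / norm (w i)) *\<^sub>R w i"])
    fix i j :: nat assume ij: "1 \<le> i" "1 \<le> j"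
    then show "((1 / norm (w i)) *\<^sub>R w i) \<bullet> ((1 / norm (w j)) *\<^sub>R w j) = (if i = j then 1 else 0)"
      using w[of i] orth[of i j]
      by (cases "i = j") (simp_all add: power2_norm_eq_inner[symmetric] power2_eq_square)
  next
    fix i :: nat assume "1 \<le> i"
    then show "\<Gamma> ((1 / norm (w i)) *\<^sub>R w i) = lam i *\<^sub>R ((1 / norm (w i)) *\<^sub>R w i)"
      using w[of i] by (simp add: G.scaleR)
  qed
qed

text \<open>The parameters of \<open>Psi_hat_error\<close> are chosen in the order \<open>m\<close>, \<open>\<zeta>\<close>, \<open>g\<close>, \<open>d\<close>, where \<open>d\<close> relates the noise to
\<open>lam (k n)\<close>. The bound \<open>5 d / (1 - norm \<Psi>) \<le> 1 / 2\<close> makes Weyl's inequality yield an empirical eigenvalue of at least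
\<open>lam (k n) / 2\<close>.\<close>

lemma Psi_hat_consistent:
  assumes HS: "hilbert_schmidt \<Psi>" and spectrum: "simple_positive_spectrum \<Gamma> lam"
    and k_pos: "\<And>n. 1 \<le> k n" and k_lim: "filterlim k at_top sequentially"
    and eigen_hat: "\<And>n x. eigensystem (emp_cov n x) (lamhat n x) (vhat n x)"
    and lim: "(\<lambda>n. 1 / (real n * (lam (k n))\<^sup>2)) \<longlonglongrightarrow> 0" and \<delta>: "0 < \<delta>"
  shows "with_high_prob M (\<lambda>n \<omega>. \<forall>y. norm (Psi_hat n (k n) (lamhat n (sample X n \<omega>)) (vhat n (sample X n \<omega>)) (sample X n \<omega>) y
    - \<Psi> y) \<le> \<delta> * norm y)"
proof -
  obtain e where e: "orthonormal_frame e" and sumHS: "summable (\<lambda>i. (norm (\<Psi> (e i)))\<^sup>2)"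
    using hilbert_schmidt_frame[OF HS] by blast
  obtain u where u: "\<And>i j. 1 \<le> i \<Longrightarrow> 1 \<le> j \<Longrightarrow> u i \<bullet> u j = (if i = j then 1 else 0)"
    and Gu: "\<And>i. 1 \<le> i \<Longrightarrow> \<Gamma> (u i) = lam i *\<^sub>R u i"
    using orthonormal_eigenvectors[OF spectrum] by metis
  have lam_pos: "0 < lam j" if "1 \<le> j" for j using spectrum that by (simp add: simple_positive_spectrum_def)
  have lam_mono: "lam j \<le> lam i" if "1 \<le> i" "i \<le> j" for i j
    using spectrum that by (cases "i = j") (auto simp: simple_positive_spectrum_def monotone_on_def intro: less_imp_le)
  have inj: "x = 0" if "\<Gamma> x = 0" for x
  proof (rule ccontr)
    assume "x \<noteq> 0"
    then have "0 \<in> eigenvalues \<Gamma>" using that by (auto simp: eigenvalues_def)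
    then obtain j where "1 \<le> j" "lam j = 0" using spectrum by (auto simp: simple_positive_spectrum_def)
    then show False using lam_pos[of j] by simp
  qed
  have dense: "closure (range \<Gamma>) = UNIV"
    by (rule dense_range_if_symmetric_injective[OF bounded_linear_Gamma cov_operator_symmetric inj])
       (use integrable_X_sq in auto)
  obtain m where tail: "\<And>z. norm (\<Psi> (z - orth_proj {..<m} e z)) \<le> \<delta> / 4 * norm z"
    using hilbert_schmidt_tail[OF e blinfun.bounded_linear_right sumHS, of "\<delta> / 4"] \<delta> by auto
  define \<zeta> where "\<zeta> = \<delta> / (4 * real (Suc m))"
  have \<zeta>: "0 < \<zeta>" "real m * \<zeta> \<le> \<delta> / 4" using \<delta> by (auto simp: \<zeta>_def field_simps)
  have "\<exists>g. norm (e i - \<Gamma> g) \<le> \<zeta>" for i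
  proof -
    have "e i \<in> closure (range \<Gamma>)" by (simp add: dense)
    then obtain x where "x \<in> range \<Gamma>" "dist x (e i) < \<zeta>" using \<zeta>(1) unfolding closure_approachable by blast
    then show ?thesis by (auto simp: dist_norm norm_minus_commute intro!: less_imp_le)
  qed
  then obtain g where g: "\<And>i. norm (e i - \<Gamma> (g i)) \<le> \<zeta>" by metis
  define H where "H = 1 + (\<Sum>i<m. norm (g i))"
  have H: "1 \<le> H" by (simp add: H_def sum_nonneg)
  define \<rho> where "\<rho> = norm \<Psi>"
  have \<rho>: "0 \<le> \<rho>" "\<rho> < 1" using norm_Psi by (auto simp: \<rho>_def)
  obtain K where K: "0 < K" and trace: "with_high_prob M (\<lambda>n \<omega>. (1 / real n) * (\<Sum>i<n. (norm (X (int i) \<omega>))\<^sup>2) \<le> K)"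
    using trace_bounded by blast
  define d where "d = min (\<delta> / 8) (min ((1 - \<rho>) / 10) (\<delta> * (1 - \<rho>) / (40 * lam 1 * H)))"
  have d: "0 < d" using \<delta> \<rho> H lam_pos[of 1] by (simp add: d_def)
  have "d \<le> \<delta> / 8" unfolding d_def by (rule min.cobounded1)
  then have d1: "2 * d \<le> \<delta> / 4" by simp
  have d2: "5 * d / (1 - \<rho>) \<le> 1 / 2"
  proof -
    have "d \<le> (1 - \<rho>) / 10" unfolding d_def by (rule min.coboundedI2[OF min.cobounded1])
    then show ?thesis using \<rho> by (simp add: field_simps)
  qed
  have d3: "5 * d / (1 - \<rho>) * lam 1 * H \<le> \<delta> / 8"
  proof -
    have "d \<le> \<delta> * (1 - \<rho>) / (40 * lam 1 * H)"
      unfolding d_def by (rule min.coboundedI2[OF min.cobounded2])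
    moreover have "0 < 40 * lam 1 * H" using lam_pos[of 1] H by simp
    ultimately have "d * (40 * lam 1 * H) \<le> \<delta> * (1 - \<rho>)" by (simp add: pos_le_divide_eq)
    then show ?thesis using \<rho> by (simp add: field_simps)
  qed
  have Kk: "\<forall>\<^sub>F n in sequentially. K / real (Suc (k n)) * H \<le> \<delta> / 8"
  proof -
    obtain k0 :: nat where k0: "K * H * 8 / \<delta> \<le> real k0" using real_arch_simple by blast
    have "\<forall>\<^sub>F n in sequentially. k0 \<le> k n" using k_lim by (simp add: filterlim_at_top)
    then show ?thesis
    proof eventually_elim
      case (elim n)
      have "K * H * 8 / \<delta> \<le> real (Suc (k n))" using k0 elim by simp
      then show ?case using \<delta> by (simp add: field_simps)
    qed
  qed
  have "with_high_prob M (\<lambda>n \<omega>.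
    ((\<forall>y. norm (emp_cross_cov n (sample X n \<omega>) y - \<Psi> (emp_cov n (sample X n \<omega>) y)) \<le> d * lam (k n) * norm y)
    \<and> (\<forall>y. norm (emp_cov n (sample X n \<omega>) y - \<Gamma> y) \<le> 5 * d / (1 - norm \<Psi>) * lam (k n) * norm y))
    \<and> (1 / real n) * (\<Sum>i<n. (norm (X (int i) \<omega>))\<^sup>2) \<le> K)"
    (is "with_high_prob M ?P")
    by (intro with_high_prob_conj trace cov_close[OF e d _ lam_mono lim]) (use lam_pos k_pos in auto)
  then show ?thesis
  proof (rule with_high_prob_mono, intro eventually_mono[OF Kk] ballI impI allI)
    fix n \<omega> y
    let ?x = "sample X n \<omega>"
    assume Kn: "K / real (Suc (k n)) * H \<le> \<delta> / 8" and *: "?P n \<omega>"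
    define D where "D = 5 * d / (1 - \<rho>) * lam (k n)"
    have close: "norm (emp_cov n ?x y - \<Gamma> y) \<le> D * norm y" for y using * by (simp add: D_def \<rho>_def)
    have noise: "norm (emp_cross_cov n ?x y - \<Psi> (emp_cov n ?x y)) \<le> d * lam (k n) * norm y" for y using * by simp
    have tr: "(1 / real n) * (\<Sum>i<n. (norm (?x i))\<^sup>2) \<le> K" using * by (simp add: sample_def)
    have Lk: "0 < lam (k n)" by (rule lam_pos[OF k_pos])
    have "lam (k n) \<le> lamhat n ?x (k n) + D"
      by (rule eigensystem_weyl[OF eigen_hat k_pos bounded_linear.linear[OF bounded_linear_Gamma], where u=u and m=lam])
         (use u Gu lam_mono close in auto)
    moreover have "D \<le> 1 / 2 * lam (k n)" unfolding D_def using d2 Lk by (intro mult_right_mono) auto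
    ultimately have lk: "lam (k n) / 2 \<le> lamhat n ?x (k n)" by simp
    then have lk0: "0 < lamhat n ?x (k n)" using Lk by linarith
    have "norm (Psi_hat n (k n) (lamhat n ?x) (vhat n ?x) ?x y - \<Psi> y)
      \<le> (norm \<Psi> * (\<Sum>i<m. \<zeta> + (K / real (Suc (k n)) + D) * norm (g i)) + \<delta> / 4
          + d * lam (k n) / lamhat n ?x (k n)) * norm y"
      by (rule Psi_hat_error[OF eigen_hat k_pos lk0 e tail _ g close tr noise]) (use \<delta> in simp)
    also have "\<dots> \<le> \<delta> * norm y"
    proof (rule mult_right_mono)
      have DH: "D * H \<le> 5 * d / (1 - \<rho>) * lam 1 * H"
        unfolding D_def using d \<rho> H lam_mono[of 1 "k n"] k_pos[of n] by (intro mult_right_mono mult_left_mono) auto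
      have "(\<Sum>i<m. \<zeta> + (K / real (Suc (k n)) + D) * norm (g i))
          = real m * \<zeta> + (K / real (Suc (k n)) + D) * (\<Sum>i<m. norm (g i))"
        by (simp add: sum.distrib sum_distrib_left)
      also have "\<dots> \<le> \<delta> / 4 + (K / real (Suc (k n)) + D) * H"
      proof (intro add_mono \<zeta>(2) mult_left_mono)
        show "0 \<le> K / real (Suc (k n)) + D" using K d \<rho> Lk by (simp add: D_def)
      qed (simp add: H_def)
      also have "\<dots> = \<delta> / 4 + (K / real (Suc (k n)) * H + D * H)" by (simp only: distrib_right)
      also have "\<dots> \<le> \<delta> / 4 + (\<delta> / 8 + \<delta> / 8)" using DH d3 Kn by linarith
      finally have sum: "(\<Sum>i<m. \<zeta> + (K / real (Suc (k n)) + D) * norm (g i)) \<le> \<delta> / 2" by simp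
      have "norm \<Psi> * (\<Sum>i<m. \<zeta> + (K / real (Suc (k n)) + D) * norm (g i)) \<le> 1 * (\<delta> / 2)"
        by (rule order_trans[OF mult_left_mono[OF sum norm_ge_zero] mult_right_mono])
           (use norm_Psi \<delta> in auto)
      moreover have "d * lam (k n) / lamhat n ?x (k n) \<le> 2 * d"
        using lk lk0 d by (simp add: pos_divide_le_eq)
      ultimately show "norm \<Psi> * (\<Sum>i<m. \<zeta> + (K / real (Suc (k n)) + D) * norm (g i)) + \<delta> / 4
          + d * lam (k n) / lamhat n ?x (k n) \<le> \<delta>" using d1 by simp
    qed simp
    finally show "norm (Psi_hat n (k n) (lamhat n ?x) (vhat n ?x) ?x y - \<Psi> y) \<le> \<delta> * norm y" .
  qed
qed

end

section \<open>Consistency of the bootstrap mean\<close>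

lemma tends_to_zero_in_prob_iff:
  "tends_to_zero_in_prob M Z \<longleftrightarrow> (\<forall>\<delta>>0. with_high_prob M (\<lambda>n \<omega>. Z n \<omega> \<le> ennreal \<delta>))"
  by (simp add: tends_to_zero_in_prob_def with_high_prob_def not_le)

text \<open>Applied to the initial value of the bootstrap recursion.\<close>

lemma bounded_in_prob_sq_over_n:
  assumes Y: "bounded_in_prob M Y" and \<delta>: "0 < \<delta>"
  shows "with_high_prob M (\<lambda>n \<omega>. (norm (Y n \<omega>))\<^sup>2 / real n \<le> \<delta>)"
  unfolding with_high_prob_def
proof (rule order_tendstoI)
  fix a :: ennreal assume "0 < a"
  then obtain b where b: "0 < b" "b < a" using dense by blast
  then obtain \<eta> where \<eta>: "b = ennreal \<eta>" "0 \<le> \<eta>" by (cases b) (auto simp: top_unique less_top[symmetric])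
  then have "0 < \<eta>" using b(1) by (simp add: ennreal_less_zero_iff)
  then obtain K where K: "\<forall>\<^sub>F n in sequentially. outer_measure_of M {\<omega>\<in>space M. K < norm (Y n \<omega>)} \<le> ennreal \<eta>"
    using Y[unfolded bounded_in_prob_def, rule_format, OF \<open>0 < \<eta>\<close>] by blast
  obtain n0 :: nat where n0: "K\<^sup>2 / \<delta> \<le> real n0" using real_arch_simple by blast
  show "\<forall>\<^sub>F n in sequentially. outer_measure_of M {\<omega>\<in>space M. \<not> (norm (Y n \<omega>))\<^sup>2 / real n \<le> \<delta>} < a"
    using K eventually_ge_at_top[of "Suc n0"]
  proof eventually_elim
    case (elim n)
    have "{\<omega>\<in>space M. \<not> (norm (Y n \<omega>))\<^sup>2 / real n \<le> \<delta>} \<subseteq> {\<omega>\<in>space M. K < norm (Y n \<omega>)}"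
    proof (safe, rule ccontr)
      fix \<omega> assume *: "\<not> (norm (Y n \<omega>))\<^sup>2 / real n \<le> \<delta>" "\<not> K < norm (Y n \<omega>)"
      then have "(norm (Y n \<omega>))\<^sup>2 \<le> K\<^sup>2" by (intro power_mono) auto
      moreover have "K\<^sup>2 / \<delta> \<le> real n" using n0 elim(2) by simp
      then have "K\<^sup>2 \<le> \<delta> * real n" using \<delta> by (simp add: pos_divide_le_eq mult.commute)
      ultimately have "(norm (Y n \<omega>))\<^sup>2 \<le> \<delta> * real n" by simp
      then show False using * elim(2) by (simp add: field_simps)
    qed
    then have "outer_measure_of M {\<omega>\<in>space M. \<not> (norm (Y n \<omega>))\<^sup>2 / real n \<le> \<delta>} \<le> ennreal \<eta>"
      by (rule order_trans[OF outer_measure_of_mono elim(1)])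
    then show ?case using b \<eta> by simp
  qed
qed simp

text \<open>\<open>1 / (L n)\<^sup>2\<close> is of order \<open>sqrt n\<close>, because \<open>ln n \<ge> 1\<close> for \<open>n \<ge> 3\<close>.\<close>

lemma rate_tendsto:
  fixes L :: "nat \<Rightarrow> real"
  assumes \<beta>: "0 \<le> \<beta>" and O: "(\<lambda>n. 1 / L n) \<in> O(\<lambda>n. real n powr (1/4) / ln (real n) powr \<beta>)"
  shows "(\<lambda>n. 1 / (real n * (L n)\<^sup>2)) \<longlonglongrightarrow> 0"
proof -
  obtain c where c: "\<forall>\<^sub>F n in sequentially. norm (1 / L n) \<le> c * norm (real n powr (1/4) / ln (real n) powr \<beta>)"
    using O by (auto elim: landau_o.bigE)
  show ?thesis
  proof (rule tendsto_sandwich[OF _ _ tendsto_const])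
    have "(\<lambda>n. c\<^sup>2 * (1 / sqrt (real n))) \<longlonglongrightarrow> c\<^sup>2 * 0"
      by (intro tendsto_mult tendsto_const tendsto_divide_0[OF tendsto_const]
          filterlim_at_top_imp_at_infinity filterlim_compose[OF sqrt_at_top filterlim_real_sequentially])
    then show "(\<lambda>n. c\<^sup>2 * (1 / sqrt (real n))) \<longlonglongrightarrow> 0" by simp
    show "\<forall>\<^sub>F n in sequentially. 1 / (real n * (L n)\<^sup>2) \<le> c\<^sup>2 * (1 / sqrt (real n))"
      using c eventually_ge_at_top[of 3]
    proof eventually_elim
      case (elim n)
      have "1 \<le> ln (real n)" using elim(2) ln_ge_iff[of "real n" 1] exp_le by simp
      then have l: "1 \<le> ln (real n) powr \<beta>" using \<beta> by (rule ge_one_powr_ge_zero)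
      have q: "0 \<le> real n powr (1/4) / ln (real n) powr \<beta>" "real n powr (1/4) / ln (real n) powr \<beta> \<le> real n powr (1/4)"
        using l by (auto simp: divide_le_eq mult_le_cancel_left1)
      have "(1 / L n)\<^sup>2 = (norm (1 / L n))\<^sup>2" by (simp only: real_norm_def power2_abs)
      also have "\<dots> \<le> (c * (real n powr (1/4) / ln (real n) powr \<beta>))\<^sup>2" using elim(1) q by (intro power_mono) auto
      also have "\<dots> = c\<^sup>2 * (real n powr (1/4) / ln (real n) powr \<beta>)\<^sup>2" by (simp only: power_mult_distrib)
      also have "\<dots> \<le> c\<^sup>2 * (real n powr (1/4))\<^sup>2" using q by (intro mult_left_mono power_mono) auto
      also have "(real n powr (1/4))\<^sup>2 = sqrt (real n)"
        using elim(2) by (simp add: powr_half_sqrt[symmetric] power2_eq_square powr_add[symmetric])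
      finally have "(1 / L n)\<^sup>2 / real n \<le> c\<^sup>2 * sqrt (real n) / real n" by (rule divide_right_mono) simp
      also have "c\<^sup>2 * sqrt (real n) / real n = c\<^sup>2 * (1 / sqrt (real n))"
        using elim(2) real_sqrt_mult_self[of "real n"] by (simp add: field_simps)
      finally show ?case by (simp add: power_divide mult.commute)
    qed
  qed simp
qed

lemma norm_average_sq_le:
  fixes a :: "nat \<Rightarrow> 'a::real_normed_vector"
  assumes n: "1 \<le> n"
  shows "(norm ((1 / real n) *\<^sub>R (\<Sum>i=1..n. a i)))\<^sup>2 \<le> (1 / real n) * (\<Sum>i=1..n. (norm (a i))\<^sup>2)"
proof -
  have "(norm (\<Sum>i=1..n. a i))\<^sup>2 \<le> (\<Sum>i=1..n. norm (a i))\<^sup>2" by (intro power_mono norm_sum) simp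
  also have "\<dots> \<le> (\<Sum>i=1..n. (norm (a i))\<^sup>2) * real n"
    using sum_squared_le_sum_of_squares[of "\<lambda>i. norm (a i)" "{1..n}"] n by simp
  finally have "(1 / real n)\<^sup>2 * (norm (\<Sum>i=1..n. a i))\<^sup>2 \<le> (1 / real n)\<^sup>2 * ((\<Sum>i=1..n. (norm (a i))\<^sup>2) * real n)"
    by (rule mult_left_mono) simp
  then show ?thesis using n by (simp add: power_divide power2_eq_square)
qed

context far1_model
begin

text \<open>Provides the cells of the coupling. The linear bound gives the squared approximation error a
finite second moment, so that the law of large numbers applies to it.\<close>

lemma simple_approximation:
  assumes A: "0 < A"
  obtains \<pi> :: "'a \<Rightarrow> 'a" where "simple_function borel \<pi>" "\<And>x. norm (\<pi> x) \<le> 2 * norm x"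
    "(\<integral>\<^sup>+x. ennreal ((norm (x - \<pi> x))\<^sup>2) \<partial>F) \<le> ennreal A"
proof -
  note [measurable_cong] = sets_F
  have "(\<lambda>x::'a. x) \<in> borel_measurable borel" by simp
  from borel_measurable_implies_sequence_metric[OF this, of 0]
  obtain s where s': "\<forall>i. simple_function borel (s i)" "\<forall>x\<in>space borel. (\<lambda>i. s i x) \<longlonglongrightarrow> x"
    "\<forall>i. \<forall>x\<in>space borel. dist (s i x) 0 \<le> 2 * dist x (0::'a)" by blast
  then have s: "\<And>i. simple_function borel (s i)" "\<And>x. (\<lambda>i. s i x) \<longlonglongrightarrow> x" "\<And>i x. norm (s i x) \<le> 2 * norm x"
    by auto
  have [measurable]: "s i \<in> borel_measurable borel" for i by (rule borel_measurable_simple_function[OF s(1)])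
  have bound: "(norm (x - s i x))\<^sup>2 \<le> 9 * (norm x)\<^sup>2" for x i
  proof -
    have "norm (x - s i x) \<le> 3 * norm x" using norm_triangle_ineq4[of x "s i x"] s(3)[of i x] by simp
    then have "(norm (x - s i x))\<^sup>2 \<le> (3 * norm x)\<^sup>2" by (intro power_mono) auto
    then show ?thesis by (simp add: power_mult_distrib)
  qed
  have "(\<lambda>i. \<integral>\<^sup>+x. ennreal ((norm (x - s i x))\<^sup>2) \<partial>F) \<longlonglongrightarrow> (\<integral>\<^sup>+x. 0 \<partial>F)"
  proof (rule nn_integral_dominated_convergence[where w="\<lambda>x. ennreal (9 * (norm x)\<^sup>2)"])
    have "(\<integral>\<^sup>+x. ennreal (9 * (norm x)\<^sup>2) \<partial>F) = ennreal 9 * (\<integral>\<^sup>+x. ennreal ((norm x)\<^sup>2) \<partial>F)"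
      by (subst nn_integral_cmult[symmetric]) (auto simp: ennreal_mult)
    also have "\<dots> < \<infinity>" by (simp add: second_moment_F ennreal_mult_less_top)
    finally show "(\<integral>\<^sup>+x. ennreal (9 * (norm x)\<^sup>2) \<partial>F) < \<infinity>" .
    have "(\<lambda>i. ennreal ((norm (x - s i x))\<^sup>2)) \<longlonglongrightarrow> ennreal ((norm (x - x))\<^sup>2)" for x
      by (intro tendsto_ennrealI tendsto_power tendsto_norm tendsto_diff tendsto_const s(2))
    then show "AE x in F. (\<lambda>i. ennreal ((norm (x - s i x))\<^sup>2)) \<longlonglongrightarrow> 0" by simp
    show "AE x in F. ennreal ((norm (x - s j x))\<^sup>2) \<le> ennreal (9 * (norm x)\<^sup>2)" for j
      using bound by (auto intro: ennreal_leI)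
  qed measurable
  then have "(\<lambda>i. \<integral>\<^sup>+x. ennreal ((norm (x - s i x))\<^sup>2) \<partial>F) \<longlonglongrightarrow> 0" by simp
  then have "\<forall>\<^sub>F i in sequentially. (\<integral>\<^sup>+x. ennreal ((norm (x - s i x))\<^sup>2) \<partial>F) < ennreal A"
    using A by (intro order_tendstoD) auto
  then obtain i where "(\<integral>\<^sup>+x. ennreal ((norm (x - s i x))\<^sup>2) \<partial>F) < ennreal A"
    by (auto simp: eventually_sequentially)
  with s show thesis by (intro that[of "s i"]) auto
qed

text \<open>The residual at time \<open>i\<close> differs from \<open>\<epsilon> i\<close> by \<open>(T - \<Psi>) (X (i - 1))\<close>. Centring subtracts the average of these
differences and the average innovation.\<close>

lemma centered_residual_error:
  assumes path: "\<forall>t. X (t + 1) \<omega> = \<Psi> (X t \<omega>) + \<epsilon> (t + 1) \<omega>" and n: "1 \<le> n"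
    and \<tau>: "\<And>y. norm (T y - \<Psi> y) \<le> \<tau> * norm y" "0 \<le> \<tau>"
    and trace: "(1 / real n) * (\<Sum>i<n. (norm (X (int i) \<omega>))\<^sup>2) \<le> K"
    and mean: "norm ((1 / real n) *\<^sub>R (\<Sum>j=1..n. \<epsilon> (int j) \<omega>)) \<le> \<eta>"
  shows "(\<Sum>i=1..n. (norm (\<epsilon> (int i) \<omega> - centered_residual n T (sample X n \<omega>) i))\<^sup>2) / real n
    \<le> 3 * (2 * (\<tau>\<^sup>2 * K) + \<eta>\<^sup>2)"
proof -
  let ?x = "sample X n \<omega>"
  define a where "a i = T (?x (i - 1)) - \<Psi> (?x (i - 1))" for i
  define abar where "abar = (1 / real n) *\<^sub>R (\<Sum>i=1..n. a i)"
  define ebar where "ebar = (1 / real n) *\<^sub>R (\<Sum>i=1..n. \<epsilon> (int i) \<omega>)"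
  have res: "residual T ?x i = \<epsilon> (int i) \<omega> - a i" if "i \<in> {1..n}" for i
  proof -
    obtain j where j: "i = Suc j" using \<open>i \<in> {1..n}\<close> by (cases i) auto
    have "X (int i) \<omega> = \<Psi> (X (int j) \<omega>) + \<epsilon> (int i) \<omega>"
      using path[rule_format, of "int j"] by (simp add: j add.commute)
    then show ?thesis using that by (simp add: residual_def a_def sample_def j)
  qed
  have "(1 / real n) *\<^sub>R (\<Sum>i=1..n. residual T ?x i) = ebar - abar"
  proof -
    have "(\<Sum>i=1..n. residual T ?x i) = (\<Sum>i=1..n. \<epsilon> (int i) \<omega> - a i)" by (intro sum.cong refl res)
    then show ?thesis unfolding ebar_def abar_def by (simp only: sum_subtractf scaleR_diff_right)
  qed
  then have diff: "\<epsilon> (int i) \<omega> - centered_residual n T ?x i = a i - abar + ebar" if "i \<in> {1..n}" for i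
    using res[OF that] by (simp add: centered_residual_def)
  have an: "(1 / real n) * (\<Sum>i=1..n. (norm (a i))\<^sup>2) \<le> \<tau>\<^sup>2 * K"
  proof -
    have "(\<Sum>i=1..n. (norm (a i))\<^sup>2) \<le> (\<Sum>i=1..n. \<tau>\<^sup>2 * (norm (?x (i - 1)))\<^sup>2)"
      unfolding a_def power_mult_distrib[symmetric] by (intro sum_mono power_mono \<tau>(1)) auto
    also have "\<dots> = \<tau>\<^sup>2 * (\<Sum>i<n. (norm (X (int i) \<omega>))\<^sup>2)"
      unfolding sum_distrib_left
      by (rule sum.reindex_bij_witness[of _ Suc "\<lambda>j. j - 1"]) (auto simp: sample_def)
    finally have "(1 / real n) * (\<Sum>i=1..n. (norm (a i))\<^sup>2) \<le> (1 / real n) * (\<tau>\<^sup>2 * (\<Sum>i<n. (norm (X (int i) \<omega>))\<^sup>2))"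
      by (rule mult_left_mono) simp
    also have "\<dots> = \<tau>\<^sup>2 * ((1 / real n) * (\<Sum>i<n. (norm (X (int i) \<omega>))\<^sup>2))" by simp
    also have "\<dots> \<le> \<tau>\<^sup>2 * K" by (intro mult_left_mono trace) simp
    finally show ?thesis .
  qed
  have abar: "(norm abar)\<^sup>2 \<le> \<tau>\<^sup>2 * K"
    unfolding abar_def using norm_average_sq_le[OF n] an by (rule order_trans)
  have ebar: "(norm ebar)\<^sup>2 \<le> \<eta>\<^sup>2" unfolding ebar_def using mean by (intro power_mono) auto
  have "(\<Sum>i=1..n. (norm (\<epsilon> (int i) \<omega> - centered_residual n T ?x i))\<^sup>2)
      \<le> (\<Sum>i=1..n. 3 * ((norm (a i))\<^sup>2 + (norm abar)\<^sup>2 + (norm ebar)\<^sup>2))"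
  proof (rule sum_mono)
    fix i assume i: "i \<in> {1..n}"
    have "norm (a i - abar + ebar) \<le> norm (a i) + norm abar + norm ebar"
      using norm_triangle_ineq[of "a i - abar" ebar] norm_triangle_ineq4[of "a i" abar] by linarith
    then have "(norm (a i - abar + ebar))\<^sup>2 \<le> (norm (a i) + norm abar + norm ebar)\<^sup>2" by (intro power_mono) auto
    then show "(norm (\<epsilon> (int i) \<omega> - centered_residual n T ?x i))\<^sup>2 \<le> 3 * ((norm (a i))\<^sup>2 + (norm abar)\<^sup>2 + (norm ebar)\<^sup>2)"
      unfolding diff[OF i] using square_sum3_le by (rule order_trans)
  qed
  also have "\<dots> = 3 * ((\<Sum>i=1..n. (norm (a i))\<^sup>2) + real n * ((norm abar)\<^sup>2 + (norm ebar)\<^sup>2))"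
    by (simp add: sum.distrib sum_distrib_left[symmetric] algebra_simps)
  finally have "(\<Sum>i=1..n. (norm (\<epsilon> (int i) \<omega> - centered_residual n T ?x i))\<^sup>2) / real n
      \<le> 3 * ((\<Sum>i=1..n. (norm (a i))\<^sup>2) + real n * ((norm abar)\<^sup>2 + (norm ebar)\<^sup>2)) / real n"
    by (rule divide_right_mono) simp
  also have "\<dots> = 3 * ((1 / real n) * (\<Sum>i=1..n. (norm (a i))\<^sup>2) + ((norm abar)\<^sup>2 + (norm ebar)\<^sup>2))"
    using n by (simp add: field_simps)
  also have "\<dots> \<le> 3 * (2 * (\<tau>\<^sup>2 * K) + \<eta>\<^sup>2)" using an abar ebar by simp
  finally show ?thesis .
qed

lemma frequencies_close:
  fixes \<pi> :: "'a \<Rightarrow> 'a"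
  assumes \<pi>: "simple_function borel \<pi>" and \<xi>: "0 < \<xi>"
  shows "with_high_prob M (\<lambda>n \<omega>. (\<Sum>v\<in>range \<pi>. \<bar>measure F {x. \<pi> x = v}
    - real (card {i\<in>{1..n}. \<pi> (\<epsilon> (int i) \<omega>) = v}) / real n\<bar>) \<le> \<xi>)"
proof -
  interpret F: prob_space F by (rule prob_space_F)
  note [measurable_cong] = sets_F
  have fin: "finite (range \<pi>)" using simple_functionD(1)[OF \<pi>] by simp
  have [measurable]: "\<pi> \<in> borel_measurable borel" using \<pi> by (rule borel_measurable_simple_function)
  define c where "c = real (card (range \<pi>))"
  have c: "0 < c" using fin by (simp add: c_def card_gt_0_iff)
  have "with_high_prob M (\<lambda>n \<omega>. norm ((1 / real n) *\<^sub>R (\<Sum>j=1..n. indicator {x. \<pi> x = v} (\<epsilon> (int j) \<omega>) :: real)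
      - (\<integral>x. indicator {x. \<pi> x = v} x \<partial>F)) \<le> \<xi> / c)" for v
  proof (rule iid_average_close)
    show "(indicator {x. \<pi> x = v} :: 'a \<Rightarrow> real) \<in> borel_measurable borel" by measurable
    have "integrable F (\<lambda>x. indicator {x. \<pi> x = v} x :: real)"
      by (rule F.integrable_const_bound[where B=1]) auto
    moreover have "(norm (indicator {x. \<pi> x = v} x :: real))\<^sup>2 = indicator {x. \<pi> x = v} x" for x
      by (simp add: indicator_def)
    ultimately show "integrable F (\<lambda>x. (norm (indicator {x. \<pi> x = v} x :: real))\<^sup>2)" by simp
  qed (use \<xi> c in simp)
  then have "with_high_prob M (\<lambda>n \<omega>. \<forall>v\<in>range \<pi>. norm ((1 / real n) *\<^sub>R (\<Sum>j=1..n. indicator {x. \<pi> x = v} (\<epsilon> (int j) \<omega>) :: real)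
      - (\<integral>x. indicator {x. \<pi> x = v} x \<partial>F)) \<le> \<xi> / c)"
    (is "with_high_prob M ?P") using fin by (intro with_high_prob_ball)
  then show ?thesis
  proof (rule with_high_prob_mono, intro always_eventually allI ballI impI)
    fix n \<omega>
    assume *: "?P n \<omega>"
    have sp: "space F = UNIV" using sets_eq_imp_space_eq[OF sets_F] by simp
    have "\<bar>measure F {x. \<pi> x = v} - real (card {i\<in>{1..n}. \<pi> (\<epsilon> (int i) \<omega>) = v}) / real n\<bar> \<le> \<xi> / c" if "v \<in> range \<pi>" for v
    proof -
      have "(\<Sum>j=1..n. indicator {x. \<pi> x = v} (\<epsilon> (int j) \<omega>) :: real) = (\<Sum>j\<in>{i\<in>{1..n}. \<pi> (\<epsilon> (int i) \<omega>) = v}. 1)"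
        by (rule sum.mono_neutral_cong_right) (auto simp: indicator_def)
      moreover have "(\<integral>x. indicator {x. \<pi> x = v} x \<partial>F) = measure F {x. \<pi> x = v}" by (simp add: sp)
      ultimately show ?thesis using *[rule_format, OF that] by (simp add: abs_minus_commute)
    qed
    then have "(\<Sum>v\<in>range \<pi>. \<bar>measure F {x. \<pi> x = v} - real (card {i\<in>{1..n}. \<pi> (\<epsilon> (int i) \<omega>) = v}) / real n\<bar>)
        \<le> (\<Sum>v\<in>range \<pi>. \<xi> / c)" by (rule sum_mono)
    also have "\<dots> = \<xi>" using c by (simp add: c_def)
    finally show "(\<Sum>v\<in>range \<pi>. \<bar>measure F {x. \<pi> x = v} - real (card {i\<in>{1..n}. \<pi> (\<epsilon> (int i) \<omega>) = v}) / real n\<bar>) \<le> \<xi>" .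
  qed
qed

lemma approximation_error_close:
  fixes \<pi> :: "'a \<Rightarrow> 'a"
  assumes \<pi> [measurable]: "\<pi> \<in> borel_measurable borel" and bound: "\<And>x. norm (\<pi> x) \<le> 2 * norm x"
    and A: "(\<integral>\<^sup>+x. ennreal ((norm (x - \<pi> x))\<^sup>2) \<partial>F) \<le> ennreal A" "0 < A"
  shows "with_high_prob M (\<lambda>n \<omega>. (\<Sum>i=1..n. (norm (\<epsilon> (int i) \<omega> - \<pi> (\<epsilon> (int i) \<omega>)))\<^sup>2) / real n \<le> 2 * A)"
proof -
  note [measurable_cong] = sets_F
  define f where "f x = (norm (x - \<pi> x))\<^sup>2" for x
  have fm [measurable]: "f \<in> borel_measurable borel" unfolding f_def by measurable
  have fm' [measurable]: "f \<in> borel_measurable F" by measurable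
  have fb: "f x \<le> 9 * (norm x)\<^sup>2" for x
  proof -
    have "norm (x - \<pi> x) \<le> 3 * norm x" using norm_triangle_ineq4[of x "\<pi> x"] bound[of x] by simp
    then have "(norm (x - \<pi> x))\<^sup>2 \<le> (3 * norm x)\<^sup>2" by (intro power_mono) auto
    then show ?thesis by (simp add: f_def power_mult_distrib)
  qed
  have f0: "0 \<le> f x" for x by (simp add: f_def)
  have sq: "integrable F (\<lambda>x. (norm (f x))\<^sup>2)"
  proof (rule Bochner_Integration.integrable_bound)
    have "integrable F (\<lambda>x. norm x ^ 4)" using moment_eps[of 0] integral_eps(2)[of "\<lambda>x. norm x ^ 4" 0] by simp
    then show "integrable F (\<lambda>x. 81 * norm x ^ 4)" by simp
    have "(f x)\<^sup>2 \<le> 81 * norm x ^ 4" for x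
      using power_mono[OF fb f0, of x 2] by (simp add: power_mult_distrib flip: power_mult)
    then show "AE x in F. norm ((norm (f x))\<^sup>2) \<le> norm (81 * norm x ^ 4)" by simp
  qed measurable
  have "(\<integral>\<^sup>+x. ennreal (f x) \<partial>F) < \<infinity>" using A(1) by (auto simp: f_def le_less_trans[OF _ ennreal_less_top])
  then have fi: "integrable F f" using f0 by (intro integrableI_bounded) auto
  have "ennreal (\<integral>x. f x \<partial>F) = (\<integral>\<^sup>+x. ennreal (f x) \<partial>F)"
    using fi f0 by (intro nn_integral_eq_integral[symmetric]) auto
  also have "\<dots> \<le> ennreal A" using A(1) by (simp add: f_def)
  finally have mean: "(\<integral>x. f x \<partial>F) \<le> A" using A(2) by (simp add: ennreal_le_iff)
  have "with_high_prob M (\<lambda>n \<omega>. norm ((1 / real n) *\<^sub>R (\<Sum>j=1..n. f (\<epsilon> (int j) \<omega>)) - (\<integral>x. f x \<partial>F)) \<le> A)"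
    by (rule iid_average_close[OF fm sq A(2)])
  then show ?thesis
  proof (rule with_high_prob_mono, intro always_eventually allI ballI impI)
    fix n \<omega>
    assume "norm ((1 / real n) *\<^sub>R (\<Sum>j=1..n. f (\<epsilon> (int j) \<omega>)) - (\<integral>x. f x \<partial>F)) \<le> A"
    then have "(1 / real n) * (\<Sum>j=1..n. f (\<epsilon> (int j) \<omega>)) \<le> 2 * A"
      using mean by (simp only: real_norm_def real_scaleR_def abs_le_iff) linarith
    then show "(\<Sum>i=1..n. (norm (\<epsilon> (int i) \<omega> - \<pi> (\<epsilon> (int i) \<omega>)))\<^sup>2) / real n \<le> 2 * A" by (simp add: f_def)
  qed
qed

text \<open>The bound of \<open>bootstrap_mean_distance\<close> is \<open>B\<close> times a sum of six parts, each of which is kept below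
\<open>\<theta> = \<Delta> / (6 B)\<close>: the two initial values, the approximation error of the cells, the difference of the cell
frequencies, the average innovation, and all terms that contain \<open>\<tau>\<close>.\<close>

lemma bootstrap_mean_consistent:
  assumes HS: "hilbert_schmidt \<Psi>" and spectrum: "simple_positive_spectrum \<Gamma> lam"
    and k_pos: "\<And>n. 1 \<le> k n" and k_lim: "filterlim k at_top sequentially"
    and eigen_hat: "\<And>n x. eigensystem (emp_cov n x) (lamhat n x) (vhat n x)"
    and x0: "bounded_in_prob M (\<lambda>n \<omega>. x0 n (sample X n \<omega>))"
    and lim: "(\<lambda>n. 1 / (real n * (lam (k n))\<^sup>2)) \<longlonglongrightarrow> 0"
  shows "tends_to_zero_in_prob M (\<lambda>n \<omega>. of_nat n * mallows_dist_sq (mean_distr M X n)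
    (boot_mean_distr n (Psi_hat n (k n) (lamhat n (sample X n \<omega>)) (vhat n (sample X n \<omega>)) (sample X n \<omega>))
      (x0 n (sample X n \<omega>)) (sample X n \<omega>)))"
  unfolding tends_to_zero_in_prob_iff
proof (intro allI impI)
  fix \<Delta> :: real assume \<Delta>: "0 < \<Delta>"
  define \<rho> where "\<rho> = norm \<Psi>"
  have \<rho>: "0 \<le> \<rho>" "\<rho> < 1" using norm_Psi by (auto simp: \<rho>_def)
  \<comment> \<open>Contraction constant of the estimator: it exceeds \<open>\<rho>\<close> by \<open>(1 - \<rho>) / 2\<close>, which is the
     largest value admitted for \<open>\<tau>\<close>.\<close>
  define \<kappa> where "\<kappa> = (1 + \<rho>) / 2"
  have \<kappa>: "0 \<le> \<kappa>" "\<kappa> < 1" using \<rho> by (auto simp: \<kappa>_def)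
  define B where "B = 3 / (1 - \<kappa>)\<^sup>2"
  have B: "0 < B" using \<kappa> by (simp add: B_def)
  define \<theta> where "\<theta> = \<Delta> / (6 * B)"
  have \<theta>: "0 < \<theta>" using \<Delta> B by (simp add: \<theta>_def)
  define CS where "CS = 2 * (moment2 + sigma2) / (1 - norm \<Psi>)\<^sup>2"
  have CS: "0 \<le> CS" by (simp add: CS_def moment2_nonneg sigma2_nonneg)
  obtain K where K: "0 < K" and trace: "with_high_prob M (\<lambda>n \<omega>. (1 / real n) * (\<Sum>i<n. (norm (X (int i) \<omega>))\<^sup>2) \<le> K)"
    using trace_bounded by blast
  define A where "A = \<theta> / 12"
  have A: "0 < A" using \<theta> by (simp add: A_def)
  obtain \<pi> :: "'a \<Rightarrow> 'a" where \<pi>: "simple_function borel \<pi>" and \<pi>b: "\<And>x. norm (\<pi> x) \<le> 2 * norm x"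
    and \<pi>A: "(\<integral>\<^sup>+x. ennreal ((norm (x - \<pi> x))\<^sup>2) \<partial>F) \<le> ennreal A"
    using simple_approximation[OF A] by blast
  have fin: "finite (range \<pi>)" using simple_functionD(1)[OF \<pi>] by simp
  obtain D where D: "\<And>u w. u \<in> range \<pi> \<Longrightarrow> w \<in> range \<pi> \<Longrightarrow> norm (u - w) \<le> D"
  proof -
    obtain b where "\<And>u. u \<in> range \<pi> \<Longrightarrow> norm u \<le> b"
      using finite_imp_bounded[OF fin] by (auto simp: bounded_iff)
    then show thesis by (intro that[of "b + b"]) (meson add_mono norm_triangle_ineq4 order_trans)
  qed
  define \<xi> where "\<xi> = \<theta> / (4 * D\<^sup>2 + 1)"
  have D1: "0 < 4 * D\<^sup>2 + 1" by (simp add: add_nonneg_pos)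
  have \<xi>: "0 < \<xi>" using \<theta> D1 by (simp add: \<xi>_def)
  have D\<xi>: "4 * (D\<^sup>2 * \<xi>) \<le> \<theta>"
  proof -
    have "4 * (D\<^sup>2 * \<xi>) = (4 * D\<^sup>2) / (4 * D\<^sup>2 + 1) * \<theta>" by (simp add: \<xi>_def)
    also have "\<dots> \<le> 1 * \<theta>" using \<theta> D1 by (intro mult_right_mono) auto
    finally show ?thesis by simp
  qed
  define \<tau> where "\<tau> = min ((1 - \<rho>) / 2) (sqrt (\<theta> / (CS + 24 * K + 1)))"
  have den: "0 < CS + 24 * K + 1" using CS K by simp
  have "0 < \<tau>" using \<rho> \<theta> den by (simp add: \<tau>_def)
  moreover have "\<tau> \<le> (1 - \<rho>) / 2" unfolding \<tau>_def by (rule min.cobounded1)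
  ultimately have \<tau>: "0 < \<tau>" "\<tau> \<le> (1 - \<rho>) / 2" by auto
  have \<tau>2: "\<tau>\<^sup>2 * (CS + 24 * K + 1) \<le> \<theta>"
  proof -
    have "\<tau>\<^sup>2 \<le> (sqrt (\<theta> / (CS + 24 * K + 1)))\<^sup>2" using \<tau>(1) by (intro power_mono) (auto simp: \<tau>_def)
    also have "\<dots> = \<theta> / (CS + 24 * K + 1)" using \<theta> den by simp
    finally show ?thesis using den by (simp add: pos_le_divide_eq)
  qed
  define \<eta> where "\<eta> = sqrt (\<theta> / 12)"
  have \<eta>: "0 < \<eta>" "12 * \<eta>\<^sup>2 = \<theta>" using \<theta> by (auto simp: \<eta>_def)
  have F0: "(\<integral>x. x \<partial>F) = 0" using integral_eps(1)[of "\<lambda>x. x" 0] mean_eps[of 0] by simp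
  have sqF: "integrable F (\<lambda>x. (norm x)\<^sup>2)"
    using integrable_eps_sq[of 0] integral_eps(2)[of "\<lambda>x. (norm x)\<^sup>2" 0] by simp
  have mean: "with_high_prob M (\<lambda>n \<omega>. norm ((1 / real n) *\<^sub>R (\<Sum>j=1..n. \<epsilon> (int j) \<omega>)) \<le> \<eta>)"
    using iid_average_close[of "\<lambda>x. x", OF _ sqF \<eta>(1)] by (simp add: F0)
  have large: "\<forall>\<^sub>F n in sequentially. 1 \<le> n \<and> 2 * moment2 / real n \<le> \<theta>"
  proof -
    have "(\<lambda>n. 2 * moment2 * (1 / real n)) \<longlonglongrightarrow> 2 * moment2 * 0"
      by (intro tendsto_mult tendsto_const lim_1_over_n)
    then have "\<forall>\<^sub>F n in sequentially. 2 * moment2 * (1 / real n) < \<theta>" using \<theta> by (intro order_tendstoD) auto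
    then show ?thesis using eventually_ge_at_top[of 1] by eventually_elim simp
  qed
  have hp: "with_high_prob M (\<lambda>n \<omega>.
      (\<forall>y. norm (Psi_hat n (k n) (lamhat n (sample X n \<omega>)) (vhat n (sample X n \<omega>)) (sample X n \<omega>) y - \<Psi> y) \<le> \<tau> * norm y)
      \<and> (\<forall>t. X (t + 1) \<omega> = \<Psi> (X t \<omega>) + \<epsilon> (t + 1) \<omega>)
      \<and> (1 / real n) * (\<Sum>i<n. (norm (X (int i) \<omega>))\<^sup>2) \<le> K
      \<and> norm ((1 / real n) *\<^sub>R (\<Sum>j=1..n. \<epsilon> (int j) \<omega>)) \<le> \<eta>
      \<and> (\<Sum>v\<in>range \<pi>. \<bar>measure F {x. \<pi> x = v} - real (card {i\<in>{1..n}. \<pi> (\<epsilon> (int i) \<omega>) = v}) / real n\<bar>) \<le> \<xi>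
      \<and> (\<Sum>i=1..n. (norm (\<epsilon> (int i) \<omega> - \<pi> (\<epsilon> (int i) \<omega>)))\<^sup>2) / real n \<le> 2 * A
      \<and> (norm (x0 n (sample X n \<omega>)))\<^sup>2 / real n \<le> \<theta> / 2)"
    (is "with_high_prob M ?P")
    by (intro with_high_prob_conj Psi_hat_consistent[OF HS spectrum k_pos k_lim eigen_hat lim \<tau>(1)]
        with_high_prob_AE[OF AE_path] trace mean frequencies_close[OF \<pi> \<xi>]
        approximation_error_close[OF borel_measurable_simple_function[OF \<pi>] \<pi>b \<pi>A A]
        bounded_in_prob_sq_over_n[OF x0]) (use \<theta> in simp)
  show "with_high_prob M (\<lambda>n \<omega>. of_nat n * mallows_dist_sq (mean_distr M X n)
    (boot_mean_distr n (Psi_hat n (k n) (lamhat n (sample X n \<omega>)) (vhat n (sample X n \<omega>)) (sample X n \<omega>))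
      (x0 n (sample X n \<omega>)) (sample X n \<omega>)) \<le> ennreal \<Delta>)"
    using hp
  proof (rule with_high_prob_mono, intro eventually_mono[OF large] ballI impI)
    fix n \<omega>
    let ?x = "sample X n \<omega>"
    let ?T = "Psi_hat n (k n) (lamhat n ?x) (vhat n ?x) ?x"
    assume n: "1 \<le> n \<and> 2 * moment2 / real n \<le> \<theta>" and *: "?P n \<omega>"
    from * have T\<tau>: "\<And>y. norm (?T y - \<Psi> y) \<le> \<tau> * norm y" and path: "\<forall>t. X (t + 1) \<omega> = \<Psi> (X t \<omega>) + \<epsilon> (t + 1) \<omega>"
      by blast+
    have T: "bounded_linear ?T" by (rule Psi_hat_bounded_linear[OF eigen_hat])
    have T\<kappa>: "norm (?T y) \<le> \<kappa> * norm y" for y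
    proof -
      have "norm (?T y) \<le> norm (?T y - \<Psi> y) + norm (\<Psi> y)" using norm_triangle_ineq[of "?T y - \<Psi> y" "\<Psi> y"] by simp
      also have "\<dots> \<le> (1 - \<rho>) / 2 * norm y + \<rho> * norm y"
        using order_trans[OF T\<tau> mult_right_mono[OF \<tau>(2) norm_ge_zero]] norm_blinfun[of \<Psi> y]
        unfolding \<rho>_def by (intro add_mono) auto
      also have "\<dots> = \<kappa> * norm y" by (simp add: \<kappa>_def field_simps)
      finally show ?thesis .
    qed
    define z where "z = centered_residual n ?T ?x"
    define TV where "TV = (\<Sum>v\<in>range \<pi>. \<bar>measure F {x. \<pi> x = v} - real (card {i\<in>{1..n}. \<pi> (\<epsilon> (int i) \<omega>) = v}) / real n\<bar>)"
    define a1 where "a1 = (\<Sum>i=1..n. (norm (\<epsilon> (int i) \<omega> - \<pi> (\<epsilon> (int i) \<omega>)))\<^sup>2) / real n"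
    define a2 where "a2 = (\<Sum>i=1..n. (norm (\<epsilon> (int i) \<omega> - z i))\<^sup>2) / real n"
    have TV: "0 \<le> TV" "TV \<le> \<xi>" using * by (auto simp: TV_def sum_nonneg)
    have a1: "0 \<le> a1" "a1 \<le> 2 * A" using * by (auto simp: a1_def sum_nonneg)
    have a2: "a2 \<le> 3 * (2 * (\<tau>\<^sup>2 * K) + \<eta>\<^sup>2)"
      unfolding a2_def z_def using * \<tau>(1) n by (intro centered_residual_error[OF path]) auto
    have a20: "0 \<le> a2" by (simp add: a2_def sum_nonneg)
    obtain Q where Q: "Q \<in> couplings F (distr (uniform_count_measure {1..n}) borel z)"
      and cost: "(\<integral>\<^sup>+w. ennreal ((norm (fst w - snd w))\<^sup>2) \<partial>Q) \<le> ennreal (4 * (A + a1 + D\<^sup>2 * TV + a2))"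
      unfolding a1_def a2_def TV_def
      by (rule coupling_with_perturbed_empirical[OF prob_space_F sets_F conjunct1[OF n] \<pi> D \<pi>A less_imp_le[OF A],
            where y="\<lambda>i. \<epsilon> (int i) \<omega>" and z=z]) 
    have q: "0 \<le> 4 * (A + a1 + D\<^sup>2 * TV + a2)" using A a1 TV a20 by simp
    have "of_nat n * mallows_dist_sq (mean_distr M X n) (boot_mean_distr n ?T (x0 n ?x) ?x)
      \<le> ennreal (3 / (1 - \<kappa>)\<^sup>2 * (2 * (moment2 + (norm (x0 n ?x))\<^sup>2) / real n
        + \<tau>\<^sup>2 * (2 * (moment2 + sigma2) / (1 - norm \<Psi>)\<^sup>2) + 4 * (A + a1 + D\<^sup>2 * TV + a2)))"
      using n by (intro bootstrap_mean_distance[OF T T\<kappa> \<kappa> T\<tau> less_imp_le[OF \<tau>(1)] _ _ Q cost q])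
        (auto simp: residual_distr_def z_def)
    also have "\<dots> \<le> ennreal \<Delta>"
    proof (rule ennreal_leI)
      have 1: "2 * (moment2 + (norm (x0 n ?x))\<^sup>2) / real n \<le> 2 * \<theta>"
      proof -
        have "(norm (x0 n ?x))\<^sup>2 / real n \<le> \<theta> / 2" using * by blast
        moreover have "2 * (moment2 + (norm (x0 n ?x))\<^sup>2) / real n = 2 * moment2 / real n + 2 * ((norm (x0 n ?x))\<^sup>2 / real n)"
          by (simp add: add_divide_distrib distrib_left)
        ultimately show ?thesis using n by linarith
      qed
      have "D\<^sup>2 * TV \<le> D\<^sup>2 * \<xi>" using TV(2) by (intro mult_left_mono) auto
      then have "4 * (D\<^sup>2 * TV) \<le> \<theta>" using D\<xi> by linarith
      moreover have "\<tau>\<^sup>2 * CS + 24 * (\<tau>\<^sup>2 * K) \<le> \<theta>"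
      proof -
        have "\<tau>\<^sup>2 * (CS + 24 * K + 1) = \<tau>\<^sup>2 * CS + 24 * (\<tau>\<^sup>2 * K) + \<tau>\<^sup>2" by (simp add: algebra_simps)
        then show ?thesis using \<tau>2 by (smt (verit) zero_le_power2)
      qed
      ultimately have "2 * (moment2 + (norm (x0 n ?x))\<^sup>2) / real n + \<tau>\<^sup>2 * CS + 4 * (A + a1 + D\<^sup>2 * TV + a2) \<le> 6 * \<theta>"
        using 1 a1(2) a2 \<eta>(2) \<theta> A_def by (simp add: distrib_left)
      then have "B * (2 * (moment2 + (norm (x0 n ?x))\<^sup>2) / real n + \<tau>\<^sup>2 * CS + 4 * (A + a1 + D\<^sup>2 * TV + a2)) \<le> B * (6 * \<theta>)"
        using B by (intro mult_left_mono) auto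
      also have "B * (6 * \<theta>) = \<Delta>" using B by (simp add: \<theta>_def)
      finally show "3 / (1 - \<kappa>)\<^sup>2 * (2 * (moment2 + (norm (x0 n ?x))\<^sup>2) / real n
        + \<tau>\<^sup>2 * (2 * (moment2 + sigma2) / (1 - norm \<Psi>)\<^sup>2) + 4 * (A + a1 + D\<^sup>2 * TV + a2)) \<le> \<Delta>"
        by (simp add: B_def CS_def)
    qed
    finally show "of_nat n * mallows_dist_sq (mean_distr M X n) (boot_mean_distr n ?T (x0 n ?x) ?x) \<le> ennreal \<Delta>" .
  qed
qed

end

theorem theorem4p1:
  fixes M :: "'w measure"
    and X \<epsilon> :: "int \<Rightarrow> 'w \<Rightarrow> 'a::{real_inner,banach,second_countable_topology}"
    and \<Psi> :: "'a \<Rightarrow>\<^sub>L 'a"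
    and lam :: "nat \<Rightarrow> real"
    and k :: "nat \<Rightarrow> nat"
    and lamhat :: "nat \<Rightarrow> (nat \<Rightarrow> 'a) \<Rightarrow> nat \<Rightarrow> real"
    and vhat :: "nat \<Rightarrow> (nat \<Rightarrow> 'a) \<Rightarrow> nat \<Rightarrow> 'a"
    and x0 :: "nat \<Rightarrow> (nat \<Rightarrow> 'a) \<Rightarrow> 'a"
  defines "a \<equiv> spectral_gap lam"
    and "\<Psi>hat \<equiv> (\<lambda>n x. Psi_hat n (k n) (lamhat n x) (vhat n x) x)"
  assumes "prob_space M"
    and stationary: "strictly_stationary M X"
    and far1: "far1 M \<Psi> \<epsilon> X"
    and mean_X: "\<And>t. integrable M (X t) \<and> (\<integral>\<omega>. X t \<omega> \<partial>M) = 0"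
    and iid: "iid M \<epsilon>"
    and mean_eps: "\<And>t. integrable M (\<epsilon> t) \<and> (\<integral>\<omega>. \<epsilon> t \<omega> \<partial>M) = 0"
    and moment_eps: "\<And>t. integrable M (\<lambda>\<omega>. norm (\<epsilon> t \<omega>) ^ 4)"
    and HS: "hilbert_schmidt \<Psi>"
    and norm_Psi: "norm \<Psi> < 1"
    and spectrum: "simple_positive_spectrum (cov_operator M (X 0)) lam"
    and k_pos: "\<And>n. 1 \<le> k n"
    and k_lim: "filterlim k at_top sequentially"
    and eigen_hat: "\<And>n x. eigensystem (emp_cov n x) (lamhat n x) (vhat n x)"
    and x0: "bounded_in_prob M (\<lambda>n \<omega>. x0 n (sample X n \<omega>))"
    and rate1: "(\<lambda>n. real (k n) / real n * (\<Sum>j=1..k n. 1 / (a j)\<^sup>2)) \<longlonglongrightarrow> 0"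
    and rate2: "\<exists>\<beta>>1/2. (\<lambda>n. 1 / lam (k n)) \<in> O(\<lambda>n. real n powr (1/4) / ln (real n) powr \<beta>)"
    and rate3: "\<exists>\<beta>>1. (\<lambda>n. 1 / lam (k n) * (\<Sum>j=1..k n. 1 / a j))
                  \<in> O(\<lambda>n. real n powr (1/4) / ln (real n) powr \<beta>)"
  shows "tends_to_zero_in_prob M (\<lambda>n \<omega>.
           of_nat n * mallows_dist_sq (mean_distr M X n)
             (boot_mean_distr n (\<Psi>hat n (sample X n \<omega>))
               (x0 n (sample X n \<omega>)) (sample X n \<omega>)))"
proof -
  interpret far1_model M X \<epsilon> \<Psi>
  proof (rule far1_model.intro)
    show "prob_space M" by fact
    show "far1_model_axioms M X \<epsilon> \<Psi>"
      using stationary far1 mean_X iid mean_eps moment_eps norm_Psi by unfold_locales auto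
  qed
  obtain \<beta> where "1/2 < \<beta>" "(\<lambda>n. 1 / lam (k n)) \<in> O(\<lambda>n. real n powr (1/4) / ln (real n) powr \<beta>)"
    using rate2 by blast
  then have "(\<lambda>n. 1 / (real n * (lam (k n))\<^sup>2)) \<longlonglongrightarrow> 0" by (intro rate_tendsto[of \<beta>]) auto
  then show ?thesis
    unfolding \<Psi>hat_def by (rule bootstrap_mean_consistent[OF HS spectrum k_pos k_lim eigen_hat x0])
qed

end
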